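(* Let $1\le p<\infty$. (1) If $F\in H^p(\Pi_{\mathbb{BC}^+})$, then $$F(Z)=\frac{1}{2\pi i}\int_{(-\infty,\infty)_{\mathbb{D}}}\frac{F(W)}{W-Z}\,dW\odot dW^\dagger\qquad\text{for all } Z\in\Pi_{\mathbb{BC}^+},$$ where $F(W)$ for $W\in(-\infty,\infty)_{\mathbb{D}}$ denotes the boundary function of $F$, and the integral vanishes for all $Z\in\Pi_{\mathbb{BC}^-}$. (2) Conversely, if $H\in L_k^p(dm)$ and $$\frac{1}{2\pi i}\int_{(-\infty,\infty)_{\mathbb{D}}}\frac{H(W)}{W-Z}\,dW\odot dW^\dagger=0\qquad\text{for all } Z\in\Pi_{\mathbb{BC}^-},$$ then for $Z\in\Pi_{\mathbb{BC}^+}$ this integral represents a bicomplex function $F\in H^p(\Pi_{\mathbb{BC}^+})$ whose boundary function satisfies $F(x_0,x_3)=H(x_0,x_3)$ almost everywhere.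
   Context: Bicomplex numbers: $\mathbb{BC}=\{z_1+jz_2: z_1,z_2\in\mathbb{C}\}$, where $\mathbb{C}=\mathbb{C}(i)$, $i^2=j^2=-1$, $ij=ji=k$, $k^2=1$ (a commutative ring). Put $e=\frac{1+ij}{2}$, $e^\dagger=\frac{1-ij}{2}$; these are idempotents with $e e^\dagger=0$, $e+e^\dagger=1$. Every $Z=z_1+jz_2$ is uniquely $Z=e\beta_1+e^\dagger\beta_2$ with $\beta_1=z_1-iz_2$, $\beta_2=z_1+iz_2\in\mathbb{C}$; algebraic operations (including division by elements with both components nonzero) act componentwise. $\Pi_{\mathbb{BC}^+}=\{e\beta_1+e^\dagger\beta_2:\operatorname{Im}\beta_1>0,\operatorname{Im}\beta_2>0\}$ and $\Pi_{\mathbb{BC}^-}=\{e\beta_1+e^\dagger\beta_2:\operatorname{Im}\beta_1<0,\operatorname{Im}\beta_2<0\}$. Let $\Pi^+\subset\mathbb{C}$ be the complex upper half-plane. $H^p(\Pi^+)$ is the usual Hardy space of holomorphic $f$ on $\Pi^+$ with $\sup_{y>0}\int_{-\infty}^\infty|f(x+iy)|^pdx<\infty$; such $f$ has a nontangential boundary function $f(x)$ for a.e. $x\in\mathbb{R}$. The bicomplex Hardy space is $H^p(\Pi_{\mathbb{BC}^+})=eH^p(\Pi^+)+e^\dagger H^p(\Pi^+)$, i.e. functions $F(e\beta_1+e^\dagger\beta_2)=eF_1(\beta_1)+e^\dagger F_2(\beta_2)$ with $F_1,F_2\in H^p(\Pi^+)$. The boundary function of $F$ is $F(es_1+e^\dagger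 s_2)=eF_1(s_1)+e^\dagger F_2(s_2)$ for $s_1,s_2\in\mathbb{R}$, built from the boundary functions of $F_1,F_2$. One writes $F(x_0,x_3)$ for its value at $x_0+kx_3=e(x_0+x_3)+e^\dagger(x_0-x_3)$, $x_0,x_3\in\mathbb{R}$; similarly for $H$. $(-\infty,\infty)_{\mathbb{D}}=e(-\infty,\infty)+e^\dagger(-\infty,\infty)$. $L_k^p(dm)=eL^p(\mathbb{R})+e^\dagger L^p(\mathbb{R})$, the product-type functions $H(es_1+e^\dagger s_2)=eH_1(s_1)+e^\dagger H_2(s_2)$ with $H_1,H_2\in L^p(\mathbb{R})$ (Lebesgue measure). For product-type $G=eG_1+e^\dagger G_2$, the integral is componentwise: with $Z=e\beta_1+e^\dagger\beta_2$, $$\int_{(-\infty,\infty)_{\mathbb{D}}}\frac{G(W)}{W-Z}\,dW\odot dW^\dagger=e\int_{-\infty}^\infty\frac{G_1(s)}{s-\beta_1}ds+e^\dagger\int_{-\infty}^\infty\frac{G_2(s)}{s-\beta_2}ds .$$ *)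

theory Defs
  imports "HOL-Analysis.Analysis"
begin

section \<open>Bicomplex numbers\<close>

text \<open>\<open>Bicomplex z1 z2\<close> is the bicomplex number \<open>z1 + j z2\<close>.\<close>

datatype bicomplex = Bicomplex (bc_fst: complex) (bc_snd: complex)

instantiation bicomplex :: comm_ring_1
begin

definition "0 = Bicomplex 0 0"
definition "1 = Bicomplex 1 0"
definition "Z + W = Bicomplex (bc_fst Z + bc_fst W) (bc_snd Z + bc_snd W)"
definition "Z - W = Bicomplex (bc_fst Z - bc_fst W) (bc_snd Z - bc_snd W)"
definition "- Z = Bicomplex (- bc_fst Z) (- bc_snd Z)"
definition "Z * W = Bicomplex (bc_fst Z * bc_fst W - bc_snd Z * bc_snd W)
                              (bc_fst Z * bc_snd W + bc_snd Z * bc_fst W)"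

instance
  by standard
    (simp_all add: zero_bicomplex_def one_bicomplex_def plus_bicomplex_def minus_bicomplex_def
      uminus_bicomplex_def times_bicomplex_def algebra_simps)

end

lemmas bicomplex_ops_defs =
  zero_bicomplex_def one_bicomplex_def plus_bicomplex_def minus_bicomplex_def
  uminus_bicomplex_def times_bicomplex_def

definition bc_of_complex :: "complex \<Rightarrow> bicomplex"
  where "bc_of_complex z = Bicomplex z 0"

definition bc_j :: bicomplex
  where "bc_j = Bicomplex 0 1"

definition bc_k :: bicomplex
  where "bc_k = bc_of_complex \<i> * bc_j"

definition bc_e :: bicomplex
  where "bc_e = bc_of_complex (1/2) * (1 + bc_of_complex \<i> * bc_j)"

definition bc_e_dag :: bicomplex
  where "bc_e_dag = bc_of_complex (1/2) * (1 - bc_of_complex \<i> * bc_j)"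

definition bc_idem :: "complex \<Rightarrow> complex \<Rightarrow> bicomplex"
  where "bc_idem b1 b2 = bc_e * bc_of_complex b1 + bc_e_dag * bc_of_complex b2"

definition bc_comp1 :: "bicomplex \<Rightarrow> complex"
  where "bc_comp1 Z = bc_fst Z - \<i> * bc_snd Z"

definition bc_comp2 :: "bicomplex \<Rightarrow> complex"
  where "bc_comp2 Z = bc_fst Z + \<i> * bc_snd Z"

lemmas bicomplex_consts_defs =
  bc_of_complex_def bc_j_def bc_k_def bc_e_def bc_e_dag_def bc_idem_def bc_comp1_def bc_comp2_def

lemma bc_units: "bc_j * bc_j = - 1" "bc_of_complex \<i> * bc_of_complex \<i> = - 1" "bc_k * bc_k = 1"
  by (simp_all add: bicomplex_ops_defs bicomplex_consts_defs)

lemma bicomplex_eq_z1_j_z2: "Bicomplex z1 z2 = bc_of_complex z1 + bc_j * bc_of_complex z2"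
  by (simp add: bicomplex_ops_defs bicomplex_consts_defs)

lemma bc_e_idempotents:
  "bc_e * bc_e = bc_e" "bc_e_dag * bc_e_dag = bc_e_dag" "bc_e * bc_e_dag = 0" "bc_e + bc_e_dag = 1"
  by (simp_all add: bicomplex_ops_defs bicomplex_consts_defs)

lemma bc_idem_explicit: "bc_idem b1 b2 = Bicomplex ((b1 + b2) / 2) (\<i> * (b1 - b2) / 2)"
  by (simp add: bicomplex_ops_defs bicomplex_consts_defs field_simps)

lemma bc_comp_idem [simp]: "bc_comp1 (bc_idem b1 b2) = b1" "bc_comp2 (bc_idem b1 b2) = b2"
  by (simp_all add: bc_idem_explicit bc_comp1_def bc_comp2_def field_simps)

lemma bc_idem_comp [simp]: "bc_idem (bc_comp1 Z) (bc_comp2 Z) = Z"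
  by (cases Z) (simp add: bc_idem_explicit bc_comp1_def bc_comp2_def field_simps)

lemma bicomplex_eq_iff: "Z = W \<longleftrightarrow> bc_comp1 Z = bc_comp1 W \<and> bc_comp2 Z = bc_comp2 W"
  by (metis bc_idem_comp)

lemma bc_comp_add [simp]:
  "bc_comp1 (Z + W) = bc_comp1 Z + bc_comp1 W" "bc_comp2 (Z + W) = bc_comp2 Z + bc_comp2 W"
  by (simp_all add: bicomplex_ops_defs bicomplex_consts_defs algebra_simps)

lemma bc_comp_diff [simp]:
  "bc_comp1 (Z - W) = bc_comp1 Z - bc_comp1 W" "bc_comp2 (Z - W) = bc_comp2 Z - bc_comp2 W"
  by (simp_all add: bicomplex_ops_defs bicomplex_consts_defs algebra_simps)

lemma bc_comp_mult [simp]: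
  "bc_comp1 (Z * W) = bc_comp1 Z * bc_comp1 W" "bc_comp2 (Z * W) = bc_comp2 Z * bc_comp2 W"
  by (simp_all add: bicomplex_ops_defs bicomplex_consts_defs algebra_simps)

lemma bc_comp_of_complex [simp]:
  "bc_comp1 (bc_of_complex z) = z" "bc_comp2 (bc_of_complex z) = z"
  by (simp_all add: bicomplex_consts_defs)

lemma bc_of_complex_eq_idem: "bc_of_complex z = bc_idem z z"
  by (simp add: bicomplex_eq_iff)

text \<open>
  Division is componentwise.  It is the ring division when both idempotent components of the
  divisor are nonzero; otherwise the convention \<open>x / 0 = 0\<close> applies in each component.
\<close>

instantiation bicomplex :: inverse
begin

definition "inverse Z = bc_idem (inverse (bc_comp1 Z)) (inverse (bc_comp2 Z))"
definition "Z div W = Z * inverse (W :: bicomplex)"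

instance ..

end

lemma bc_comp_divide [simp]:
  "bc_comp1 (Z / W) = bc_comp1 Z / bc_comp1 W" "bc_comp2 (Z / W) = bc_comp2 Z / bc_comp2 W"
  by (simp_all add: divide_bicomplex_def inverse_bicomplex_def field_simps)

lemma bc_divide_mult_cancel:
  assumes "bc_comp1 W \<noteq> 0" "bc_comp2 W \<noteq> 0"
  shows "(Z / W) * W = Z"
  using assms by (simp add: bicomplex_eq_iff)

definition bc_upper :: "bicomplex set"
  where "bc_upper = {bc_idem b1 b2 | b1 b2. Im b1 > 0 \<and> Im b2 > 0}"

definition bc_lower :: "bicomplex set"
  where "bc_lower = {bc_idem b1 b2 | b1 b2. Im b1 < 0 \<and> Im b2 < 0}"

definition bc_hyp :: "real \<Rightarrow> real \<Rightarrow> bicomplex"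
  where "bc_hyp x0 x3 = bc_of_complex (of_real x0) + bc_k * bc_of_complex (of_real x3)"

lemma bc_hyp_eq_idem: "bc_hyp x0 x3 = bc_idem (of_real (x0 + x3)) (of_real (x0 - x3))"
  by (simp add: bicomplex_eq_iff bc_hyp_def bc_k_def bc_j_def)
     (simp add: bc_comp1_def bc_comp2_def flip: mult.assoc)


section \<open>Functions of product type\<close>

text \<open>
  If \<open>F (e b1 + e\<^sup>\<dagger> b2) = e F1 b1 + e\<^sup>\<dagger> F2 b2\<close>, the component functions are recovered by
  evaluating on the diagonal, where \<open>e b + e\<^sup>\<dagger> b = b\<close>.
\<close>

definition bc_fun1 :: "(bicomplex \<Rightarrow> bicomplex) \<Rightarrow> complex \<Rightarrow> complex"
  where "bc_fun1 F b = bc_comp1 (F (bc_of_complex b))"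

definition bc_fun2 :: "(bicomplex \<Rightarrow> bicomplex) \<Rightarrow> complex \<Rightarrow> complex"
  where "bc_fun2 F b = bc_comp2 (F (bc_of_complex b))"

lemma bc_fun_product:
  assumes "\<And>b1 b2. b1 \<in> S \<Longrightarrow> b2 \<in> S \<Longrightarrow> F (bc_idem b1 b2) = bc_idem (F1 b1) (F2 b2)" "b \<in> S"
  shows "bc_fun1 F b = F1 b" "bc_fun2 F b = F2 b"
  using assms by (simp_all add: bc_fun1_def bc_fun2_def bc_of_complex_eq_idem)

text \<open>
  Integration over \<open>(-\<infinity>,\<infinity>)\<^sub>D\<close> with respect to \<open>dW \<odot> dW\<^sup>\<dagger>\<close>, componentwise; only meant for
  integrands of product type, since it reads off the component functions on the diagonal.
\<close>

definition bc_integrable :: "(bicomplex \<Rightarrow> bicomplex) \<Rightarrow> bool"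
  where "bc_integrable G \<longleftrightarrow>
    integrable lebesgue (\<lambda>s::real. bc_fun1 G (of_real s)) \<and>
    integrable lebesgue (\<lambda>s::real. bc_fun2 G (of_real s))"

definition bc_integral :: "(bicomplex \<Rightarrow> bicomplex) \<Rightarrow> bicomplex"
  where "bc_integral G =
    bc_idem (LINT s|lebesgue. bc_fun1 G (of_real (s::real)))
            (LINT s|lebesgue. bc_fun2 G (of_real (s::real)))"

lemma bc_integral_cauchy:
  assumes "\<And>s1 s2 :: real. G (bc_idem (of_real s1) (of_real s2)) = bc_idem (G1 s1) (G2 s2)"
  shows "bc_integral (\<lambda>W. G W / (W - bc_idem b1 b2)) =
    bc_idem (LINT s|lebesgue. G1 s / (of_real (s::real) - b1))
            (LINT s|lebesgue. G2 s / (of_real (s::real) - b2))"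
  by (simp add: bc_integral_def bc_fun1_def bc_fun2_def bc_of_complex_eq_idem assms)


section \<open>Hardy and Lebesgue spaces\<close>

definition hardy :: "real \<Rightarrow> (complex \<Rightarrow> complex) set"
  where "hardy p = {f. f holomorphic_on {z. Im z > 0} \<and>
    (SUP y\<in>{0<..}. \<integral>\<^sup>+ x. ennreal (cmod (f (Complex x y)) powr p) \<partial>lebesgue) < \<infinity>}"

definition bc_hardy :: "real \<Rightarrow> (bicomplex \<Rightarrow> bicomplex) set"
  where "bc_hardy p = {F. \<exists>F1\<in>hardy p. \<exists>F2\<in>hardy p.
    \<forall>b1 b2. Im b1 > 0 \<longrightarrow> Im b2 > 0 \<longrightarrow> F (bc_idem b1 b2) = bc_idem (F1 b1) (F2 b2)}"

definition Lp_line :: "real \<Rightarrow> (real \<Rightarrow> complex) set"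
  where "Lp_line p = {h. h \<in> borel_measurable lebesgue \<and>
    integrable lebesgue (\<lambda>s. cmod (h s) powr p)}"

definition bc_Lp :: "real \<Rightarrow> (bicomplex \<Rightarrow> bicomplex) set"
  where "bc_Lp p = {H. \<exists>H1\<in>Lp_line p. \<exists>H2\<in>Lp_line p.
    \<forall>s1 s2 :: real. H (bc_idem (of_real s1) (of_real s2)) = bc_idem (H1 s1) (H2 s2)}"


section \<open>Nontangential boundary functions\<close>

text \<open>The nontangential limit is the limit within every open cone with vertex \<open>x\<close>.\<close>

definition has_nt_limit :: "(complex \<Rightarrow> complex) \<Rightarrow> real \<Rightarrow> complex \<Rightarrow> bool"
  where "has_nt_limit f x L \<longleftrightarrow> (\<forall>a>0.
    (f \<longlongrightarrow> L) (at (of_real x) within {z. Im z > 0 \<and> \<bar>Re z - x\<bar> < a * Im z}))"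

text \<open>Unspecified at the points where there is no nontangential limit.\<close>

definition nt_boundary :: "(complex \<Rightarrow> complex) \<Rightarrow> real \<Rightarrow> complex"
  where "nt_boundary f x = (THE L. has_nt_limit f x L)"

text \<open>
  For bicomplex \<open>F\<close> of product type the boundary function lives on the hyperbolic numbers
  \<open>W = e s1 + e\<^sup>\<dagger> s2\<close> with \<open>s1, s2\<close> real; these are recovered as the real parts of the
  idempotent components of \<open>W\<close>.
\<close>

definition bc_boundary_exists :: "(bicomplex \<Rightarrow> bicomplex) \<Rightarrow> bicomplex \<Rightarrow> bool"
  where "bc_boundary_exists F W \<longleftrightarrow>
    (\<exists>L. has_nt_limit (bc_fun1 F) (Re (bc_comp1 W)) L) \<and>
    (\<exists>L. has_nt_limit (bc_fun2 F) (Re (bc_comp2 W)) L)"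

definition bc_boundary :: "(bicomplex \<Rightarrow> bicomplex) \<Rightarrow> bicomplex \<Rightarrow> bicomplex"
  where "bc_boundary F W =
    bc_idem (nt_boundary (bc_fun1 F) (Re (bc_comp1 W))) (nt_boundary (bc_fun2 F) (Re (bc_comp2 W)))"

lemma has_nt_limit_unique:
  assumes "has_nt_limit f x L" "has_nt_limit f x M"
  shows "L = M"
proof -
  let ?C = "{z. Im z > 0 \<and> \<bar>Re z - x\<bar> < 1 * Im z}"
  have "complex_of_real x islimpt ?C"
  proof (subst islimpt_approachable, intro allI impI)
    fix d :: real assume "d > 0"
    then show "\<exists>z\<in>?C. z \<noteq> complex_of_real x \<and> dist z (complex_of_real x) < d"
      by (intro bexI[of _ "Complex x (d/2)"])
         (auto simp: dist_norm cmod_def complex_eq_iff)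
  qed
  then have "at (complex_of_real x) within ?C \<noteq> bot"
    by (simp add: trivial_limit_within)
  moreover have "(f \<longlongrightarrow> L) (at (of_real x) within ?C)" "(f \<longlongrightarrow> M) (at (of_real x) within ?C)"
    using assms unfolding has_nt_limit_def by (auto dest: spec[of _ 1])
  ultimately show ?thesis
    by (rule tendsto_unique)
qed

lemma nt_boundary_eq: "has_nt_limit f x L \<Longrightarrow> nt_boundary f x = L"
  unfolding nt_boundary_def using has_nt_limit_unique by blast

end

theory Submission
  imports Defs "HOL-Complex_Analysis.Complex_Analysis"
begin

text \<open>
  The statement splits into the two idempotent components, so it is about functions on the complex
  half-plane.

  For the converse direction the Cauchy integral of \<open>H\<close> at \<open>z\<close> equals its difference with the (vanishing)
  integral at the conjugate point, that is the Poisson integral of \<open>H\<close>; Jensen's inequality and Lebesgue's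
  differentiation theorem give the rest.

  For the direct part, dividing by \<open>(1 - \<i> \<delta> z)\<^sup>2\<close> and letting \<open>\<delta> \<rightarrow> 0\<close> reduces everything to \<open>p = 1\<close> with
  quadratic decay above every height. There \<open>sqrt \<bar>g\<bar>\<close> has a harmonic majorant bounded in \<open>L\<^sup>2\<close>, which is
  the real part of a Cauchy integral \<open>G\<close>. The functions \<open>g / (1 + G)\<^sup>2\<close> and \<open>1 / (1 + G)\<close> are bounded, hence
  have boundary values by \<open>L\<^sup>2\<close> theory; so \<open>g\<close> has boundary values \<open>h\<close>, and the majorant provides the
  domination that makes \<open>g(x + \<i> \<epsilon>)\<close> converge to \<open>h\<close> in \<open>L\<^sup>1\<close>. This replaces the usual Blaschke
  factorization.
\<close>

section \<open>Cauchy and Poisson formulas in the half-plane\<close>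

text \<open>The obstacle is p = 1: an L^1 bound on horizontal lines yields at first only a limiting
  measure, and its absolute continuity is the theorem of F. and M. Riesz. The square root gets
  around it: \<open>sqrt |g|\<close> is bounded in L^2, where orthogonality alone produces boundary
  values, and it is subharmonic, so its Poisson extensions from lower and lower lines increase to a
  majorant. Squaring returns to L^1. The exponent 2 of the damping factor serves twice: it gives an
  integrable weight on lines, and its square root still decays like 1/|z|, enough for the Cauchy
  integral of the boundary data and for the maximum principle at infinity. From |g| <= (Re G)^2 <=
  |1 + G|^2 both quotients are bounded by 1, and \<open>g\<close> is the first divided by the square
  of the second. This requires the boundary value of \<open>1 / (1 + G)\<close> to be nonzero almost
  everywhere, which is where Kolmogorov's trick enters. Decay holds only above positive heights, so
  the formulas are proved for shifted functions and passed to the limit.\<close>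

lemma one_plus_norm_le_dist:
  fixes a w :: complex
  assumes "d > 0" "d \<le> cmod (w - a)"
  shows "1 + cmod w \<le> ((1 + cmod a + d) / d) * cmod (w - a)"
proof -
  have "1 + cmod w \<le> 1 + cmod a + cmod (w - a)"
    using norm_triangle_ineq[of "w - a" a] by simp
  also have "\<dots> \<le> (1 + cmod a) * (cmod (w - a) / d) + cmod (w - a)"
    using assms mult_left_mono[of 1 "cmod (w - a) / d" "1 + cmod a"] by simp
  also have "\<dots> = ((1 + cmod a + d) / d) * cmod (w - a)"
    using assms by (simp add: field_simps)
  finally show ?thesis .
qed

text \<open>Trades the kernel 1/|w - a|, on a set at distance at least \<open>d\<close> from its
  pole, for the weight 1/(1 + |w|), which does not depend on the pole.\<close>

lemma inverse_dist_le:
  fixes a w :: complex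
  assumes "d > 0" "d \<le> cmod (w - a)"
  shows "1 / cmod (w - a) \<le> ((1 + cmod a + d) / d) / (1 + cmod w)"
proof -
  have "cmod (w - a) > 0" "1 + cmod w > 0"
    using assms by (auto intro: add_pos_nonneg)
  moreover have "1 / u \<le> M / v" if "u > 0" "v > 0" "v \<le> M * u" for u v M :: real
    using that by (simp add: field_simps)
  ultimately show ?thesis
    using one_plus_norm_le_dist[OF assms] by blast
qed

lemma nn_integral_arctan_half:
  assumes "y > (0::real)"
  shows "(\<integral>\<^sup>+ t. ennreal (y / (t\<^sup>2 + y\<^sup>2)) * indicator {0..} t \<partial>lborel) = ennreal (pi / 2)"
proof -
  have "((\<lambda>t. arctan (t / y)) \<longlongrightarrow> pi / 2) at_top"
    by (rule filterlim_compose[OF tendsto_arctan_at_top])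
       (use assms in \<open>auto intro!: filterlim_tendsto_pos_mult_at_top[OF tendsto_const, of "1/y", simplified] filterlim_ident\<close>)
  moreover have "((\<lambda>t. arctan (t / y)) has_real_derivative y / (t\<^sup>2 + y\<^sup>2)) (at t)" for t
    using assms by (auto intro!: derivative_eq_intros simp: field_simps power2_eq_square)
  ultimately have "(\<integral>\<^sup>+ t. ennreal (y / (t\<^sup>2 + y\<^sup>2)) * indicator {0..} t \<partial>lborel)
      = ennreal (pi / 2 - arctan (0 / y))"
    using assms by (intro nn_integral_FTC_atLeast) auto
  then show ?thesis by simp
qed

definition poisson :: "real \<Rightarrow> real \<Rightarrow> real"
  where "poisson y t = y / (pi * (t\<^sup>2 + y\<^sup>2))"

lemma poisson_measurable [measurable]: "poisson y \<in> borel_measurable borel"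
  unfolding poisson_def by measurable

lemma poisson_nonneg [simp]: "y > 0 \<Longrightarrow> 0 \<le> poisson y t"
  by (auto simp: poisson_def intro!: divide_nonneg_nonneg)

lemma poisson_pos: "y > 0 \<Longrightarrow> 0 < poisson y t"
  unfolding poisson_def by (intro divide_pos_pos mult_pos_pos) (auto intro: add_nonneg_pos)

lemma poisson_minus [simp]: "poisson y (- t) = poisson y t"
  by (simp add: poisson_def)

lemma poisson_commute: "poisson y (s - t) = poisson y (t - s)"
  by (simp add: poisson_def power2_commute)

lemma poisson_le: "y > 0 \<Longrightarrow> poisson y t \<le> 1 / (pi * y)"
  using divide_left_mono[of "pi * y * y" "pi * (t\<^sup>2 + y\<^sup>2)" y]
  by (simp add: poisson_def power2_eq_square add_pos_nonneg add_nonneg_pos)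

lemma nn_integral_poisson:
  assumes y: "y > 0"
  shows "(\<integral>\<^sup>+ s. ennreal (poisson y (x - s)) \<partial>lborel) = 1"
proof -
  have "(\<integral>\<^sup>+ s. ennreal (poisson y (x - s)) \<partial>lborel) = (\<integral>\<^sup>+ t. ennreal (poisson y t) \<partial>lborel)"
    using nn_integral_real_affine[of "\<lambda>t. ennreal (poisson y t)" "-1" x] by simp
  also have "\<dots> = (\<integral>\<^sup>+ t. ennreal (poisson y t) * indicator {0..} t
                       + ennreal (poisson y t) * indicator {..0} t \<partial>lborel)"
    by (intro nn_integral_cong_AE, use AE_lborel_singleton[of 0] in eventually_elim)
       (auto simp: indicator_def)
  also have "\<dots> = (\<integral>\<^sup>+ t. ennreal (poisson y t) * indicator {0..} t \<partial>lborel)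
                  + (\<integral>\<^sup>+ t. ennreal (poisson y t) * indicator {..0} t \<partial>lborel)"
    by (rule nn_integral_add) auto
  also have "(\<integral>\<^sup>+ t. ennreal (poisson y t) * indicator {..0} t \<partial>lborel)
      = (\<integral>\<^sup>+ t. ennreal (poisson y t) * indicator {0..} t \<partial>lborel)"
    using nn_integral_real_affine[of "\<lambda>t. ennreal (poisson y t) * indicator {..0} t" "-1" 0]
    by (simp add: indicator_def)
  also have "(\<integral>\<^sup>+ t. ennreal (poisson y t) * indicator {0..} t \<partial>lborel)
      = (\<integral>\<^sup>+ t. ennreal (1/pi) * (ennreal (y / (t\<^sup>2 + y\<^sup>2)) * indicator {0..} t) \<partial>lborel)"
    by (intro nn_integral_cong) (use y in \<open>auto simp: poisson_def indicator_def simp flip: ennreal_mult\<close>)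
  also have "\<dots> = ennreal (1/pi) * ennreal (pi/2)"
    using nn_integral_arctan_half[OF y] by (subst nn_integral_cmult) auto
  also have "ennreal (1/pi) * ennreal (pi/2) = ennreal (1/2)"
    by (subst ennreal_mult[symmetric]) auto
  also have "ennreal (1/2) + ennreal (1/2) = 1"
    by (subst ennreal_plus[symmetric]) auto
  finally show ?thesis .
qed

lemma poisson_has_integral:
  assumes "y > 0"
  shows "integrable lborel (\<lambda>s. poisson y (x - s))" "(LINT s|lborel. poisson y (x - s)) = 1"
proof -
  show 1: "integrable lborel (\<lambda>s. poisson y (x - s))"
    using assms nn_integral_poisson[OF assms, of x] by (intro integrableI_nonneg) auto
  have "(LINT s|lborel. poisson y (x - s)) = enn2real (\<integral>\<^sup>+ s. ennreal (poisson y (x - s)) \<partial>lborel)"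
    using assms by (intro integral_eq_nn_integral) auto
  then show "(LINT s|lborel. poisson y (x - s)) = 1"
    by (simp add: nn_integral_poisson assms)
qed

lemma integrable_inverse_square: "integrable lborel (\<lambda>s::real. 1 / (1 + \<bar>s\<bar>)\<^sup>2)"
proof (rule Bochner_Integration.integrable_bound)
  show "integrable lborel (\<lambda>s. pi * poisson 1 (0 - s))"
    using poisson_has_integral(1)[of 1 0] by (intro integrable_mult_right) auto
  have "1 + s\<^sup>2 \<le> (1 + \<bar>s\<bar>)\<^sup>2" for s :: real
    by (simp add: power2_sum)
  then show "AE s in lborel. norm (1 / (1 + \<bar>s\<bar>)\<^sup>2) \<le> norm (pi * poisson 1 (0 - s))"
    by (auto simp: poisson_def add.commute intro!: AE_I2 divide_left_mono mult_pos_pos add_pos_nonneg)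
qed auto

text \<open>Cauchy's formula on the rectangle with base [-n, n] and height n. With the kernel the
  integrand is O(1/|w|^2), so the three upper sides contribute O(1/n). Holomorphy slightly below the
  real line allows the base to lie on it.\<close>

lemma halfplane_Cauchy:
  assumes hol: "f holomorphic_on {w. Im w > -\<eta>}" and \<eta>: "\<eta> > 0" and z: "Im z > 0"
    and bound: "\<And>w. Im w \<ge> 0 \<Longrightarrow> cmod (f w) \<le> C / (1 + cmod w)"
  shows "integrable lborel (\<lambda>s. f (of_real s) / (of_real s - z))"
    and "(LINT s|lborel. f (of_real s) / (of_real s - z)) = 2 * of_real pi * \<i> * f z"
proof -
  define F where "F = (\<lambda>w. f w / (w - z))"
  define M where "M = (1 + cmod z + Im z) / Im z"
  have C: "C \<ge> 0" using bound[of 0] norm_ge_zero[of "f 0"] by (simp del: norm_ge_zero)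
  have contf: "continuous_on {w. Im w > -\<eta>} f"
    by (rule holomorphic_on_imp_continuous_on[OF hol])
  have nz: "of_real s \<noteq> z" for s using z by auto
  have contF: "continuous_on UNIV (\<lambda>s. F (of_real s))"
    unfolding F_def
    by (intro continuous_intros continuous_on_compose2[OF contf]) (use \<eta> nz in auto)
  have M: "M > 0" using z by (auto simp: M_def intro!: divide_pos_pos add_nonneg_pos)
  have bF: "cmod (F (of_real s)) \<le> C * M * (1 / (1 + \<bar>s\<bar>)\<^sup>2)" for s
  proof -
    have "Im z \<le> cmod (of_real s - z)"
      using abs_Im_le_cmod[of "of_real s - z"] by simp
    from inverse_dist_le[OF z this] have "1 / cmod (of_real s - z) \<le> M / (1 + \<bar>s\<bar>)"
      by (simp add: M_def)
    moreover have "cmod (f (of_real s)) \<le> C / (1 + \<bar>s\<bar>)"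
      using bound[of "of_real s"] by simp
    ultimately have "cmod (f (of_real s)) * (1 / cmod (of_real s - z)) \<le> (C / (1 + \<bar>s\<bar>)) * (M / (1 + \<bar>s\<bar>))"
      using C by (intro mult_mono) auto
    then show ?thesis
      by (simp add: F_def norm_divide power2_eq_square)
  qed
  have intF: "integrable lborel (\<lambda>s. F (of_real s))"
    by (rule Bochner_Integration.integrable_bound[OF integrable_mult_right[OF integrable_inverse_square, of "C * M"]])
       (use contF C M bF in \<open>auto intro: borel_measurable_continuous_onI\<close>)
  then show "integrable lborel (\<lambda>s. f (of_real s) / (of_real s - z))"
    by (simp add: F_def)
  define I where "I = (\<lambda>n::nat. LINT s|lborel. indicator {-real n..real n} s *\<^sub>R F (of_real s))"
  have limI: "I \<longlonglongrightarrow> (LINT s|lborel. F (of_real s))"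
    unfolding I_def
  proof (rule integral_dominated_convergence[where w = "\<lambda>s. cmod (F (of_real s))"])
    show "AE s in lborel. (\<lambda>n. indicator {-real n..real n} s *\<^sub>R F (of_real s)) \<longlonglongrightarrow> F (of_real s)"
    proof (rule AE_I2)
      fix s :: real
      obtain N :: nat where N: "\<bar>s\<bar> \<le> real N" using real_arch_simple by blast
      have "eventually (\<lambda>n. F (of_real s) = indicator {-real n..real n} s *\<^sub>R F (of_real s)) sequentially"
        using eventually_ge_at_top[of N]
        by eventually_elim (use N in \<open>auto simp: indicator_def\<close>)
      then show "(\<lambda>n. indicator {-real n..real n} s *\<^sub>R F (of_real s)) \<longlonglongrightarrow> F (of_real s)"
        by (rule Lim_transform_eventually[OF tendsto_const])
    qed
  qed (use intF in \<open>auto simp: indicator_def intro!: borel_measurable_integrable\<close>)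
  \<comment> \<open>The condition on \<open>n\<close> puts \<open>z\<close> inside the rectangle and
    makes the denominator positive; the 4 comes from the total length 4n of the three upper
    sides.\<close>
  have est: "cmod (I n - 2 * of_real pi * \<i> * f z) \<le> 4 * C / (real n - cmod z)"
    if n: "real n > cmod z + 1" for n
  proof -
    define a1 where "a1 = Complex (- real n) 0"
    define a2 where "a2 = Complex (real n) 0"
    define a3 where "a3 = Complex (real n) (real n)"
    define a4 where "a4 = Complex (- real n) (real n)"
    have n0: "real n > 0" using n norm_ge_zero[of z] by linarith
    have zb: "z \<in> box a1 a3"
      using n z abs_Re_le_cmod[of z] abs_Im_le_cmod[of z]
      by (auto simp: a1_def a3_def in_box_complex_iff)
    have rp: "rectpath a1 a3 = linepath a1 a2 +++ linepath a2 a3 +++ linepath a3 a4 +++ linepath a4 a1"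
      by (simp add: rectpath_def a1_def a2_def a3_def a4_def Let_def)
    have sub: "path_image (rectpath a1 a3) \<subseteq> {w. Im w > -\<eta>} - {z}"
    proof -
      have "path_image (rectpath a1 a3) = cbox a1 a3 - box a1 a3"
        using n0 by (intro path_image_rectpath_cbox_minus_box) (simp_all add: a1_def a3_def)
      moreover have "cbox a1 a3 \<subseteq> {w. Im w > -\<eta>}"
        using \<eta> by (auto simp: a1_def a3_def in_cbox_complex_iff)
      ultimately show ?thesis using zb by blast
    qed
    have "(F has_contour_integral (2*pi * \<i> * winding_number (rectpath a1 a3) z * f z)) (rectpath a1 a3)"
      unfolding F_def
    proof (rule Cauchy_integral_formula_convex_simple[OF _ hol])
      show "convex {w. Im w > -\<eta>}" by (simp add: convex_halfspace_Im_gt)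
      have "open {w. Im w > -\<eta>}" by (simp add: open_halfspace_Im_gt)
      then show "z \<in> interior {w. Im w > -\<eta>}"
        using z \<eta> by (simp add: interior_open)
    qed (use sub in auto)
    then have tot: "(F has_contour_integral (2*pi * \<i> * f z)) (rectpath a1 a3)"
      using winding_number_rectpath[OF zb] by simp
    have sides: "F contour_integrable_on linepath a1 a2" "F contour_integrable_on linepath a2 a3"
       "F contour_integrable_on linepath a3 a4" "F contour_integrable_on linepath a4 a1"
      using tot unfolding rp contour_integrable_on_def[symmetric]
      by (auto simp: contour_integrable_joinI has_contour_integral_integrable
               dest!: has_contour_integral_integrable)
    have sum: "contour_integral (linepath a1 a2) F + (contour_integral (linepath a2 a3) F +
       (contour_integral (linepath a3 a4) F + contour_integral (linepath a4 a1) F)) = 2*pi * \<i> * f z"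
      using contour_integral_unique[OF tot] sides unfolding rp
      by (simp add: contour_integrable_joinI)
    have bd: "cmod (F w) \<le> C / (real n * (real n - cmod z))"
      if "Im w \<ge> 0" "cmod w \<ge> real n" for w
    proof -
      have "cmod (w - z) \<ge> real n - cmod z"
        using norm_triangle_ineq2[of w z] that by linarith
      moreover have "cmod (f w) \<le> C / real n"
        by (rule order.trans[OF bound[OF that(1)]]) (use C n0 that in \<open>auto intro!: divide_left_mono mult_pos_pos add_pos_nonneg\<close>)
      ultimately have "cmod (f w) / cmod (w - z) \<le> (C / real n) / (real n - cmod z)"
        using n C by (intro frac_le) auto
      then show ?thesis by (simp add: F_def norm_divide)
    qed
    have D: "C / (real n * (real n - cmod z)) \<ge> 0" using C n n0 by auto
    have cl: "cmod w \<ge> real n" "Im w \<ge> 0"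
      if "w \<in> closed_segment a2 a3 \<union> closed_segment a3 a4 \<union> closed_segment a4 a1" for w
    proof -
      have "\<bar>Re w\<bar> = real n \<or> \<bar>Im w\<bar> = real n" "Im w \<ge> 0"
        using that n0 by (auto simp: a1_def a2_def a3_def a4_def closed_segment_same_Re
            closed_segment_same_Im closed_segment_eq_real_ivl)
      then show "cmod w \<ge> real n" "Im w \<ge> 0"
        using abs_Re_le_cmod[of w] abs_Im_le_cmod[of w] by auto
    qed
    let ?D = "C / (real n * (real n - cmod z))"
    have e2: "cmod (contour_integral (linepath a2 a3) F) \<le> ?D * cmod (a3 - a2)"
      by (rule contour_integral_bound_linepath[OF sides(2) D]) (use bd cl in auto)
    have e3: "cmod (contour_integral (linepath a3 a4) F) \<le> ?D * cmod (a4 - a3)"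
      by (rule contour_integral_bound_linepath[OF sides(3) D]) (use bd cl in auto)
    have e4: "cmod (contour_integral (linepath a4 a1) F) \<le> ?D * cmod (a1 - a4)"
      by (rule contour_integral_bound_linepath[OF sides(4) D]) (use bd cl in auto)
    have len: "cmod (a3 - a2) = real n" "cmod (a4 - a3) = 2 * real n" "cmod (a1 - a4) = real n"
      by (simp_all add: a1_def a2_def a3_def a4_def cmod_def real_sqrt_mult)
    have "(F has_contour_integral contour_integral (linepath a1 a2) F) (linepath a1 a2)"
      using sides(1) by (simp add: has_contour_integral_integral)
    then have hi: "((\<lambda>s. F (of_real s)) has_integral contour_integral (linepath a1 a2) F) {-real n..real n}"
      using n0 by (subst (asm) has_contour_integral_linepath_Reals_iff)
        (auto simp: a1_def a2_def complex_is_Real_iff)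
    have si: "set_integrable lborel {-real n..real n} (\<lambda>s. F (of_real s))"
      unfolding set_integrable_def by (rule integrable_mult_indicator[OF _ intF]) auto
    have "I n = contour_integral (linepath a1 a2) F"
      using set_borel_integral_eq_integral(2)[OF si] integral_unique[OF hi]
      by (simp add: I_def set_lebesgue_integral_def)
    then have "I n - 2 * of_real pi * \<i> * f z = - (contour_integral (linepath a2 a3) F +
       (contour_integral (linepath a3 a4) F + contour_integral (linepath a4 a1) F))"
      using sum by (simp add: algebra_simps)
    then have "cmod (I n - 2 * of_real pi * \<i> * f z) \<le> ?D * real n + (?D * (2 * real n) + ?D * real n)"
      using e2 e3 e4 unfolding len
      by (smt (verit) norm_minus_cancel norm_triangle_ineq)
    also have "\<dots> = 4 * C / (real n - cmod z)"
    proof -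
      have "4 * (?D * real n) = 4 * C / (real n - cmod z)" using n0 by simp
      moreover have "d * u + (d * (2 * u) + d * u) = 4 * (d * u)" for d u :: real
        by simp
      ultimately show ?thesis by metis
    qed
    finally show ?thesis .
  qed
  have "(\<lambda>n. 4 * C / (real n - cmod z)) \<longlonglongrightarrow> 0"
    by (intro real_tendsto_divide_at_top[OF tendsto_const])
       (auto intro!: filterlim_at_top_add_at_top filterlim_real_sequentially
             filterlim_tendsto_add_at_top[OF tendsto_const, where c = "- cmod z", simplified add.commute, simplified])
  moreover have "eventually (\<lambda>n. cmod (I n - 2 * of_real pi * \<i> * f z) \<le> 4 * C / (real n - cmod z)) sequentially"
  proof -
    obtain N where "cmod z + 1 < real N" using reals_Archimedean2 by blast
    then have "\<forall>n\<ge>N. cmod z + 1 < real n" by auto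
    then show ?thesis using est by (auto simp: eventually_sequentially)
  qed
  ultimately have "(\<lambda>n. I n - 2 * of_real pi * \<i> * f z) \<longlonglongrightarrow> 0"
    by (rule Lim_null_comparison[rotated])
  then have "I \<longlonglongrightarrow> 2 * of_real pi * \<i> * f z"
    by (simp add: LIM_zero_iff)
  then show "(LINT s|lborel. f (of_real s) / (of_real s - z)) = 2 * of_real pi * \<i> * f z"
    using LIMSEQ_unique[OF limI] by (simp add: F_def)
qed

text \<open>Cauchy's formula at \<i> for f(w) (w - \<i>): the extra factor costs one power of decay,
  vanishes at \<i> and cancels the kernel.\<close>

lemma halfplane_Cauchy_0:
  assumes hol: "f holomorphic_on {w. Im w > -\<eta>}" and \<eta>: "\<eta> > 0"
    and bound: "\<And>w. Im w \<ge> 0 \<Longrightarrow> cmod (f w) \<le> C / (1 + cmod w)\<^sup>2"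
  shows "integrable lborel (\<lambda>s. f (of_real s))" and "(LINT s|lborel. f (of_real s)) = 0"
proof -
  have bd: "cmod (f w * (w - \<i>)) \<le> C / (1 + cmod w)" if w: "Im w \<ge> 0" for w
  proof -
    have "cmod (w - \<i>) \<le> 1 + cmod w"
      using norm_triangle_ineq4[of w \<i>] by simp
    then have "cmod (f w) * cmod (w - \<i>) \<le> C / (1 + cmod w)\<^sup>2 * (1 + cmod w)"
      using order.trans[OF norm_ge_zero bound[OF w]] by (intro mult_mono bound w) auto
    also have "\<dots> = C / (1 + cmod w)"
      by (simp add: power2_eq_square add_nonneg_eq_0_iff)
    finally show ?thesis by (simp add: norm_mult)
  qed
  have nz: "complex_of_real s \<noteq> \<i>" for s
    by (metis Im_complex_of_real imaginary_unit.sel(2) zero_neq_one)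
  have h: "(\<lambda>w. f w * (w - \<i>)) holomorphic_on {w. Im w > -\<eta>}"
    by (intro holomorphic_intros hol)
  note c = halfplane_Cauchy[OF h \<eta> _ bd, of \<i>]
  show "integrable lborel (\<lambda>s. f (of_real s))" and "(LINT s|lborel. f (of_real s)) = 0"
    using c nz by auto
qed

lemma poisson_as_Cauchy:
  assumes "y > 0"
  shows "(Complex x y - cnj (Complex x y)) / (of_real s - cnj (Complex x y)) / (of_real s - Complex x y)
     = 2 * of_real pi * \<i> * of_real (poisson y (x - s))"
proof -
  have "(of_real s - cnj (Complex x y)) * (of_real s - Complex x y) = of_real ((x - s)\<^sup>2 + y\<^sup>2)"
    by (simp add: complex_eq_iff power2_eq_square algebra_simps)
  moreover have "Complex x y - cnj (Complex x y) = 2 * \<i> * of_real y"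
    by (simp add: complex_eq_iff)
  ultimately show ?thesis
    by (simp add: poisson_def divide_divide_eq_left)
qed

text \<open>A bounded \<open>k\<close> is multiplied by (z - cnj z)/(w - cnj z), which is 1 at
  \<open>z\<close> and decays like 1/|w|, so that Cauchy's formula at \<open>z\<close> applies. On
  the real line the two kernels multiply to 2 pi \<i> times the Poisson kernel. The new pole lies at
  height \<open>- y\<close>, whence the strip of width \<open>min \<eta> y\<close>.\<close>

lemma bounded_holomorphic_Poisson:
  assumes hol: "k holomorphic_on {w. Im w > -\<eta>}" and \<eta>: "\<eta> > 0" and y: "y > 0"
    and bound: "\<And>w. Im w \<ge> 0 \<Longrightarrow> cmod (k w) \<le> C"
  shows "integrable lborel (\<lambda>s. of_real (poisson y (x - s)) * k (of_real s))"
    and "(LINT s|lborel. of_real (poisson y (x - s)) * k (of_real s)) = k (Complex x y)"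
proof -
  define z where "z = Complex x y"
  have z: "Im z > 0" "Im z = y" using y by (auto simp: z_def)
  define f where "f = (\<lambda>w. k w * ((z - cnj z) / (w - cnj z)))"
  define M where "M = C * (cmod (z - cnj z) * ((1 + cmod (cnj z) + y) / y))"
  have C: "C \<ge> 0" using order.trans[OF norm_ge_zero bound[of 0]] by simp
  have hf: "f holomorphic_on {w. Im w > - min \<eta> y}"
    unfolding f_def
    by (intro holomorphic_intros holomorphic_on_subset[OF hol]) (use z in \<open>auto simp: complex_eq_iff\<close>)
  have bf: "cmod (f w) \<le> M / (1 + cmod w)" if w: "Im w \<ge> 0" for w
  proof -
    have "y \<le> cmod (w - cnj z)"
      using abs_Im_le_cmod[of "w - cnj z"] w z by simp
    from inverse_dist_le[OF y this]
    have "cmod (k w) * (cmod (z - cnj z) * (1 / cmod (w - cnj z)))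
       \<le> C * (cmod (z - cnj z) * (((1 + cmod (cnj z) + y) / y) / (1 + cmod w)))"
      using bound[OF w] C by (intro mult_mono mult_left_mono) auto
    then show ?thesis by (simp add: f_def M_def norm_mult norm_divide)
  qed
  have eq: "f (of_real s) / (of_real s - z) = 2 * of_real pi * \<i> * (of_real (poisson y (x - s)) * k (of_real s))" for s
  proof -
    have "f (of_real s) / (of_real s - z)
        = k (of_real s) * ((z - cnj z) / (of_real s - cnj z) / (of_real s - z))"
      by (simp add: f_def)
    also have "\<dots> = k (of_real s) * (2 * of_real pi * \<i> * of_real (poisson y (x - s)))"
      unfolding z_def by (subst poisson_as_Cauchy[OF y]) (rule refl)
    finally show ?thesis by (simp add: mult_ac)
  qed
  have fz: "f z = k z" using z by (simp add: f_def complex_eq_iff)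
  have m: "min \<eta> y > 0" using \<eta> y by simp
  note c = halfplane_Cauchy[OF hf m z(1) bf]
  show "integrable lborel (\<lambda>s. of_real (poisson y (x - s)) * k (of_real s))"
    using integrable_mult_left[OF c(1)[unfolded eq], of "1 / (2 * of_real pi * \<i>)"] by simp
  show "(LINT s|lborel. of_real (poisson y (x - s)) * k (of_real s)) = k (Complex x y)"
    using c(2) unfolding eq fz by (simp add: z_def)
qed

text \<open>On the real line \<open>poisson b (s - t)\<close> is the real part of the function
  \<open>k\<close>, whose only pole is at height \<open>- b\<close>. So \<open>k\<close> is bounded
  on the closed upper half-plane and obeys the Poisson formula; the real part of that formula is the
  claim.\<close>

lemma poisson_semigroup:
  assumes "a > 0" "b > 0"
  shows "(LINT s|lborel. poisson a (x - s) * poisson b (s - t)) = poisson (a + b) (x - t)"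
    and "integrable lborel (\<lambda>s. poisson a (x - s) * poisson b (s - t))"
proof -
  define k where "k = (\<lambda>w. \<i> / (of_real pi * (w + (\<i> * of_real b - of_real t))))"
  have nz: "w + (\<i> * of_real b - of_real t) \<noteq> 0" if "Im w > - b" for w
    using that by (auto simp: complex_eq_iff)
  have hk: "k holomorphic_on {w. Im w > - b}"
    unfolding k_def by (intro holomorphic_intros) (use nz in auto)
  have bk: "cmod (k w) \<le> 1 / (pi * b)" if "Im w \<ge> 0" for w
  proof -
    have "b \<le> cmod (w + (\<i> * of_real b - of_real t))"
      using abs_Im_le_cmod[of "w + (\<i> * of_real b - of_real t)"] that by simp
    then show ?thesis using assms
      by (auto simp: k_def norm_divide norm_mult intro!: divide_left_mono mult_pos_pos mult_left_mono
          intro: less_le_trans)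
  qed
  have Rek: "Re (k (Complex u v)) = poisson (v + b) (u - t)" if "v \<ge> 0" for u v
  proof -
    have "Complex u v + (\<i> * of_real b - of_real t) = Complex (u - t) (v + b)"
      by (simp add: complex_eq_iff)
    then have "k (Complex u v) = \<i> / (of_real pi * Complex (u - t) (v + b))"
      by (simp add: k_def)
    also have "\<dots> = of_real (1 / pi) * (\<i> * inverse (Complex (u - t) (v + b)))"
      by (simp add: divide_inverse)
    also have "Re \<dots> = (1 / pi) * Re (\<i> * inverse (Complex (u - t) (v + b)))"
      by (simp only: times_complex.sel Re_complex_of_real Im_complex_of_real mult_zero_left diff_zero)
    also have "Re (\<i> * inverse (Complex (u - t) (v + b))) = (v + b) / ((u - t)\<^sup>2 + (v + b)\<^sup>2)"
      by (simp add: minus_divide_left)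
    also have "(1 / pi) * ((v + b) / ((u - t)\<^sup>2 + (v + b)\<^sup>2)) = (v + b) / (pi * ((u - t)\<^sup>2 + (v + b)\<^sup>2))"
      by simp
    also have "\<dots> = poisson (v + b) (u - t)" by (simp add: poisson_def)
    finally show ?thesis .
  qed
  have Rek0: "Re (k (of_real u)) = poisson b (u - t)" for u
    using Rek[of 0 u] by (simp add: complex_of_real_def)
  note c = bounded_holomorphic_Poisson[OF hk assms(2) assms(1) bk, of x]
  show "integrable lborel (\<lambda>s. poisson a (x - s) * poisson b (s - t))"
    using integrable_Re[OF c(1)] by (simp add: Rek0)
  show "(LINT s|lborel. poisson a (x - s) * poisson b (s - t)) = poisson (a + b) (x - t)"
    using arg_cong[OF c(2), of Re] assms c(1) integral_Re[OF c(1)] by (simp add: Rek0 Rek)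
qed

section \<open>Lebesgue points and nontangential limits\<close>

text \<open>Writes the kernel as a superposition of indicators of the intervals |t| <= r, so that
  bounds on averages over intervals pass to Poisson integrals.\<close>

lemma inverse_square_layer_cake:
  assumes y: "y > (0::real)"
  shows "ennreal (1 / (t\<^sup>2 + y\<^sup>2)) =
    (\<integral>\<^sup>+ r. ennreal (2 * r / (r\<^sup>2 + y\<^sup>2)\<^sup>2) * indicator {\<bar>t\<bar>..} r \<partial>lborel)"
proof -
  have pos: "r\<^sup>2 + y\<^sup>2 > 0" for r using y by (intro add_nonneg_pos) auto
  have lim: "((\<lambda>r. - 1 / (r\<^sup>2 + y\<^sup>2)) \<longlongrightarrow> 0) at_top"
    by (intro real_tendsto_divide_at_top[OF tendsto_const]
         filterlim_tendsto_add_at_top[OF tendsto_const, where c = "y\<^sup>2", simplified add.commute]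
         filterlim_pow_at_top filterlim_ident) auto
  have "((\<lambda>r. - 1 / (r\<^sup>2 + y\<^sup>2)) has_real_derivative 2 * r / (r\<^sup>2 + y\<^sup>2)\<^sup>2) (at r)" for r
    using pos[of r] by (auto intro!: derivative_eq_intros simp: power2_eq_square)
  then have "(\<integral>\<^sup>+ r. ennreal (2 * r / (r\<^sup>2 + y\<^sup>2)\<^sup>2) * indicator {\<bar>t\<bar>..} r \<partial>lborel)
      = ennreal (0 - (- 1 / (\<bar>t\<bar>\<^sup>2 + y\<^sup>2)))"
    using lim by (intro nn_integral_FTC_atLeast) auto
  then show ?thesis by simp
qed

text \<open>Tonelli applied to the layer-cake form: each layer is an average over an interval around
  \<open>x\<close>, and the remaining weight in \<open>r\<close> is at most (4 eta/pi) y/(r^2 +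
  y^2), whose integral over the half-line is 2 eta.\<close>

lemma nn_integral_poisson_le:
  fixes \<psi> :: "real \<Rightarrow> ennreal"
  assumes [measurable]: "\<psi> \<in> borel_measurable borel" and y: "y > 0" and \<eta>: "\<eta> \<ge> 0"
    and avg: "\<And>r. r > 0 \<Longrightarrow> (\<integral>\<^sup>+ s. \<psi> s * indicator {x-r..x+r} s \<partial>lborel) \<le> ennreal (2 * \<eta> * r)"
  shows "(\<integral>\<^sup>+ s. ennreal (poisson y (x - s)) * \<psi> s \<partial>lborel) \<le> ennreal (2 * \<eta>)"
proof -
  define w where "w = (\<lambda>r::real. 2 * r / (r\<^sup>2 + y\<^sup>2)\<^sup>2)"
  have [measurable]: "w \<in> borel_measurable borel" unfolding w_def by measurable
  have pos: "r\<^sup>2 + y\<^sup>2 > 0" for r using y by (intro add_nonneg_pos) auto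
  have [measurable]: "(\<lambda>p. indicator {\<bar>x - fst p\<bar>..} (snd p) :: ennreal) \<in> borel_measurable (borel \<Otimes>\<^sub>M borel)"
    unfolding atLeast_def indicator_def by measurable
  have "(\<integral>\<^sup>+ s. ennreal (poisson y (x - s)) * \<psi> s \<partial>lborel)
      = (\<integral>\<^sup>+ s. (\<integral>\<^sup>+ r. ennreal (y / pi) * (ennreal (w r) * indicator {\<bar>x - s\<bar>..} r) * \<psi> s \<partial>lborel) \<partial>lborel)"
  proof (intro nn_integral_cong)
    fix s
    have "ennreal (poisson y (x - s)) = ennreal (y / pi) * ennreal (1 / ((x - s)\<^sup>2 + y\<^sup>2))"
      using y by (subst ennreal_mult[symmetric]) (auto simp: poisson_def)
    also have "\<dots> = (\<integral>\<^sup>+ r. ennreal (y / pi) * (ennreal (w r) * indicator {\<bar>x - s\<bar>..} r) \<partial>lborel)"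
      unfolding inverse_square_layer_cake[OF y] w_def by (rule nn_integral_cmult[symmetric]) simp
    finally show "ennreal (poisson y (x - s)) * \<psi> s
        = (\<integral>\<^sup>+ r. ennreal (y / pi) * (ennreal (w r) * indicator {\<bar>x - s\<bar>..} r) * \<psi> s \<partial>lborel)"
      by (simp add: nn_integral_multc)
  qed
  also have "\<dots> = (\<integral>\<^sup>+ r. (\<integral>\<^sup>+ s. ennreal (y / pi) * (ennreal (w r) * indicator {\<bar>x - s\<bar>..} r) * \<psi> s \<partial>lborel) \<partial>lborel)"
    by (rule lborel_pair.Fubini'[symmetric]) (simp add: split_beta')
  also have "\<dots> \<le> (\<integral>\<^sup>+ r. ennreal (4 * \<eta> / pi) * (ennreal (y / (r\<^sup>2 + y\<^sup>2)) * indicator {0..} r) \<partial>lborel)"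
  proof (rule nn_integral_mono)
    fix r :: real
    have "(\<integral>\<^sup>+ s. ennreal (y / pi) * (ennreal (w r) * indicator {\<bar>x - s\<bar>..} r) * \<psi> s \<partial>lborel)
       = (\<integral>\<^sup>+ s. ennreal (y / pi) * ennreal (w r) * (\<psi> s * indicator {x-r..x+r} s) \<partial>lborel)"
      by (intro nn_integral_cong) (auto simp: indicator_def mult_ac)
    also have "\<dots> = ennreal (y / pi) * ennreal (w r) * (\<integral>\<^sup>+ s. \<psi> s * indicator {x-r..x+r} s \<partial>lborel)"
      by (rule nn_integral_cmult) simp
    also have "\<dots> \<le> ennreal (4 * \<eta> / pi) * (ennreal (y / (r\<^sup>2 + y\<^sup>2)) * indicator {0..} r)"
    proof (cases "r > 0")
      case True
      have 0: "w r * (2 * \<eta> * r) = 4 * \<eta> * (r\<^sup>2 / (r\<^sup>2 + y\<^sup>2)\<^sup>2)"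
        by (simp add: w_def power2_eq_square)
      \<comment> \<open>One factor r^2 of the numerator comes from the weight and the interval
        length together; enlarging it to r^2 + y^2 cancels one power and leaves the arctangent
        density.\<close>
      have "r\<^sup>2 / (r\<^sup>2 + y\<^sup>2)\<^sup>2 \<le> (r\<^sup>2 + y\<^sup>2) / (r\<^sup>2 + y\<^sup>2)\<^sup>2"
        by (intro divide_right_mono) auto
      also have "\<dots> = 1 / (r\<^sup>2 + y\<^sup>2)" using pos[of r] by (simp add: power2_eq_square)
      finally have 1: "w r * (2 * \<eta> * r) \<le> 4 * \<eta> * (1 / (r\<^sup>2 + y\<^sup>2))"
        unfolding 0 using \<eta> by (intro mult_left_mono) auto
      have wr: "w r \<ge> 0" using True by (simp add: w_def)
      have "ennreal (y / pi) * ennreal (w r) * (\<integral>\<^sup>+ s. \<psi> s * indicator {x-r..x+r} s \<partial>lborel)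
        \<le> ennreal (y / pi) * ennreal (w r) * ennreal (2 * \<eta> * r)"
        by (intro mult_left_mono avg True) auto
      also have "\<dots> = ennreal (y / pi * (w r * (2 * \<eta> * r)))"
      proof -
        have "ennreal a * ennreal b * ennreal d = ennreal (a * (b * d))"
          if "a \<ge> 0" "b \<ge> 0" "d \<ge> 0" for a b d
          using that by (simp add: ennreal_mult mult.assoc)
        then show ?thesis using wr y \<eta> True by simp
      qed
      also have "\<dots> \<le> ennreal (y / pi * (4 * \<eta> * (1 / (r\<^sup>2 + y\<^sup>2))))"
        using y by (intro ennreal_leI mult_left_mono 1) auto
      also have "\<dots> = ennreal (4 * \<eta> / pi) * ennreal (y / (r\<^sup>2 + y\<^sup>2))"
        using y \<eta> by (subst ennreal_mult[symmetric]) (auto simp: mult_ac)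
      finally show ?thesis using True by simp
    next
      case False
      \<comment> \<open>For r <= 0 the weight is nonpositive, and \<open>ennreal\<close> sends
        negative reals to 0.\<close>
      then have "ennreal (w r) = 0"
        by (auto intro!: ennreal_neg divide_nonpos_nonneg simp: w_def)
      then show ?thesis by simp
    qed
    finally show "(\<integral>\<^sup>+ s. ennreal (y / pi) * (ennreal (w r) * indicator {\<bar>x - s\<bar>..} r) * \<psi> s \<partial>lborel)
       \<le> ennreal (4 * \<eta> / pi) * (ennreal (y / (r\<^sup>2 + y\<^sup>2)) * indicator {0..} r)" .
  qed
  also have "\<dots> = ennreal (4 * \<eta> / pi) * ennreal (pi / 2)"
    using nn_integral_arctan_half[OF y] by (subst nn_integral_cmult) auto
  also have "\<dots> = ennreal (2 * \<eta>)"
    using \<eta> by (subst ennreal_mult[symmetric]) auto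
  finally show ?thesis .
qed

text \<open>
  The exceptional set is covered by balls on which \<open>\<psi>\<close> has large average and which lie in an open
  superset of \<open>A\<close> of small \<open>\<psi>\<close>-mass; Vitali's covering lemma bounds its outer measure.
\<close>

lemma AE_average_small_on_zero_set:
  fixes \<psi> :: "real \<Rightarrow> ennreal"
  assumes [measurable]: "\<psi> \<in> borel_measurable borel" and fin: "(\<integral>\<^sup>+ s. \<psi> s \<partial>lborel) < \<infinity>"
    and A: "A \<in> sets borel" and zero: "\<And>x. x \<in> A \<Longrightarrow> \<psi> x = 0" and c: "c > 0"
  shows "AE x in lborel. x \<in> A \<longrightarrow>
    (\<exists>\<delta>>0. \<forall>r. 0 < r \<and> r \<le> \<delta> \<longrightarrow> (\<integral>\<^sup>+ s. \<psi> s * indicator {x-r..x+r} s \<partial>lborel) \<le> ennreal (2 * c * r))"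
proof -
  define \<nu> where "\<nu> = density lborel \<psi>"
  have sets\<nu>[simp]: "sets \<nu> = sets borel" "space \<nu> = UNIV" by (simp_all add: \<nu>_def)
  have em\<nu>: "emeasure \<nu> B = (\<integral>\<^sup>+ s. \<psi> s * indicator B s \<partial>lborel)" if "B \<in> sets borel" for B
    unfolding \<nu>_def using that by (subst emeasure_density) auto
  have fin\<nu>: "emeasure \<nu> (space \<nu>) \<noteq> \<infinity>"
    using em\<nu>[of UNIV] fin by simp
  interpret \<nu>: finite_measure \<nu> by (rule finite_measureI[OF fin\<nu>])
  have \<nu>A: "emeasure \<nu> A = 0"
  proof -
    have "emeasure \<nu> A = nn_integral lborel (\<lambda>s::real. 0)"
      unfolding em\<nu>[OF A] by (intro nn_integral_cong) (auto simp: indicator_def zero)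
    then show ?thesis by simp
  qed
  define N where "N = {x \<in> A. \<forall>\<delta>>0. \<exists>r. 0 < r \<and> r \<le> \<delta> \<and> ennreal (2 * c * r) < emeasure \<nu> (cball x r)}"
  have "negligible N"
  proof (rule iffD2[OF negligible_outer_le], intro allI impI)
    fix e :: real assume e: "e > 0"
    \<comment> \<open>Vitali enlarges a ball of radius r to length 10 r, which is below 5/c times
      its mass because the mass exceeds 2 c r. Disjoint balls inside \<open>U\<close> have total
      mass at most this \<epsilon>, so the enlarged ones measure at most 5/c * \<epsilon> =
      e.\<close>
    define \<epsilon> where "\<epsilon> = e * c / 5"
    have \<epsilon>: "\<epsilon> > 0" using e c by (simp add: \<epsilon>_def)
    have "emeasure \<nu> A < ennreal \<epsilon>" using \<nu>A \<epsilon> by simp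
    also have "emeasure \<nu> A = (INF U\<in>{U. A \<subseteq> U \<and> open U}. emeasure \<nu> U)"
      by (rule outer_regular[OF sets\<nu>(1) fin\<nu> A])
    finally obtain U where U: "A \<subseteq> U" "open U" "emeasure \<nu> U < ennreal \<epsilon>"
      unfolding INF_less_iff by auto
    define K where "K = {(x, r). x \<in> N \<and> 0 < r \<and> r \<le> 1 \<and> cball x r \<subseteq> U \<and> ennreal (2 * c * r) < emeasure \<nu> (cball x r)}"
    have "N \<subseteq> (\<Union>i\<in>K. cball (fst i) (snd i))"
    proof
      fix x assume x: "x \<in> N"
      then have "x \<in> U" using U by (auto simp: N_def)
      then obtain d where d: "d > 0" "cball x d \<subseteq> U" using U(2) open_contains_cball by blast
      then obtain r where r: "0 < r" "r \<le> min 1 d" "ennreal (2 * c * r) < emeasure \<nu> (cball x r)"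
        using x by (auto simp: N_def dest!: spec[of _ "min 1 d"])
      then have "cball x r \<subseteq> U" using d by (meson min.boundedE order.trans subset_cball)
      then have "(x, r) \<in> K" using r x by (auto simp: K_def)
      then show "x \<in> (\<Union>i\<in>K. cball (fst i) (snd i))" using r by force
    qed
    moreover have "0 < snd i \<and> snd i \<le> 1" if "i \<in> K" for i using that by (auto simp: K_def)
    ultimately obtain C where C: "countable C" "C \<subseteq> K"
        "pairwise (\<lambda>i j. disjnt (cball (fst i) (snd i)) (cball (fst j) (snd j))) C"
        "N \<subseteq> (\<Union>i\<in>C. cball (fst i) (5 * snd i))"
      by (rule Vitali_covering_lemma_cballs)
    have fin_bound: "measure lebesgue (\<Union>i\<in>F. cball (fst i) (5 * snd i)) \<le> e"
      if F: "F \<subseteq> C" "finite F" for F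
    proof -
      have "measure lebesgue (\<Union>i\<in>F. cball (fst i) (5 * snd i)) \<le> (\<Sum>i\<in>F. measure lebesgue (cball (fst i) (5 * snd i)))"
        by (rule measure_UNION_le[OF F(2)]) auto
      also have "\<dots> \<le> (\<Sum>i\<in>F. 5 / c * measure \<nu> (cball (fst i) (snd i)))"
      proof (rule sum_mono)
        fix i assume "i \<in> F"
        then have i: "i \<in> K" using F C by auto
        then have r: "snd i > 0" "ennreal (2 * c * snd i) < emeasure \<nu> (cball (fst i) (snd i))"
          by (auto simp: K_def)
        have "2 * c * snd i < measure \<nu> (cball (fst i) (snd i))"
          using r c by (simp add: \<nu>.emeasure_eq_measure ennreal_less_iff)
        moreover have "measure lebesgue (cball (fst i) (5 * snd i)) = 10 * snd i"
          using r by (simp add: cball_eq_atLeastAtMost)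
        ultimately show "measure lebesgue (cball (fst i) (5 * snd i)) \<le> 5 / c * measure \<nu> (cball (fst i) (snd i))"
          using c by (simp add: field_simps)
      qed
      also have "\<dots> = 5 / c * (\<Sum>i\<in>F. measure \<nu> (cball (fst i) (snd i)))"
        by (simp add: sum_distrib_left)
      finally have le: "measure lebesgue (\<Union>i\<in>F. cball (fst i) (5 * snd i))
        \<le> 5 / c * (\<Sum>i\<in>F. measure \<nu> (cball (fst i) (snd i)))" .
      have "(\<Sum>i\<in>F. measure \<nu> (cball (fst i) (snd i))) = measure \<nu> (\<Union>i\<in>F. cball (fst i) (snd i))"
      proof (intro \<nu>.finite_measure_finite_Union[symmetric] F)
        show "disjoint_family_on (\<lambda>i. cball (fst i) (snd i)) F"
          unfolding disjoint_family_on_def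
        proof (intro ballI impI)
          fix i j assume "i \<in> F" "j \<in> F" "i \<noteq> j"
          then have "i \<in> C" "j \<in> C" "i \<noteq> j" using F(1) by auto
          from pairwiseD[OF C(3) this]
          show "cball (fst i) (snd i) \<inter> cball (fst j) (snd j) = {}"
            by (simp add: disjnt_def)
        qed
      qed auto
      also have "\<dots> \<le> measure \<nu> U"
      proof (rule \<nu>.finite_measure_mono)
        have "cball (fst i) (snd i) \<subseteq> U" if "i \<in> F" for i
        proof -
          have "i \<in> K" using that F(1) C(2) by blast
          then show ?thesis by (simp add: K_def case_prod_beta)
        qed
        then show "(\<Union>i\<in>F. cball (fst i) (snd i)) \<subseteq> U" by blast
      qed (use U(2) in auto)
      also have "\<dots> \<le> \<epsilon>"
        using U(3) \<epsilon> by (simp add: \<nu>.emeasure_eq_measure ennreal_less_iff)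
      finally have "5 / c * (\<Sum>i\<in>F. measure \<nu> (cball (fst i) (snd i))) \<le> 5 / c * \<epsilon>"
        using c by (intro mult_left_mono) auto
      with le show ?thesis using c by (simp add: \<epsilon>_def)
    qed
    have "(\<Union>i\<in>C. cball (fst i) (5 * snd i)) \<in> lmeasurable"
      "measure lebesgue (\<Union>i\<in>C. cball (fst i) (5 * snd i)) \<le> e"
      by (rule fmeasurable_UN_bound[OF C(1) _ fin_bound], simp, assumption, assumption,
          rule measure_UN_bound[OF C(1) _ fin_bound], simp)
    then show "\<exists>T. N \<subseteq> T \<and> T \<in> lmeasurable \<and> measure lebesgue T \<le> e"
      using C(4) by blast
  qed
  then have "N \<in> null_sets lebesgue" by (simp add: negligible_iff_null_sets)
  then have "AE x in lebesgue. x \<notin> N" by (rule AE_not_in)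
  then have "AE x in lborel. x \<notin> N" by (simp add: AE_completion_iff)
  then show ?thesis
  proof eventually_elim
    case (elim x)
    show ?case
    proof
      assume "x \<in> A"
      with elim obtain \<delta> where \<delta>: "\<delta> > 0" "\<And>r. 0 < r \<Longrightarrow> r \<le> \<delta> \<Longrightarrow> \<not> ennreal (2 * c * r) < emeasure \<nu> (cball x r)"
        by (auto simp: N_def)
      then show "\<exists>\<delta>>0. \<forall>r. 0 < r \<and> r \<le> \<delta> \<longrightarrow>
          (\<integral>\<^sup>+ s. \<psi> s * indicator {x-r..x+r} s \<partial>lborel) \<le> ennreal (2 * c * r)"
        by (intro exI[of _ \<delta>]) (auto simp: em\<nu> cball_eq_atLeastAtMost not_less)
    qed
  qed
qed

text \<open>Every Poisson kernel is dominated by a multiple of the one at height 1 over the origin,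
  because s^2 <= 2 (x - s)^2 + 2 x^2. One integrability condition therefore serves for all points of
  the half-plane.\<close>

lemma poisson_le_poisson_1:
  assumes "y > 0"
  shows "poisson y (x - s) \<le> y * (2 + (1 + 2 * x\<^sup>2) / y\<^sup>2) * poisson 1 s"
proof -
  have "s\<^sup>2 \<le> 2 * (x - s)\<^sup>2 + 2 * x\<^sup>2"
    using zero_le_power2[of "s - 2 * x"] by (simp add: power2_eq_square algebra_simps)
  moreover have "1 + 2 * x\<^sup>2 \<le> (1 + 2 * x\<^sup>2) / y\<^sup>2 * ((x - s)\<^sup>2 + y\<^sup>2)"
    using assms by (simp add: field_simps)
  ultimately have "s\<^sup>2 + 1\<^sup>2 \<le> (2 + (1 + 2 * x\<^sup>2) / y\<^sup>2) * ((x - s)\<^sup>2 + y\<^sup>2)"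
  proof -
    have "(2 + c) * (S + y\<^sup>2) = 2 * S + 2 * y\<^sup>2 + c * (S + y\<^sup>2)" for c S
      by (simp add: algebra_simps)
    moreover assume "s\<^sup>2 \<le> 2 * (x - s)\<^sup>2 + 2 * x\<^sup>2"
      "1 + 2 * x\<^sup>2 \<le> (1 + 2 * x\<^sup>2) / y\<^sup>2 * ((x - s)\<^sup>2 + y\<^sup>2)"
    ultimately show ?thesis using zero_le_power2[of y] by (simp only: one_power2)
  qed
  moreover have "y / (pi * u) \<le> y * K * (1 / (pi * v))" if "v \<le> K * u" "u > 0" "v > 0" for u v K
    using that assms by (simp add: field_simps)
  moreover have "(x - s)\<^sup>2 + y\<^sup>2 > 0" "s\<^sup>2 + 1\<^sup>2 > 0"
    using assms by (auto intro: add_nonneg_pos)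
  ultimately show ?thesis
    unfolding poisson_def by blast
qed

text \<open>Away from its centre the kernel is O(y) relative to the kernel at height 1, so the far
  part of any convergent Poisson integral vanishes as y tends to 0.\<close>

lemma poisson_tail_le:
  assumes "0 < y" "0 < \<delta>" "\<delta> \<le> \<bar>t\<bar>"
  shows "poisson y t \<le> y * (1 + 1 / \<delta>\<^sup>2) * poisson 1 t"
proof -
  have "\<delta>\<^sup>2 \<le> t\<^sup>2" using assms by (metis abs_le_square_iff abs_of_pos)
  then have "t\<^sup>2 + 1\<^sup>2 \<le> (1 + 1 / \<delta>\<^sup>2) * t\<^sup>2" "t\<^sup>2 > 0"
    using assms by (auto simp: field_simps)
  then have "t\<^sup>2 + 1\<^sup>2 \<le> (1 + 1 / \<delta>\<^sup>2) * (t\<^sup>2 + y\<^sup>2)"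
    by (smt (verit) mult_left_mono zero_le_power2 zero_le_divide_1_iff)
  moreover have "y / (pi * u) \<le> y * K * (1 / (pi * v))" if "v \<le> K * u" "u > 0" "v > 0" for u v K
    using that assms by (simp add: field_simps)
  moreover have "t\<^sup>2 + y\<^sup>2 > 0" "t\<^sup>2 + 1\<^sup>2 > 0"
    using assms by (auto intro: add_nonneg_pos)
  ultimately show ?thesis
    unfolding poisson_def by blast
qed

text \<open>The condition that g(s)/(1 + s^2) be integrable. It holds for every L^p function with p
  >= 1, so Fatou's theorem below is stated once for all exponents.\<close>

definition poisson_integrable :: "(real \<Rightarrow> complex) \<Rightarrow> bool"
  where "poisson_integrable g \<longleftrightarrow> g \<in> borel_measurable borel \<and>
    integrable lborel (\<lambda>s. poisson 1 s *\<^sub>R g s)"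

definition poisson_ext :: "(real \<Rightarrow> complex) \<Rightarrow> complex \<Rightarrow> complex"
  where "poisson_ext g z = (LINT s|lborel. poisson (Im z) (Re z - s) *\<^sub>R g s)"

lemma poisson_ext_of_real:
  "poisson_ext (\<lambda>s. of_real (q s)) z = of_real (LINT s|lborel. poisson (Im z) (Re z - s) * q s)"
  unfolding poisson_ext_def
  by (simp add: scaleR_conv_of_real flip: of_real_mult integral_complex_of_real)

lemma poisson_integrable_measurable: "poisson_integrable g \<Longrightarrow> g \<in> borel_measurable borel"
  by (simp add: poisson_integrable_def)

lemma poisson_integrableD:
  assumes g: "poisson_integrable g" and y: "y > 0"
  shows "integrable lborel (\<lambda>s. poisson y (x - s) *\<^sub>R g s)"
proof -
  define K where "K = y * (2 + (1 + 2 * x\<^sup>2) / y\<^sup>2)"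
  have K: "K > 0" unfolding K_def using y by (intro mult_pos_pos add_pos_nonneg) auto
  have [measurable]: "g \<in> borel_measurable borel" using g by (simp add: poisson_integrable_def)
  have "integrable lborel (\<lambda>s. K *\<^sub>R (poisson 1 s *\<^sub>R g s))"
    using g by (intro integrable_scaleR_right) (simp add: poisson_integrable_def)
  then show ?thesis
  proof (rule Bochner_Integration.integrable_bound)
    show "AE s in lborel. norm (poisson y (x - s) *\<^sub>R g s) \<le> norm (K *\<^sub>R (poisson 1 s *\<^sub>R g s))"
      using poisson_le_poisson_1[OF y, of x] K y
      by (auto simp: K_def mult_right_mono simp flip: mult.assoc)
  qed measurable
qed

lemma poisson_integrable_nn:
  assumes g: "poisson_integrable g" and y: "y > 0"
  shows "(\<integral>\<^sup>+ s. ennreal (poisson y (x - s) * cmod (g s)) \<partial>lborel) < \<infinity>"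
  using poisson_integrableD[OF g y, of x] y by (simp add: integrable_iff_bounded)

text \<open>For \<open>c\<close> in a countable dense set, the excess of |g - c| over 1/(k + 1)
  vanishes where \<open>g\<close> is that close to \<open>c\<close>, so the covering lemma makes its
  averages small almost everywhere there. For given \<open>x\<close> a \<open>c\<close> close to
  \<open>g x\<close> is chosen, and |g s - g x| is at most the excess plus a small constant.\<close>

lemma AE_lebesgue_points:
  fixes g :: "real \<Rightarrow> complex"
  assumes g: "poisson_integrable g"
  shows "AE x in lborel. \<forall>\<eta>>0. \<exists>\<delta>>0. \<forall>r. 0 < r \<and> r \<le> \<delta> \<longrightarrow>
     (\<integral>\<^sup>+ s. ennreal (cmod (g s - g x)) * indicator {x-r..x+r} s \<partial>lborel) \<le> ennreal (2 * \<eta> * r)"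
proof -
  have [measurable]: "g \<in> borel_measurable borel" using g by (simp add: poisson_integrable_def)
  obtain D :: "complex set" where D: "countable D" "\<And>X. open X \<Longrightarrow> X \<noteq> {} \<Longrightarrow> \<exists>d\<in>D. d \<in> X"
    by (erule countable_dense_setE)
  \<comment> \<open>Since \<open>ennreal\<close> truncates at 0, this is the positive part of the
    difference. The indicator makes its integral finite, as \<open>g\<close> need not be integrable
    on the whole line.\<close>
  define \<psi> where "\<psi> = (\<lambda>(n::nat) (k::nat) c s. ennreal (cmod (g s - c) - 1 / real (Suc k)) * indicator {-real n..real n} s)"
  define A where "A = (\<lambda>(n::nat) (k::nat) c. {x. cmod (g x - c) \<le> 1 / real (Suc k)})"
  have "AE x in lborel. \<forall>n k. \<forall>c\<in>D. x \<in> A n k c \<longrightarrow>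
    (\<exists>\<delta>>0. \<forall>r. 0 < r \<and> r \<le> \<delta> \<longrightarrow> (\<integral>\<^sup>+ s. \<psi> n k c s * indicator {x-r..x+r} s \<partial>lborel) \<le> ennreal (2 * (1 / real (Suc k)) * r))"
    unfolding AE_all_countable AE_ball_countable[OF D(1)]
  proof (intro allI ballI AE_average_small_on_zero_set)
    fix n k c
    show "\<psi> n k c \<in> borel_measurable borel" unfolding \<psi>_def by measurable
    show "A n k c \<in> sets borel" unfolding A_def by measurable
    have "(\<integral>\<^sup>+ s. \<psi> n k c s \<partial>lborel) \<le>
      (\<integral>\<^sup>+ s. ennreal (pi * (1 + (real n)\<^sup>2)) * ennreal (poisson 1 (0 - s) * cmod (g s)) + ennreal (cmod c) * indicator {-real n..real n} s \<partial>lborel)"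
    proof (rule nn_integral_mono)
      fix s
      show "\<psi> n k c s \<le> ennreal (pi * (1 + (real n)\<^sup>2)) * ennreal (poisson 1 (0 - s) * cmod (g s)) + ennreal (cmod c) * indicator {-real n..real n} s"
      proof (cases "s \<in> {-real n..real n}")
        case True
        then have "s\<^sup>2 \<le> (real n)\<^sup>2" using abs_le_square_iff[of s "real n"] by auto
        then have "pi * (s\<^sup>2 + 1\<^sup>2) \<le> pi * (1 + (real n)\<^sup>2)" by (intro mult_left_mono) auto
        moreover have "pi * (s\<^sup>2 + 1\<^sup>2) > 0" by (intro mult_pos_pos add_nonneg_pos) auto
        ultimately have "1 \<le> pi * (1 + (real n)\<^sup>2) * poisson 1 (0 - s)"
          by (simp add: poisson_def pos_le_divide_eq zero_less_mult_iff)
        then have "cmod (g s - c) - 1 / real (Suc k) \<le> pi * (1 + (real n)\<^sup>2) * (poisson 1 (0 - s) * cmod (g s)) + cmod c"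
        proof -
          have "cmod (g s) \<le> pi * (1 + (real n)\<^sup>2) * (poisson 1 (0 - s) * cmod (g s))"
            using \<open>1 \<le> pi * (1 + (real n)\<^sup>2) * poisson 1 (0 - s)\<close>
              mult_right_mono[of 1 "pi * (1 + (real n)\<^sup>2) * poisson 1 (0 - s)" "cmod (g s)"]
            by (simp only: mult.assoc norm_ge_zero mult_1)
          moreover have "1 / real (Suc k) \<ge> 0" by simp
          ultimately show ?thesis using norm_triangle_ineq4[of "g s" c] by linarith
        qed
        then have "ennreal (cmod (g s - c) - 1 / real (Suc k)) \<le> ennreal (pi * (1 + (real n)\<^sup>2) * (poisson 1 (0 - s) * cmod (g s)) + cmod c)"
          by (rule ennreal_leI)
        also have "\<dots> = ennreal (pi * (1 + (real n)\<^sup>2)) * ennreal (poisson 1 (0 - s) * cmod (g s)) + ennreal (cmod c)"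
          by (subst ennreal_plus) (auto simp: ennreal_mult intro!: mult_nonneg_nonneg)
        finally show ?thesis using True by (simp add: \<psi>_def)
      qed (simp add: \<psi>_def)
    qed
    also have "\<dots> = ennreal (pi * (1 + (real n)\<^sup>2)) * (\<integral>\<^sup>+ s. ennreal (poisson 1 (0 - s) * cmod (g s)) \<partial>lborel)
        + ennreal (cmod c) * ennreal (2 * real n)"
      by (subst nn_integral_add) (auto simp: nn_integral_cmult nn_integral_cmult_indicator)
    also have "\<dots> < \<infinity>"
      using poisson_integrable_nn[OF g, of 1 0] by (auto simp: ennreal_mult_less_top)
    finally show "(\<integral>\<^sup>+ s. \<psi> n k c s \<partial>lborel) < \<infinity>" .
  qed (auto simp: \<psi>_def A_def indicator_def intro!: ennreal_neg)
  then show ?thesis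
  proof eventually_elim
    case (elim x)
    show ?case
    proof (intro allI impI)
      fix \<eta> :: real assume \<eta>: "\<eta> > 0"
      \<comment> \<open>With h = 1/(k + 1) the excess contributes 2 h r and the constant 2 h
        contributes 4 h r; the sum 6 h r has to stay below 2 \<eta> r.\<close>
      obtain k where k: "1 / real (Suc k) < \<eta> / 3"
        using \<eta> by (metis divide_pos_pos inverse_eq_divide reals_Archimedean zero_less_numeral)
      define h where "h = 1 / real (Suc k)"
      have h: "h > 0" "h < \<eta> / 3" using k by (auto simp: h_def)
      obtain c where c: "c \<in> D" "c \<in> ball (g x) h"
        using D(2)[of "ball (g x) h"] h by auto
      then have gc: "cmod (g x - c) \<le> h" by (auto simp: dist_norm)
      \<comment> \<open>The margin 1 keeps intervals around \<open>x\<close> of radius at most 1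
        inside the truncation window; this is why the final radius is
        \<open>min \<delta> 1\<close>.\<close>
      obtain n :: nat where n: "\<bar>x\<bar> + 1 < real n" using reals_Archimedean2 by blast
      have "x \<in> A n k c" using gc by (simp add: A_def h_def)
      with elim c(1) obtain \<delta> where \<delta>: "\<delta> > 0"
        "\<And>r. 0 < r \<Longrightarrow> r \<le> \<delta> \<Longrightarrow> (\<integral>\<^sup>+ s. \<psi> n k c s * indicator {x-r..x+r} s \<partial>lborel) \<le> ennreal (2 * h * r)"
        unfolding h_def by blast
      show "\<exists>\<delta>>0. \<forall>r. 0 < r \<and> r \<le> \<delta> \<longrightarrow>
         (\<integral>\<^sup>+ s. ennreal (cmod (g s - g x)) * indicator {x-r..x+r} s \<partial>lborel) \<le> ennreal (2 * \<eta> * r)"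
      proof (intro exI[of _ "min \<delta> 1"] conjI allI impI)
        show "min \<delta> 1 > 0" using \<delta> by simp
        fix r assume r: "0 < r \<and> r \<le> min \<delta> 1"
        have "(\<integral>\<^sup>+ s. ennreal (cmod (g s - g x)) * indicator {x-r..x+r} s \<partial>lborel)
          \<le> (\<integral>\<^sup>+ s. \<psi> n k c s * indicator {x-r..x+r} s + ennreal (2 * h) * indicator {x-r..x+r} s \<partial>lborel)"
        proof (rule nn_integral_mono)
          fix s
          show "ennreal (cmod (g s - g x)) * indicator {x-r..x+r} s
             \<le> \<psi> n k c s * indicator {x-r..x+r} s + ennreal (2 * h) * indicator {x-r..x+r} s"
          proof (cases "s \<in> {x-r..x+r}")
            case True
            then have s: "s \<in> {-real n..real n}" using r n by auto
            have "cmod (g s - g x) \<le> cmod (g s - c) + cmod (g x - c)"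
              using norm_triangle_ineq4[of "g s - c" "g x - c"] by simp
            then have "cmod (g s - g x) \<le> max 0 (cmod (g s - c) - h) + 2 * h" using gc by linarith
            then have "ennreal (cmod (g s - g x)) \<le> ennreal (max 0 (cmod (g s - c) - h) + 2 * h)"
              by (rule ennreal_leI)
            also have "\<dots> = ennreal (max 0 (cmod (g s - c) - h)) + ennreal (2 * h)"
              using h by (intro ennreal_plus) auto
            moreover have "\<psi> n k c s = ennreal (cmod (g s - c) - h)"
              using s by (simp add: \<psi>_def h_def)
            ultimately show ?thesis using True by (simp add: ennreal_max_0)
          qed simp
        qed
        also have "\<dots> = (\<integral>\<^sup>+ s. \<psi> n k c s * indicator {x-r..x+r} s \<partial>lborel) + ennreal (2 * h) * ennreal (2 * r)"
          using r by (subst nn_integral_add) (auto simp: nn_integral_cmult_indicator \<psi>_def)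
        also have "\<dots> \<le> ennreal (2 * h * r) + ennreal (2 * h) * ennreal (2 * r)"
          using r by (intro add_right_mono \<delta>) auto
        also have "\<dots> = ennreal (2 * h * r + 2 * h * (2 * r))"
        proof (subst ennreal_plus)
          show "ennreal (2 * h * r) + ennreal (2 * h) * ennreal (2 * r)
              = ennreal (2 * h * r) + ennreal (2 * h * (2 * r))"
            by (subst ennreal_mult) (use h r in auto)
        qed (use h r in auto)
        also have "\<dots> \<le> ennreal (2 * \<eta> * r)"
        proof (rule ennreal_leI)
          have "(6 * h) * r \<le> (2 * \<eta>) * r" using h r by (intro mult_right_mono) auto
          then show "2 * h * r + 2 * h * (2 * r) \<le> 2 * \<eta> * r" by simp
        qed
        finally show "(\<integral>\<^sup>+ s. ennreal (cmod (g s - g x)) * indicator {x-r..x+r} s \<partial>lborel) \<le> ennreal (2 * \<eta> * r)" .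
      qed
    qed
  qed
qed

lemma poisson_const_integrable:
  fixes c :: complex
  assumes "y > 0"
  shows "integrable lborel (\<lambda>s. poisson y (x - s) *\<^sub>R c)" "(LINT s|lborel. poisson y (x - s) *\<^sub>R c) = c"
  using poisson_has_integral[OF assms, of x] by simp_all

text \<open>Within distance \<delta> of \<open>x\<close> the layer-cake bound turns small averages
  into a small Poisson integral; beyond it the tail bound gives a multiple of
  \<open>y\<close>.\<close>

lemma poisson_radial_at_lebesgue_point:
  fixes g :: "real \<Rightarrow> complex"
  assumes g: "poisson_integrable g" and \<eta>: "\<eta> > 0"
    and leb: "\<forall>\<eta>>0. \<exists>\<delta>>0. \<forall>r. 0 < r \<and> r \<le> \<delta> \<longrightarrow>
     (\<integral>\<^sup>+ s. ennreal (cmod (g s - g x)) * indicator {x-r..x+r} s \<partial>lborel) \<le> ennreal (2 * \<eta> * r)"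
  shows "\<exists>d>0. \<forall>y. 0 < y \<and> y < d \<longrightarrow>
     (\<integral>\<^sup>+ s. ennreal (poisson y (x - s) * cmod (g s - g x)) \<partial>lborel) \<le> ennreal \<eta>"
proof -
  have [measurable]: "g \<in> borel_measurable borel" using g by (simp add: poisson_integrable_def)
  obtain \<delta> where \<delta>: "\<delta> > 0" "\<And>r. 0 < r \<Longrightarrow> r \<le> \<delta> \<Longrightarrow>
     (\<integral>\<^sup>+ s. ennreal (cmod (g s - g x)) * indicator {x-r..x+r} s \<partial>lborel) \<le> ennreal (2 * (\<eta>/4) * r)"
    using leb \<eta> by (metis divide_pos_pos zero_less_numeral)
  define J where "J = (\<integral>\<^sup>+ s. ennreal (poisson 1 (x - s) * cmod (g s - g x)) \<partial>lborel)"
  have "integrable lborel (\<lambda>s. poisson 1 (x - s) *\<^sub>R g s - poisson 1 (x - s) *\<^sub>R g x)"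
    using poisson_integrableD[OF g, of 1 x] poisson_const_integrable(1)[of 1 x]
    by (intro Bochner_Integration.integrable_diff) auto
  then have "J < \<infinity>"
    by (simp add: J_def integrable_iff_bounded flip: scaleR_diff_right)
  then obtain j where j: "J = ennreal j" "j \<ge> 0"
    by (metis ennreal_cases infinity_ennreal_def less_irrefl)
  define K where "K = (1 + 1 / \<delta>\<^sup>2) * j"
  have K: "K \<ge> 0" using j by (simp add: K_def)
  \<comment> \<open>The near part is at most \<eta>/2, from averages \<eta>/4 and the factor 2 of
    the layer-cake bound; this \<open>d\<close> makes the tail y K at most \<eta>/2. The + 1 keeps
    the denominator positive when \<open>K\<close> is 0.\<close>
  define d where "d = \<eta> / (2 * (K + 1))"
  have d: "d > 0" using \<eta> K by (simp add: d_def)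
  show ?thesis
  proof (intro exI[of _ d] conjI d allI impI)
    fix y assume y: "0 < y \<and> y < d"
    define \<psi> where "\<psi> = (\<lambda>s. ennreal (cmod (g s - g x)) * indicator {x-\<delta>..x+\<delta>} s)"
    have [measurable]: "\<psi> \<in> borel_measurable borel" unfolding \<psi>_def by measurable
    have av: "(\<integral>\<^sup>+ s. \<psi> s * indicator {x-r..x+r} s \<partial>lborel) \<le> ennreal (2 * (\<eta>/4) * r)" if r: "r > 0" for r
    proof -
      have "(\<integral>\<^sup>+ s. \<psi> s * indicator {x-r..x+r} s \<partial>lborel)
          = (\<integral>\<^sup>+ s. ennreal (cmod (g s - g x)) * indicator {x-min r \<delta>..x+min r \<delta>} s \<partial>lborel)"
        by (intro nn_integral_cong) (auto simp: \<psi>_def indicator_def)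
      also have "\<dots> \<le> ennreal (2 * (\<eta>/4) * min r \<delta>)" using r \<delta> by (intro \<delta>) auto
      also have "\<dots> \<le> ennreal (2 * (\<eta>/4) * r)" using \<eta> by (intro ennreal_leI mult_left_mono) auto
      finally show ?thesis .
    qed
    have near: "(\<integral>\<^sup>+ s. ennreal (poisson y (x - s)) * \<psi> s \<partial>lborel) \<le> ennreal (2 * (\<eta>/4))"
      using y \<eta> by (intro nn_integral_poisson_le av) auto
    have "(\<integral>\<^sup>+ s. ennreal (poisson y (x - s) * cmod (g s - g x)) \<partial>lborel)
       \<le> (\<integral>\<^sup>+ s. ennreal (poisson y (x - s)) * \<psi> s
           + ennreal (y * (1 + 1 / \<delta>\<^sup>2)) * ennreal (poisson 1 (x - s) * cmod (g s - g x)) \<partial>lborel)"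
    proof (rule nn_integral_mono)
      fix s
      show "ennreal (poisson y (x - s) * cmod (g s - g x)) \<le> ennreal (poisson y (x - s)) * \<psi> s
           + ennreal (y * (1 + 1 / \<delta>\<^sup>2)) * ennreal (poisson 1 (x - s) * cmod (g s - g x))"
      proof (cases "s \<in> {x-\<delta>..x+\<delta>}")
        case True
        then show ?thesis using y by (simp add: \<psi>_def ennreal_mult)
      next
        case False
        then have "\<delta> \<le> \<bar>x - s\<bar>" by auto
        then have "poisson y (x - s) * cmod (g s - g x) \<le> y * (1 + 1 / \<delta>\<^sup>2) * poisson 1 (x - s) * cmod (g s - g x)"
          using y \<delta> by (intro mult_right_mono poisson_tail_le) auto
        then have "ennreal (poisson y (x - s) * cmod (g s - g x)) \<le> ennreal ((y * (1 + 1 / \<delta>\<^sup>2)) * (poisson 1 (x - s) * cmod (g s - g x)))"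
          by (intro ennreal_leI) (simp add: mult.assoc)
        then show ?thesis using False y by (simp add: \<psi>_def ennreal_mult mult_nonneg_nonneg)
      qed
    qed
    also have "\<dots> = (\<integral>\<^sup>+ s. ennreal (poisson y (x - s)) * \<psi> s \<partial>lborel) + ennreal (y * (1 + 1 / \<delta>\<^sup>2)) * J"
      unfolding J_def by (subst nn_integral_add) (auto simp: nn_integral_cmult)
    also have "\<dots> \<le> ennreal (2 * (\<eta>/4)) + ennreal (y * (1 + 1 / \<delta>\<^sup>2)) * J"
      by (intro add_right_mono near)
    also have "\<dots> = ennreal (\<eta> / 2 + y * K)"
      using y j \<eta> unfolding K_def by (subst ennreal_plus) (auto simp: ennreal_mult' mult.assoc mult_nonneg_nonneg)
    also have "\<dots> \<le> ennreal \<eta>"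
    proof (rule ennreal_leI)
      have "y * K \<le> d * (K + 1)" using y K d by (intro mult_mono) auto
      also have "\<dots> = \<eta> / 2"
      proof -
        have "K + 1 \<noteq> 0" using K by simp
        moreover have "\<eta> / (2 * k) * k = \<eta> / 2" if "k \<noteq> 0" for k using that by simp
        ultimately show ?thesis unfolding d_def by blast
      qed
      finally show "\<eta> / 2 + y * K \<le> \<eta>" by simp
    qed
    finally show "(\<integral>\<^sup>+ s. ennreal (poisson y (x - s) * cmod (g s - g x)) \<partial>lborel) \<le> ennreal \<eta>" .
  qed
qed

text \<open>Inside a cone with vertex \<open>x\<close>, moving the centre of the kernel back to
  \<open>x\<close> costs only a constant depending on the aperture. This turns vertical convergence
  into nontangential convergence.\<close>

lemma poisson_cone_le:
  assumes y: "y > 0" and cone: "\<bar>u - x\<bar> \<le> a * y"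
  shows "poisson y (u - s) \<le> (2 + 2 * a\<^sup>2) * poisson y (x - s)"
proof -
  have "(x - s)\<^sup>2 \<le> 2 * (u - s)\<^sup>2 + 2 * (u - x)\<^sup>2"
    using zero_le_power2[of "(u - s) + (u - x)"] by (simp add: power2_eq_square algebra_simps)
  moreover have "(u - x)\<^sup>2 \<le> a\<^sup>2 * y\<^sup>2"
    using power_mono[OF cone, of 2] by (simp add: power_mult_distrib)
  ultimately have "(x - s)\<^sup>2 + y\<^sup>2 \<le> (2 + 2 * a\<^sup>2) * ((u - s)\<^sup>2 + y\<^sup>2)"
  proof -
    have "(2 + 2 * a\<^sup>2) * ((u - s)\<^sup>2 + y\<^sup>2)
        = 2 * (u - s)\<^sup>2 + 2 * y\<^sup>2 + 2 * (a * (u - s))\<^sup>2 + 2 * (a\<^sup>2 * y\<^sup>2)"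
      by (simp only: power_mult_distrib) (simp add: algebra_simps)
    moreover assume "(x - s)\<^sup>2 \<le> 2 * (u - s)\<^sup>2 + 2 * (u - x)\<^sup>2" "(u - x)\<^sup>2 \<le> a\<^sup>2 * y\<^sup>2"
    ultimately show ?thesis
      using zero_le_power2[of "a * (u - s)"] zero_le_power2[of y] by linarith
  qed
  moreover have "y / (pi * p) \<le> K * (y / (pi * q))" if "q \<le> K * p" "p > 0" "q > 0" for p q K
    using that y by (simp add: field_simps)
  moreover have "(x - s)\<^sup>2 + y\<^sup>2 > 0" "(u - s)\<^sup>2 + y\<^sup>2 > 0"
    using y by (auto intro: add_nonneg_pos)
  ultimately show ?thesis
    unfolding poisson_def by blast
qed

text \<open>The kernel has mass 1, so the error at \<open>z\<close> is the Poisson integral of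
  \<open>g - g x\<close>. At a Lebesgue point the cone comparison bounds it by the vertical
  estimate, used with tolerance \<eta>/(2 C) to absorb the constant \<open>C\<close> of the
  cone.\<close>

theorem Fatou_poisson:
  assumes g: "poisson_integrable g"
  shows "AE x in lborel. has_nt_limit (poisson_ext g) x (g x)"
  using AE_lebesgue_points[OF g]
proof eventually_elim
  case (elim x)
  have [measurable]: "g \<in> borel_measurable borel" using g by (simp add: poisson_integrable_def)
  show ?case
    unfolding has_nt_limit_def
  proof (intro allI impI)
    fix a :: real assume a: "a > 0"
    define C where "C = 2 + 2 * a\<^sup>2"
    have C: "C > 0" by (simp add: C_def add_pos_nonneg)
    show "(poisson_ext g \<longlongrightarrow> g x) (at (of_real x) within {z. Im z > 0 \<and> \<bar>Re z - x\<bar> < a * Im z})"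
      unfolding tendsto_iff eventually_at
    proof (intro allI impI)
      fix \<eta> :: real assume \<eta>: "\<eta> > 0"
      then have "\<eta> / (2 * C) > 0" using C by simp
      from poisson_radial_at_lebesgue_point[OF g this elim]
      obtain d where d: "d > 0" "\<And>y. 0 < y \<Longrightarrow> y < d \<Longrightarrow>
         (\<integral>\<^sup>+ s. ennreal (poisson y (x - s) * cmod (g s - g x)) \<partial>lborel) \<le> ennreal (\<eta> / (2 * C))"
        by auto
      show "\<exists>d>0. \<forall>z\<in>{z. Im z > 0 \<and> \<bar>Re z - x\<bar> < a * Im z}.
         z \<noteq> of_real x \<and> dist z (of_real x) < d \<longrightarrow> dist (poisson_ext g z) (g x) < \<eta>"
      proof (intro exI[of _ d] conjI d(1) ballI impI)
        fix z assume z: "z \<in> {z. Im z > 0 \<and> \<bar>Re z - x\<bar> < a * Im z}"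
          and dz: "z \<noteq> of_real x \<and> dist z (of_real x) < d"
        define y u where "y = Im z" and "u = Re z"
        have y: "0 < y" "\<bar>u - x\<bar> \<le> a * y" using z by (auto simp: y_def u_def)
        have "y < d" using dz abs_Im_le_cmod[of "z - of_real x"] by (auto simp: dist_norm y_def)
        note int = poisson_integrableD[OF g y(1), of u] poisson_const_integrable[OF y(1), of u "g x"]
        have eq: "poisson_ext g z - g x = (LINT s|lborel. poisson y (u - s) *\<^sub>R (g s - g x))"
          unfolding poisson_ext_def y_def[symmetric] u_def[symmetric] scaleR_diff_right
          using int by (subst Bochner_Integration.integral_diff) simp_all
        have "ennreal (cmod (poisson_ext g z - g x)) \<le> (\<integral>\<^sup>+ s. norm (poisson y (u - s) *\<^sub>R (g s - g x)) \<partial>lborel)"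
          unfolding eq using int by (intro integral_norm_bound_ennreal) (simp add: scaleR_diff_right)
        also have "\<dots> \<le> (\<integral>\<^sup>+ s. ennreal C * ennreal (poisson y (x - s) * cmod (g s - g x)) \<partial>lborel)"
        proof (intro nn_integral_mono)
          fix s
          have "poisson y (u - s) * cmod (g s - g x) \<le> C * poisson y (x - s) * cmod (g s - g x)"
            unfolding C_def by (intro mult_right_mono poisson_cone_le y) auto
          then have "norm (poisson y (u - s) *\<^sub>R (g s - g x)) \<le> C * (poisson y (x - s) * cmod (g s - g x))"
            using y by (simp add: mult.assoc)
          then have "ennreal (norm (poisson y (u - s) *\<^sub>R (g s - g x))) \<le> ennreal (C * (poisson y (x - s) * cmod (g s - g x)))"
            by (rule ennreal_leI)
          then show "ennreal (norm (poisson y (u - s) *\<^sub>R (g s - g x))) \<le> ennreal C * ennreal (poisson y (x - s) * cmod (g s - g x))"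
            using C y by (simp add: ennreal_mult)
        qed
        also have "\<dots> = ennreal C * (\<integral>\<^sup>+ s. ennreal (poisson y (x - s) * cmod (g s - g x)) \<partial>lborel)"
          by (rule nn_integral_cmult) simp
        also have "\<dots> \<le> ennreal C * ennreal (\<eta> / (2 * C))"
          by (intro mult_left_mono d y \<open>y < d\<close>) auto
        also have "\<dots> = ennreal (\<eta> / 2)"
          using C \<eta> by (subst ennreal_mult[symmetric]) auto
        finally have "cmod (poisson_ext g z - g x) \<le> \<eta> / 2" using \<eta> by simp
        then show "dist (poisson_ext g z) (g x) < \<eta>" using \<eta> by (simp add: dist_norm)
      qed
    qed
  qed
qed

section \<open>Poisson extensions of \<open>L\<^sup>p\<close> functions\<close>

text \<open>The graph of t^p lies above its tangent at \<open>m\<close>. This is Young's inequality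
  for \<open>t\<close> and m^(p - 1) with the conjugate exponent p/(p - 1), which is why p = 1 is
  treated apart.\<close>

lemma powr_tangent_line:
  fixes p :: real
  assumes p: "p \<ge> 1" and t: "t \<ge> 0" and m: "m > 0"
  shows "m powr p + p * m powr (p - 1) * (t - m) \<le> t powr p"
proof (cases "p = 1")
  case True
  then show ?thesis using t m by simp
next
  case False
  define q where "q = p / (p - 1)"
  have p1: "p > 1" using p False by simp
  have q: "q > 1" "1 / p + 1 / q = 1" using p1 by (auto simp: q_def field_simps)
  have "t * m powr (p - 1) \<le> t powr p / p + (m powr (p - 1)) powr q / q"
    by (rule Youngs_inequality) (use p1 q t in auto)
  also have "(m powr (p - 1)) powr q = m powr p"
    using p1 by (simp add: powr_powr q_def)
  finally have "p * (t * m powr (p - 1)) \<le> p * (t powr p / p + m powr p / q)"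
    using p1 by (intro mult_left_mono) auto
  also have "\<dots> = t powr p + (p - 1) * m powr p"
    using p1 by (simp add: q_def field_simps)
  finally have "p * (t * m powr (p - 1)) \<le> t powr p + (p - 1) * m powr p" .
  moreover have "m powr (p - 1) * m = m powr p"
    using m by (simp add: powr_mult_base mult.commute)
  ultimately show ?thesis
    by (simp add: algebra_simps)
qed

lemma le_one_plus_powr:
  fixes t p :: real
  assumes "t \<ge> 0" "p \<ge> 1"
  shows "t \<le> 1 + t powr p"
proof (cases "t \<le> 1")
  case True
  then show ?thesis using powr_ge_zero[of t p] by linarith
next
  case False
  then have "t powr 1 \<le> t powr p" using assms by (intro powr_mono) auto
  then show ?thesis using False by simp
qed

text \<open>Jensen's inequality for the probability density \<open>poisson y (x - s)\<close>: the
  tangent at the mean \<open>m\<close> of |g| is integrated, and its linear term cancels. The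
  tangent inequality requires m > 0, hence the case split.\<close>

lemma poisson_jensen:
  fixes g :: "real \<Rightarrow> complex"
  assumes [measurable]: "g \<in> borel_measurable borel" and p: "p \<ge> 1" and y: "y > 0"
    and fin: "(\<integral>\<^sup>+ s. ennreal (poisson y (x - s) * cmod (g s) powr p) \<partial>lborel) < \<infinity>"
  shows "integrable lborel (\<lambda>s. poisson y (x - s) *\<^sub>R g s)"
    and "ennreal (cmod (poisson_ext g (Complex x y)) powr p)
       \<le> (\<integral>\<^sup>+ s. ennreal (poisson y (x - s) * cmod (g s) powr p) \<partial>lborel)"
proof -
  have P0: "poisson y (x - s) \<ge> 0" for s using y by simp
  have intp: "integrable lborel (\<lambda>s. poisson y (x - s) * cmod (g s) powr p)"
    using fin y by (intro integrableI_nonneg) auto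
  note intP = poisson_has_integral[OF y, of x]
  have int1: "integrable lborel (\<lambda>s. poisson y (x - s) * cmod (g s))"
  proof (rule Bochner_Integration.integrable_bound[OF Bochner_Integration.integrable_add[OF intP(1) intp]])
    show "AE s in lborel. norm (poisson y (x - s) * cmod (g s)) \<le>
       norm (poisson y (x - s) + poisson y (x - s) * cmod (g s) powr p)"
    proof (rule AE_I2)
      fix s
      have "poisson y (x - s) * cmod (g s) \<le> poisson y (x - s) * (1 + cmod (g s) powr p)"
        by (intro mult_left_mono le_one_plus_powr p P0) auto
      then show "norm (poisson y (x - s) * cmod (g s)) \<le>
          norm (poisson y (x - s) + poisson y (x - s) * cmod (g s) powr p)"
        by (simp add: P0 distrib_left)
    qed
  qed measurable
  show "integrable lborel (\<lambda>s. poisson y (x - s) *\<^sub>R g s)"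
    by (rule Bochner_Integration.integrable_bound[OF int1]) (auto simp: abs_mult)
  define m where "m = (LINT s|lborel. poisson y (x - s) * cmod (g s))"
  have m0: "m \<ge> 0" unfolding m_def by (intro integral_nonneg_AE) (auto simp: P0)
  have le_m: "cmod (poisson_ext g (Complex x y)) \<le> m"
    unfolding poisson_ext_def m_def using integral_norm_bound[of lborel "\<lambda>s. poisson y (x - s) *\<^sub>R g s"]
    by (simp add: P0)
  have "m powr p \<le> (LINT s|lborel. poisson y (x - s) * cmod (g s) powr p)"
  proof (cases "m = 0")
    case True
    then show ?thesis by (auto intro!: integral_nonneg_AE simp: P0)
  next
    case False
    then have m: "m > 0" using m0 by simp
    have "(LINT s|lborel. (m powr p - p * m powr (p - 1) * m) * poisson y (x - s)
            + p * m powr (p - 1) * (poisson y (x - s) * cmod (g s)))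
       \<le> (LINT s|lborel. poisson y (x - s) * cmod (g s) powr p)"
    proof (rule integral_mono)
      fix s
      have "poisson y (x - s) * (m powr p + p * m powr (p - 1) * (cmod (g s) - m))
         \<le> poisson y (x - s) * cmod (g s) powr p"
        by (intro mult_left_mono powr_tangent_line p m P0) auto
      then show "(m powr p - p * m powr (p - 1) * m) * poisson y (x - s)
            + p * m powr (p - 1) * (poisson y (x - s) * cmod (g s)) \<le> poisson y (x - s) * cmod (g s) powr p"
        by (simp add: algebra_simps)
    qed (use intP int1 intp in auto)
    also have "(LINT s|lborel. (m powr p - p * m powr (p - 1) * m) * poisson y (x - s)
            + p * m powr (p - 1) * (poisson y (x - s) * cmod (g s)))
       = (m powr p - p * m powr (p - 1) * m) * 1 + p * m powr (p - 1) * m"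
      using intP int1 by (simp add: m_def)
    finally show ?thesis by simp
  qed
  then have "cmod (poisson_ext g (Complex x y)) powr p \<le> (LINT s|lborel. poisson y (x - s) * cmod (g s) powr p)"
    using powr_mono2[OF _ norm_ge_zero le_m, of p] p by linarith
  then show "ennreal (cmod (poisson_ext g (Complex x y)) powr p)
       \<le> (\<integral>\<^sup>+ s. ennreal (poisson y (x - s) * cmod (g s) powr p) \<partial>lborel)"
    by (subst nn_integral_eq_integral[OF intp]) (auto simp: P0 intro: ennreal_leI)
qed

lemma nn_integral_poisson_mult_le:
  fixes \<phi> :: "real \<Rightarrow> real"
  assumes [measurable]: "\<phi> \<in> borel_measurable borel" and \<phi>: "\<And>s. \<phi> s \<ge> 0" and y: "y > 0"
  shows "(\<integral>\<^sup>+ s. ennreal (poisson y (x - s) * \<phi> s) \<partial>lborel) \<le> ennreal (1 / (pi * y)) * (\<integral>\<^sup>+ s. ennreal (\<phi> s) \<partial>lborel)"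
proof -
  have "(\<integral>\<^sup>+ s. ennreal (poisson y (x - s) * \<phi> s) \<partial>lborel) \<le> (\<integral>\<^sup>+ s. ennreal (1 / (pi * y)) * ennreal (\<phi> s) \<partial>lborel)"
  proof (intro nn_integral_mono)
    fix s
    have "poisson y (x - s) * \<phi> s \<le> 1 / (pi * y) * \<phi> s"
      by (intro mult_right_mono poisson_le y \<phi>)
    then show "ennreal (poisson y (x - s) * \<phi> s) \<le> ennreal (1 / (pi * y)) * ennreal (\<phi> s)"
      using y by (subst ennreal_mult[symmetric]) (auto simp: \<phi> intro!: ennreal_leI)
  qed
  then show ?thesis by (simp add: nn_integral_cmult)
qed

lemma Lp_poisson_integrable:
  fixes g :: "real \<Rightarrow> complex"
  assumes [measurable]: "g \<in> borel_measurable borel" and p: "p \<ge> 1"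
    and fin: "(\<integral>\<^sup>+ s. ennreal (cmod (g s) powr p) \<partial>lborel) < \<infinity>"
  shows "poisson_integrable g"
    and "y > 0 \<Longrightarrow> (\<integral>\<^sup>+ s. ennreal (poisson y (x - s) * cmod (g s) powr p) \<partial>lborel) < \<infinity>"
proof -
  show 1: "y > 0 \<Longrightarrow> (\<integral>\<^sup>+ s. ennreal (poisson y (x - s) * cmod (g s) powr p) \<partial>lborel) < \<infinity>" for y x
    using fin by (intro le_less_trans[OF nn_integral_poisson_mult_le]) (auto simp: ennreal_mult_less_top)
  show "poisson_integrable g"
    using poisson_jensen(1)[OF _ p zero_less_one 1, of 0]
    by (simp add: poisson_integrable_def)
qed

lemma nn_integral_poisson_convolution:
  fixes \<phi> :: "real \<Rightarrow> ennreal"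
  assumes [measurable]: "\<phi> \<in> borel_measurable borel" and y: "y > 0"
  shows "(\<integral>\<^sup>+ x. (\<integral>\<^sup>+ s. ennreal (poisson y (x - s)) * \<phi> s \<partial>lborel) \<partial>lborel) = (\<integral>\<^sup>+ s. \<phi> s \<partial>lborel)"
proof -
  have "(\<integral>\<^sup>+ x. (\<integral>\<^sup>+ s. ennreal (poisson y (x - s)) * \<phi> s \<partial>lborel) \<partial>lborel)
     = (\<integral>\<^sup>+ s. (\<integral>\<^sup>+ x. ennreal (poisson y (x - s)) * \<phi> s \<partial>lborel) \<partial>lborel)"
    by (rule lborel_pair.Fubini') (simp add: split_beta')
  also have "\<dots> = (\<integral>\<^sup>+ s. (\<integral>\<^sup>+ x. ennreal (poisson y (s - x)) \<partial>lborel) * \<phi> s \<partial>lborel)"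
    by (subst poisson_commute) (simp add: nn_integral_multc)
  finally show ?thesis by (simp add: nn_integral_poisson[OF y])
qed

lemma poisson_ext_measurable [measurable]:
  assumes [measurable]: "g \<in> borel_measurable borel"
  shows "(\<lambda>x. poisson_ext g (Complex x y)) \<in> borel_measurable borel"
  unfolding poisson_ext_def complex.sel
  by (rule lborel.borel_measurable_lebesgue_integral) measurable

lemma poisson_Lp_contraction:
  fixes g :: "real \<Rightarrow> complex"
  assumes [measurable]: "g \<in> borel_measurable borel" and p: "p \<ge> 1" and y: "y > 0"
    and fin: "(\<integral>\<^sup>+ s. ennreal (cmod (g s) powr p) \<partial>lborel) < \<infinity>"
  shows "(\<integral>\<^sup>+ x. ennreal (cmod (poisson_ext g (Complex x y)) powr p) \<partial>lborel)
     \<le> (\<integral>\<^sup>+ s. ennreal (cmod (g s) powr p) \<partial>lborel)"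
proof -
  have "(\<integral>\<^sup>+ x. ennreal (cmod (poisson_ext g (Complex x y)) powr p) \<partial>lborel)
     \<le> (\<integral>\<^sup>+ x. (\<integral>\<^sup>+ s. ennreal (poisson y (x - s)) * ennreal (cmod (g s) powr p) \<partial>lborel) \<partial>lborel)"
  proof (intro nn_integral_mono)
    fix x
    show "ennreal (cmod (poisson_ext g (Complex x y)) powr p)
       \<le> (\<integral>\<^sup>+ s. ennreal (poisson y (x - s)) * ennreal (cmod (g s) powr p) \<partial>lborel)"
      using poisson_jensen(2)[OF _ p y Lp_poisson_integrable(2)[OF _ p fin y], of x] y
      by (simp add: ennreal_mult)
  qed
  also have "\<dots> = (\<integral>\<^sup>+ s. ennreal (cmod (g s) powr p) \<partial>lborel)"
    by (rule nn_integral_poisson_convolution[OF _ y]) simp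
  finally show ?thesis .
qed

lemma poisson_ext_tendsto_height:
  assumes g: "poisson_integrable g" and y: "y > 0" and lim: "Y \<longlonglongrightarrow> y"
  shows "(\<lambda>n. poisson_ext g (Complex x (Y n))) \<longlonglongrightarrow> poisson_ext g (Complex x y)"
proof -
  have [measurable]: "g \<in> borel_measurable borel" by (rule poisson_integrable_measurable[OF g])
  \<comment> \<open>Dominates the constant of \<open>poisson_le_poisson_1\<close> for all heights
    between y/2 and 2 y, where the sequence eventually stays.\<close>
  define K where "K = 2 * y * (2 + (1 + 2 * x\<^sup>2) / (y / 2)\<^sup>2)"
  obtain N where N: "\<And>n. n \<ge> N \<Longrightarrow> \<bar>Y n - y\<bar> < y / 2"
    using lim y by (metis LIMSEQ_iff half_gt_zero real_norm_def)
  have Yn: "y / 2 < Y (n + N)" "Y (n + N) < 2 * y" for n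
    using N[of "n + N"] y by linarith+
  have bound: "poisson (Y (n + N)) (x - s) \<le> K * poisson 1 s" for n s
  proof -
    have "poisson (Y (n + N)) (x - s) \<le> Y (n + N) * (2 + (1 + 2 * x\<^sup>2) / (Y (n + N))\<^sup>2) * poisson 1 s"
      using Yn[of n] y by (intro poisson_le_poisson_1) auto
    also have "\<dots> \<le> K * poisson 1 s"
      unfolding K_def using Yn[of n] y
      by (intro mult_right_mono mult_mono add_mono divide_left_mono power_mono mult_pos_pos
          add_nonneg_nonneg zero_less_power) auto
    finally show ?thesis .
  qed
  have "(\<lambda>n. poisson_ext g (Complex x (Y (n + N)))) \<longlonglongrightarrow> poisson_ext g (Complex x y)"
    unfolding poisson_ext_def complex.sel
  proof (rule integral_dominated_convergence[where w = "\<lambda>s. K * norm (poisson 1 s *\<^sub>R g s)"])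
    show "integrable lborel (\<lambda>s. K * norm (poisson 1 s *\<^sub>R g s))"
      using g by (intro integrable_mult_right integrable_norm) (simp add: poisson_integrable_def)
    show "AE s in lborel. (\<lambda>n. poisson (Y (n + N)) (x - s) *\<^sub>R g s) \<longlonglongrightarrow> poisson y (x - s) *\<^sub>R g s"
    proof (intro AE_I2 tendsto_scaleR tendsto_const)
      fix s
      have "(x - s)\<^sup>2 + y\<^sup>2 > 0" using y by (intro add_nonneg_pos) auto
      then show "(\<lambda>n. poisson (Y (n + N)) (x - s)) \<longlonglongrightarrow> poisson y (x - s)"
        unfolding poisson_def
        by (intro tendsto_intros LIMSEQ_ignore_initial_segment[OF lim]) auto
    qed
    fix n
    have "poisson (Y (n + N)) (x - s) \<ge> 0" for s using Yn[of n] y by simp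
    then show "AE s in lborel. norm (poisson (Y (n + N)) (x - s) *\<^sub>R g s) \<le> K * norm (poisson 1 s *\<^sub>R g s)"
      using bound[of n] by (auto intro!: AE_I2 mult_right_mono simp flip: mult.assoc)
  qed measurable
  then show ?thesis by (rule LIMSEQ_offset)
qed

lemma borel_measurable_cnj [measurable (raw)]:
  "f \<in> borel_measurable M \<Longrightarrow> (\<lambda>x. cnj (f x)) \<in> borel_measurable M"
  by (rule borel_measurable_continuous_on[where f = cnj]) (auto intro: continuous_intros)

lemma mult_le_sum_squares:
  fixes s t :: real
  assumes "s \<ge> 0" "t \<ge> 0"
  shows "s * t \<le> s\<^sup>2 + t\<^sup>2"
  using sum_squares_bound[of s t] assms mult_nonneg_nonneg[of s t] by linarith

lemma nn_integral_powr_2: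
  fixes f :: "'a \<Rightarrow> complex"
  shows "(\<integral>\<^sup>+ s. ennreal (cmod (f s) powr 2) \<partial>M) = (\<integral>\<^sup>+ s. ennreal ((cmod (f s))\<^sup>2) \<partial>M)"
  by (intro nn_integral_cong) simp

section \<open>Boundary values of \<open>L\<^sup>2\<close>-bounded Poisson semigroups\<close>

text \<open>
  Self-adjointness of the Poisson semigroup makes \<open>\<langle>v a, v b\<rangle>\<close> depend on \<open>a + b\<close> only, hence
  \<open>\<parallel>v a - v b\<parallel>\<^sup>2 = \<parallel>v a\<parallel>\<^sup>2 + \<parallel>v b\<parallel>\<^sup>2 - 2 \<parallel>v ((a + b) / 2)\<parallel>\<^sup>2\<close>, and \<open>\<parallel>v a\<parallel>\<close> is monotone in \<open>a\<close>:
  the family is Cauchy in the quadratic mean as \<open>a \<rightarrow> 0\<close>, without any weak compactness.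
\<close>

locale L2_semigroup =
  fixes v :: "complex \<Rightarrow> complex" and M :: real
  assumes meas [measurable]: "y > 0 \<Longrightarrow> (\<lambda>x. v (Complex x y)) \<in> borel_measurable borel"
    and semigroup: "y > 0 \<Longrightarrow> t > 0 \<Longrightarrow> v (Complex x (y + t)) = poisson_ext (\<lambda>s. v (Complex s y)) (Complex x t)"
    and bound: "y > 0 \<Longrightarrow> (\<integral>\<^sup>+ x. ennreal ((cmod (v (Complex x y)))\<^sup>2) \<partial>lborel) \<le> ennreal M"
begin

definition nrm :: "real \<Rightarrow> real"
  where "nrm y = (LINT x|lborel. (cmod (v (Complex x y)))\<^sup>2)"

lemma integrable_square: "y > 0 \<Longrightarrow> integrable lborel (\<lambda>x. (cmod (v (Complex x y)))\<^sup>2)"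
  using bound[of y] by (intro integrableI_nonneg) (auto intro: le_less_trans)

lemma nn_nrm: "y > 0 \<Longrightarrow> (\<integral>\<^sup>+ x. ennreal ((cmod (v (Complex x y)))\<^sup>2) \<partial>lborel) = ennreal (nrm y)"
  unfolding nrm_def by (rule nn_integral_eq_integral[OF integrable_square]) auto

lemma nrm_nonneg: "nrm y \<ge> 0"
  unfolding nrm_def by (intro integral_nonneg_AE) auto

lemma nrm_le: "y > 0 \<Longrightarrow> nrm y \<le> max 0 M"
  using bound[of y] nn_nrm[of y] by (auto simp: ennreal_le_iff2 le_max_iff_disj)

lemma nrm_antimono:
  assumes "0 < a" "a \<le> b"
  shows "nrm b \<le> nrm a"
proof (cases "a = b")
  case False
  then have ab: "b - a > 0" using assms by simp
  have eq: "v (Complex x b) = poisson_ext (\<lambda>s. v (Complex s a)) (Complex x (b - a))" for x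
    using semigroup[OF assms(1) ab, of x] by simp
  have "ennreal (nrm b) \<le> ennreal (nrm a)"
    using poisson_Lp_contraction[of "\<lambda>s. v (Complex s a)" 2 "b - a"] assms ab bound[of a]
    by (simp add: nn_integral_powr_2 eq[symmetric] nn_nrm[symmetric] le_less_trans[OF _ ennreal_less_top])
  then show ?thesis using nrm_nonneg[of a] by simp
qed simp

lemma integrable_inner:
  assumes "a > 0" "b > 0"
  shows "integrable lborel (\<lambda>x. v (Complex x a) * cnj (v (Complex x b)))"
proof (rule Bochner_Integration.integrable_bound
    [OF Bochner_Integration.integrable_add[OF integrable_square[OF assms(1)] integrable_square[OF assms(2)]]])
  show "AE x in lborel. norm (v (Complex x a) * cnj (v (Complex x b)))
      \<le> norm ((cmod (v (Complex x a)))\<^sup>2 + (cmod (v (Complex x b)))\<^sup>2)"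
    by (intro AE_I2) (simp add: norm_mult mult_le_sum_squares)
qed (use assms in measurable)

definition inn :: "real \<Rightarrow> real \<Rightarrow> complex"
  where "inn a b = (LINT x|lborel. v (Complex x a) * cnj (v (Complex x b)))"

text \<open>Raising the height by \<open>t\<close> is convolution with a kernel symmetric in both
  variables, so Fubini moves it from one factor to the other. Absolute integrability follows from |a
  b| <= |a|^2 + |b|^2, since each square integrates to the squared norm at one height.\<close>

lemma inn_shift:
  assumes a: "a > 0" and b: "b > 0" and t: "t > 0"
  shows "inn (a + t) b = inn a (b + t)"
proof -
  define va vb where "va = (\<lambda>s. v (Complex s a))" and "vb = (\<lambda>s. v (Complex s b))"
  have [measurable]: "va \<in> borel_measurable borel" "vb \<in> borel_measurable borel"
    using a b by (auto simp: va_def vb_def)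
  let ?K = "\<lambda>x s. poisson t (x - s) *\<^sub>R (va s * cnj (vb x))"
  have mK: "(\<lambda>(x, s). ?K x s) \<in> borel_measurable (lborel \<Otimes>\<^sub>M lborel)"
    by measurable
  have intK: "integrable (lborel \<Otimes>\<^sub>M lborel) (\<lambda>(x, s). ?K x s)"
  proof (rule integrableI_bounded[OF mK])
    have "(\<integral>\<^sup>+ z. ennreal (norm (case z of (x, s) \<Rightarrow> ?K x s)) \<partial>(lborel \<Otimes>\<^sub>M lborel))
        = (\<integral>\<^sup>+ x. (\<integral>\<^sup>+ s. ennreal (norm (?K x s)) \<partial>lborel) \<partial>lborel)"
      by (subst lborel.nn_integral_fst[symmetric]) (use mK in \<open>auto simp: split_beta'\<close>)
    also have "\<dots> \<le> (\<integral>\<^sup>+ x. (\<integral>\<^sup>+ s. ennreal (poisson t (x - s)) * ennreal ((cmod (va s))\<^sup>2)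
         + ennreal (poisson t (x - s)) * ennreal ((cmod (vb x))\<^sup>2) \<partial>lborel) \<partial>lborel)"
    proof (intro nn_integral_mono)
      fix x s
      have "norm (?K x s) \<le> poisson t (x - s) * ((cmod (va s))\<^sup>2 + (cmod (vb x))\<^sup>2)"
        using t by (simp add: norm_mult mult_left_mono mult_le_sum_squares)
      then have "ennreal (norm (?K x s)) \<le> ennreal (poisson t (x - s) * ((cmod (va s))\<^sup>2 + (cmod (vb x))\<^sup>2))"
        by (rule ennreal_leI)
      also have "\<dots> = ennreal (poisson t (x - s)) * ennreal ((cmod (va s))\<^sup>2)
         + ennreal (poisson t (x - s)) * ennreal ((cmod (vb x))\<^sup>2)"
        using t by (simp add: ennreal_mult distrib_left)
      finally show "ennreal (norm (?K x s)) \<le> ennreal (poisson t (x - s)) * ennreal ((cmod (va s))\<^sup>2)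
         + ennreal (poisson t (x - s)) * ennreal ((cmod (vb x))\<^sup>2)" .
    qed
    also have "\<dots> = (\<integral>\<^sup>+ x. (\<integral>\<^sup>+ s. ennreal (poisson t (x - s)) * ennreal ((cmod (va s))\<^sup>2) \<partial>lborel)
         + ennreal ((cmod (vb x))\<^sup>2) \<partial>lborel)"
      by (subst nn_integral_add) (auto simp: nn_integral_multc nn_integral_poisson[OF t])
    also have "\<dots> = (\<integral>\<^sup>+ x. (\<integral>\<^sup>+ s. ennreal (poisson t (x - s)) * ennreal ((cmod (va s))\<^sup>2) \<partial>lborel) \<partial>lborel)
       + (\<integral>\<^sup>+ x. ennreal ((cmod (vb x))\<^sup>2) \<partial>lborel)"
      by (rule nn_integral_add) auto
    also have "\<dots> = ennreal (nrm a) + ennreal (nrm b)"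
      using nn_integral_poisson_convolution[of "\<lambda>s. ennreal ((cmod (va s))\<^sup>2)" t] t
      by (simp add: nn_nrm a b va_def vb_def)
    also have "\<dots> < \<infinity>" by simp
    finally show "(\<integral>\<^sup>+ z. ennreal (norm (case z of (x, s) \<Rightarrow> ?K x s)) \<partial>(lborel \<Otimes>\<^sub>M lborel)) < \<infinity>" .
  qed
  have pint: "integrable lborel (\<lambda>s. poisson t (x - s) *\<^sub>R v (Complex s c))" if "c > 0" for x c
    using that t bound[OF that]
    by (intro poisson_integrableD Lp_poisson_integrable(1)[where p = 2])
       (auto simp: nn_integral_powr_2 intro: le_less_trans)
  have "inn (a + t) b = (LINT x|lborel. (LINT s|lborel. ?K x s))"
    unfolding inn_def using semigroup[OF a t] pint[OF a]
  proof -
    have "v (Complex x (a + t)) * cnj (vb x) = (LINT s|lborel. ?K x s)" for x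
    proof -
      have "?K x s = (poisson t (x - s) *\<^sub>R va s) * cnj (vb x)" for s by simp
      then show ?thesis
        using semigroup[OF a t, of x]
        by (simp only: integral_mult_left_zero) (simp add: poisson_ext_def va_def)
    qed
    then show "(LINT x|lborel. v (Complex x (a + t)) * cnj (v (Complex x b)))
        = (LINT x|lborel. (LINT s|lborel. ?K x s))"
      by (simp add: vb_def)
  qed
  also have "\<dots> = (LINT s|lborel. (LINT x|lborel. ?K x s))"
    by (rule lborel_pair.Fubini_integral[symmetric, OF intK])
  also have "\<dots> = inn a (b + t)"
  proof -
    have "(LINT x|lborel. ?K x s) = v (Complex s a) * cnj (v (Complex s (b + t)))" for s
    proof -
      have "cnj (v (Complex s (b + t))) = (LINT x|lborel. poisson t (x - s) *\<^sub>R cnj (v (Complex x b)))"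
        unfolding semigroup[OF b t] poisson_ext_def complex.sel
        by (subst Bochner_Integration.integral_cnj[symmetric]) (simp add: poisson_commute[of t s])
      moreover have "?K x s = v (Complex s a) * (poisson t (x - s) *\<^sub>R cnj (v (Complex x b)))" for x
        by (simp add: va_def vb_def)
      ultimately show ?thesis
        using pint[OF b, of s]
        by (simp only: integral_mult_right_zero)
    qed
    then show ?thesis by (simp add: inn_def)
  qed
  finally show ?thesis .
qed

lemma inn_eq_nrm:
  assumes "a > 0" "b > 0"
  shows "inn a b = of_real (nrm ((a + b) / 2))"
proof -
  have diag: "inn c c = of_real (nrm c)" for c
    by (simp add: inn_def nrm_def complex_norm_square[symmetric] flip: integral_complex_of_real)
  \<comment> \<open>Half of the gap is moved from the upper to the lower height, so that both
    factors meet at the midpoint.\<close>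
  have *: "inn a b = of_real (nrm ((a + b) / 2))" if "0 < a" "a < b" for a b
    using inn_shift[of a "(a + b) / 2" "(b - a) / 2"] that diag[of "(a + b) / 2"]
    by (simp add: field_simps)
  have sym: "inn b a = cnj (inn a b)" for a b
    unfolding inn_def by (simp add: mult.commute flip: Bochner_Integration.integral_cnj)
  consider "a < b" | "a = b" | "b < a" by linarith
  then show ?thesis
  proof cases
    case 1 then show ?thesis using * assms by simp
  next
    case 2 then show ?thesis using diag by simp
  next
    case 3 then show ?thesis using *[OF assms(2) 3] sym[of a b]
      by (simp only: complex_cnj_complex_of_real add.commute)
  qed
qed

lemma nrm_diff:
  assumes "a > 0" "b > 0"
  shows "(\<integral>\<^sup>+ x. ennreal ((cmod (v (Complex x a) - v (Complex x b)))\<^sup>2) \<partial>lborel)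
     = ennreal (nrm a + nrm b - 2 * nrm ((a + b) / 2))"
proof -
  have eq: "(cmod (z - w))\<^sup>2 = (cmod z)\<^sup>2 + (cmod w)\<^sup>2 - 2 * Re (z * cnj w)" for z w
    unfolding cmod_power2 by (simp add: power2_eq_square algebra_simps)
  note ints = integrable_square[OF assms(1)] integrable_square[OF assms(2)] integrable_inner[OF assms]
  have i: "integrable lborel (\<lambda>x. (cmod (v (Complex x a) - v (Complex x b)))\<^sup>2)"
    unfolding eq using ints by (intro Bochner_Integration.integrable_add Bochner_Integration.integrable_diff
        integrable_mult_right integrable_Re) auto
  have "(LINT x|lborel. (cmod (v (Complex x a) - v (Complex x b)))\<^sup>2) = nrm a + nrm b - 2 * Re (inn a b)"
    unfolding eq nrm_def inn_def 
    using ints integral_Re[OF ints(3)] by (simp del: times_complex.sel)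
  then show ?thesis
    using nn_integral_eq_integral[OF i] inn_eq_nrm[OF assms] by simp
qed

lemma nrm_diff_le:
  assumes "0 < d" "d \<le> a" "d \<le> b" "\<And>y. y > 0 \<Longrightarrow> nrm y \<le> L" "c > 0" "a \<le> c" "b \<le> c"
  shows "(\<integral>\<^sup>+ x. ennreal ((cmod (v (Complex x a) - v (Complex x b)))\<^sup>2) \<partial>lborel) \<le> ennreal (2 * (L - nrm c))"
proof -
  have "nrm c \<le> nrm ((a + b) / 2)" using assms by (intro nrm_antimono) auto
  moreover have "nrm a \<le> L" "nrm b \<le> L" using assms by auto
  ultimately have "nrm a + nrm b - 2 * nrm ((a + b) / 2) \<le> 2 * (L - nrm c)"
    by argo
  then show ?thesis using assms by (subst nrm_diff) (auto intro: ennreal_leI)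
qed

text \<open>The squared norm increases as the height decreases, towards its supremum
  \<open>L\<close>. Heights where it is within (1/8)^k of \<open>L\<close> have squared distances of
  at most 2 (1/8)^k, a rate that remains summable after multiplication by 4^k.\<close>

lemma fast_sequence:
  obtains Y :: "nat \<Rightarrow> real"
  where "\<And>k. Y k > 0" "Y \<longlonglongrightarrow> 0"
    "\<And>j k. k \<le> j \<Longrightarrow>
       (\<integral>\<^sup>+ x. ennreal ((cmod (v (Complex x (Y j)) - v (Complex x (Y k))))\<^sup>2) \<partial>lborel) \<le> ennreal (2 * (1/8) ^ k)"
proof -
  define L where "L = (SUP y\<in>{0<..}. nrm y)"
  have bdd: "bdd_above (nrm ` {0<..})"
    using nrm_le by (intro bdd_aboveI[of _ "max 0 M"]) auto
  have L: "nrm y \<le> L" if "y > 0" for y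
    unfolding L_def using that by (intro cSUP_upper bdd) auto
  have "\<exists>y. 0 < y \<and> y \<le> 1 / real (Suc k) \<and> L - nrm y \<le> (1/8) ^ k" for k
  proof -
    have "L - (1/8) ^ k < L" by simp
    then obtain d where d: "d > 0" "L - (1/8) ^ k < nrm d"
      unfolding L_def by (subst (asm) less_cSUP_iff[OF _ bdd]) auto
    have "nrm d \<le> nrm (min d (1 / real (Suc k)))" using d by (intro nrm_antimono) auto
    \<comment> \<open>The minimum also forces the heights to 0; lowering \<open>d\<close> only
      increases the norm.\<close>
    then show ?thesis using d by (intro exI[of _ "min d (1 / real (Suc k))"]) auto
  qed
  then obtain Y where Y: "\<And>k. 0 < Y k" "\<And>k. Y k \<le> 1 / real (Suc k)" "\<And>k. L - nrm (Y k) \<le> (1/8) ^ k"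
    by metis
  show thesis
  proof
    show "Y k > 0" for k by (rule Y)
    have "(\<lambda>k. 1 / real (Suc k)) \<longlonglongrightarrow> 0"
      using LIMSEQ_inverse_real_of_nat by (simp add: inverse_eq_divide)
    then show "Y \<longlonglongrightarrow> 0"
      by (rule Lim_null_comparison[rotated]) (use Y in \<open>auto intro!: always_eventually simp: abs_of_pos\<close>)
    fix j k :: nat assume jk: "k \<le> j"
    \<comment> \<open>The sequence \<open>Y\<close> is not known to be decreasing, so either of the
      two heights may be the larger.\<close>
    have "nrm (max (Y j) (Y k)) \<ge> L - (1/8) ^ k"
    proof (cases "Y j \<le> Y k")
      case True then show ?thesis using Y(3)[of k] by (simp add: max_def)
    next
      case False
      have "(1/8::real) ^ j \<le> (1/8) ^ k" using jk by (intro power_decreasing) auto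
      then have "nrm (Y j) \<ge> L - (1/8) ^ k" using Y(3)[of j] by linarith
      then show ?thesis using False by (simp add: max_def)
    qed
    then have "2 * (L - nrm (max (Y j) (Y k))) \<le> 2 * (1/8) ^ k" by simp
    then show "(\<integral>\<^sup>+ x. ennreal ((cmod (v (Complex x (Y j)) - v (Complex x (Y k))))\<^sup>2) \<partial>lborel) \<le> ennreal (2 * (1/8) ^ k)"
      using Y(1)[of j] Y(1)[of k] L
      by (intro order.trans[OF nrm_diff_le[of "min (Y j) (Y k)" _ _ L "max (Y j) (Y k)"]] ennreal_leI) auto
  qed
qed

text \<open>With D_k the successive differences, the sum of 4^k |D_k|^2 has finite integral, hence
  is finite almost everywhere. There |D_k| <= sqrt C / 2^k, and the telescoping series converges
  absolutely.\<close>

lemma AE_convergent: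
  assumes Y: "\<And>k. Y k > 0" and fast: "\<And>j k. k \<le> j \<Longrightarrow>
       (\<integral>\<^sup>+ x. ennreal ((cmod (v (Complex x (Y j)) - v (Complex x (Y k))))\<^sup>2) \<partial>lborel) \<le> ennreal (2 * (1/8) ^ k)"
  shows "AE x in lborel. convergent (\<lambda>k. v (Complex x (Y k)))"
proof -
  have [measurable]: "(\<lambda>x. v (Complex x (Y k))) \<in> borel_measurable borel" for k
    using Y by (rule meas)
  define D where "D = (\<lambda>k x. v (Complex x (Y (Suc k))) - v (Complex x (Y k)))"
  have [measurable]: "D k \<in> borel_measurable borel" for k unfolding D_def by measurable
  have "(\<integral>\<^sup>+ x. (\<Sum>k. ennreal (4 ^ k) * ennreal ((cmod (D k x))\<^sup>2)) \<partial>lborel)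
      = (\<Sum>k. (\<integral>\<^sup>+ x. ennreal (4 ^ k) * ennreal ((cmod (D k x))\<^sup>2) \<partial>lborel))"
    by (rule nn_integral_suminf) simp
  also have "\<dots> \<le> (\<Sum>k. ennreal (2 * (1/2) ^ k))"
  proof (rule suminf_le)
    fix k
    have "(\<integral>\<^sup>+ x. ennreal (4 ^ k) * ennreal ((cmod (D k x))\<^sup>2) \<partial>lborel)
        = ennreal (4 ^ k) * (\<integral>\<^sup>+ x. ennreal ((cmod (D k x))\<^sup>2) \<partial>lborel)"
      by (rule nn_integral_cmult) simp
    also have "\<dots> \<le> ennreal (4 ^ k) * ennreal (2 * (1/8) ^ k)"
      unfolding D_def by (intro mult_left_mono fast) auto
    also have "\<dots> = ennreal (2 * (1/2) ^ k)"
      by (subst ennreal_mult[symmetric]) (auto simp: power_mult_distrib[symmetric])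
    finally show "(\<integral>\<^sup>+ x. ennreal (4 ^ k) * ennreal ((cmod (D k x))\<^sup>2) \<partial>lborel) \<le> ennreal (2 * (1/2) ^ k)" .
  qed auto
  also have "\<dots> < \<infinity>"
  proof -
    have "summable (\<lambda>k. 2 * (1/2::real) ^ k)" by (intro summable_mult summable_geometric) auto
    then have "(\<Sum>k. ennreal (2 * (1/2) ^ k)) = ennreal (\<Sum>k. 2 * (1/2) ^ k)"
      by (intro suminf_ennreal2) auto
    then show ?thesis by simp
  qed
  finally have "AE x in lborel. (\<Sum>k. ennreal (4 ^ k) * ennreal ((cmod (D k x))\<^sup>2)) \<noteq> \<infinity>"
    by (intro nn_integral_PInf_AE) auto
  then show ?thesis
  proof eventually_elim
    case (elim x)
    define C where "C = enn2real (\<Sum>k. ennreal (4 ^ k) * ennreal ((cmod (D k x))\<^sup>2))"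
    have C: "(\<Sum>k. ennreal (4 ^ k) * ennreal ((cmod (D k x))\<^sup>2)) = ennreal C" "C \<ge> 0"
      using elim unfolding C_def by (auto simp: less_top intro!: ennreal_enn2real[symmetric])
    have le: "cmod (D k x) \<le> sqrt C * (1/2) ^ k" for k
    proof -
      have "ennreal (4 ^ k * (cmod (D k x))\<^sup>2) = (\<Sum>k\<in>{k}. ennreal (4 ^ k) * ennreal ((cmod (D k x))\<^sup>2))"
        by (simp add: ennreal_mult)
      also have "\<dots> \<le> ennreal C"
        unfolding C(1)[symmetric] by (intro sum_le_suminf) auto
      finally have "4 ^ k * (cmod (D k x))\<^sup>2 \<le> C" using C(2) by simp
      moreover have "4 ^ k * (cmod (D k x))\<^sup>2 = (2 ^ k * cmod (D k x))\<^sup>2"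
      proof -
        have "(2 ^ k)\<^sup>2 = (2\<^sup>2 :: real) ^ k" by (simp only: power_mult[symmetric] mult.commute)
        then show ?thesis by (simp add: power_mult_distrib)
      qed
      ultimately have "2 ^ k * cmod (D k x) \<le> sqrt C" by (simp add: real_le_rsqrt)
      then show ?thesis by (simp add: field_simps)
    qed
    have "summable (\<lambda>k. sqrt C * (1/2) ^ k)" by (intro summable_mult summable_geometric) auto
    then have "summable (\<lambda>k. D k x)" by (rule summable_comparison_test'[where N = 0]) (use le in auto)
    then have "convergent (\<lambda>n. \<Sum>k<n. D k x)" by (simp add: summable_iff_convergent)
    then have "convergent (\<lambda>n. v (Complex x (Y 0)) + (\<Sum>k<n. D k x))"
      by (intro convergent_add convergent_const)
    moreover have "v (Complex x (Y 0)) + (\<Sum>k<n. D k x) = v (Complex x (Y n))" for n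
      using sum_lessThan_telescope[of "\<lambda>k. v (Complex x (Y k))" n] by (simp add: D_def)
    ultimately show "convergent (\<lambda>k. v (Complex x (Y k)))" by simp
  qed
qed

text \<open>\<open>g\<close> is the limit along the fast sequence; Fatou's lemma yields its L^2
  bound and its distance to \<open>v\<close> on each line \<open>Y k\<close>. Jensen and the bound
  1/(pi t) of the kernel convert L^2 distance into pointwise distance of Poisson extensions, so v(x
  + \<i> (t + Y k)) tends to the extension of \<open>g\<close>. Continuity in the height shows that
  it also tends to \<open>v\<close> at height \<open>t\<close>.\<close>

theorem boundary_function:
  "\<exists>g. g \<in> borel_measurable borel \<and> (\<integral>\<^sup>+ s. ennreal ((cmod (g s))\<^sup>2) \<partial>lborel) \<le> ennreal M
     \<and> (\<forall>z. Im z > 0 \<longrightarrow> v z = poisson_ext g z)"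
proof -
  obtain Y where Y: "\<And>k. Y k > 0" "Y \<longlonglongrightarrow> 0"
    and fast: "\<And>j k. k \<le> j \<Longrightarrow>
       (\<integral>\<^sup>+ x. ennreal ((cmod (v (Complex x (Y j)) - v (Complex x (Y k))))\<^sup>2) \<partial>lborel) \<le> ennreal (2 * (1/8) ^ k)"
    by (rule fast_sequence) (rule that)
  have mv[measurable]: "(\<lambda>x. v (Complex x (Y k))) \<in> borel_measurable borel" for k
    using Y(1) by (rule meas)
  \<comment> \<open>\<open>lim\<close> is unspecified where the sequence diverges, but the function
    so defined is still Borel measurable.\<close>
  define g where "g = (\<lambda>x. lim (\<lambda>k. v (Complex x (Y k))))"
  have g[measurable]: "g \<in> borel_measurable borel" unfolding g_def by measurable
  have conv: "AE x in lborel. (\<lambda>k. v (Complex x (Y k))) \<longlonglongrightarrow> g x"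
  proof -
    have "AE x in lborel. convergent (\<lambda>k. v (Complex x (Y k)))"
      by (rule AE_convergent) (rule Y(1), rule fast)
    then show ?thesis by eventually_elim (simp add: g_def convergent_LIMSEQ_iff)
  qed
  have gM: "(\<integral>\<^sup>+ s. ennreal ((cmod (g s))\<^sup>2) \<partial>lborel) \<le> ennreal M"
  proof -
    have "(\<integral>\<^sup>+ s. ennreal ((cmod (g s))\<^sup>2) \<partial>lborel)
        = (\<integral>\<^sup>+ s. liminf (\<lambda>k. ennreal ((cmod (v (Complex s (Y k))))\<^sup>2)) \<partial>lborel)"
    proof (intro nn_integral_cong_AE, use conv in eventually_elim)
      case (elim s)
      then have "(\<lambda>k. ennreal ((cmod (v (Complex s (Y k))))\<^sup>2)) \<longlonglongrightarrow> ennreal ((cmod (g s))\<^sup>2)"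
        by (intro tendsto_intros)
      then show ?case by (intro lim_imp_Liminf[symmetric]) simp_all
    qed
    also have "\<dots> \<le> liminf (\<lambda>k. \<integral>\<^sup>+ s. ennreal ((cmod (v (Complex s (Y k))))\<^sup>2) \<partial>lborel)"
      by (intro nn_integral_liminf) measurable
    also have "\<dots> \<le> ennreal M"
      by (rule Liminf_le) (use bound Y in \<open>auto intro!: always_eventually\<close>)
    finally show ?thesis .
  qed
  have dist: "(\<integral>\<^sup>+ s. ennreal ((cmod (g s - v (Complex s (Y k))))\<^sup>2) \<partial>lborel) \<le> ennreal (2 * (1/8) ^ k)" for k
  proof -
    have "(\<integral>\<^sup>+ s. ennreal ((cmod (g s - v (Complex s (Y k))))\<^sup>2) \<partial>lborel)
        = (\<integral>\<^sup>+ s. liminf (\<lambda>j. ennreal ((cmod (v (Complex s (Y j)) - v (Complex s (Y k))))\<^sup>2)) \<partial>lborel)"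
    proof (intro nn_integral_cong_AE, use conv in eventually_elim)
      case (elim s)
      then have "(\<lambda>j. ennreal ((cmod (v (Complex s (Y j)) - v (Complex s (Y k))))\<^sup>2)) \<longlonglongrightarrow> ennreal ((cmod (g s - v (Complex s (Y k))))\<^sup>2)"
        by (intro tendsto_intros)
      then show ?case by (intro lim_imp_Liminf[symmetric]) simp_all
    qed
    also have "\<dots> \<le> liminf (\<lambda>j. \<integral>\<^sup>+ s. ennreal ((cmod (v (Complex s (Y j)) - v (Complex s (Y k))))\<^sup>2) \<partial>lborel)"
      by (intro nn_integral_liminf) measurable
    also have "\<dots> \<le> ennreal (2 * (1/8) ^ k)"
    proof (rule Liminf_le)
      show "\<forall>\<^sub>F j in sequentially. (\<integral>\<^sup>+ s. ennreal ((cmod (v (Complex s (Y j)) - v (Complex s (Y k))))\<^sup>2) \<partial>lborel)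
          \<le> ennreal (2 * (1/8) ^ k)"
        using eventually_ge_at_top[of k] by eventually_elim (rule fast)
    qed simp
    finally show ?thesis .
  qed
  have gpi: "poisson_integrable g"
    using gM by (intro Lp_poisson_integrable(1)[where p = 2]) (auto simp: nn_integral_powr_2 intro: le_less_trans)
  have vpi: "poisson_integrable (\<lambda>s. v (Complex s y))" if "y > 0" for y
    using bound[OF that] that
    by (intro Lp_poisson_integrable(1)[where p = 2]) (auto simp: nn_integral_powr_2 intro: le_less_trans)
  have "v (Complex x t) = poisson_ext g (Complex x t)" if t: "t > 0" for x t
  proof -
    have "(\<lambda>k. cmod (poisson_ext g (Complex x t) - v (Complex x (t + Y k)))) \<longlonglongrightarrow> 0"
    proof (rule Lim_null_comparison[OF always_eventually])
      have "(\<lambda>k. (1/8::real) ^ k) \<longlonglongrightarrow> 0" by (rule LIMSEQ_realpow_zero) auto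
      then have "(\<lambda>k. sqrt (1 / (pi * t) * (2 * (1/8) ^ k))) \<longlonglongrightarrow> sqrt (1 / (pi * t) * (2 * 0))"
        by (intro tendsto_real_sqrt tendsto_mult tendsto_const)
      then show "(\<lambda>k. sqrt (1 / (pi * t) * (2 * (1/8) ^ k))) \<longlonglongrightarrow> 0" by simp
      show "\<forall>k. norm (cmod (poisson_ext g (Complex x t) - v (Complex x (t + Y k)))) \<le> sqrt (1 / (pi * t) * (2 * (1/8) ^ k))"
      proof
        fix k
        let ?d = "\<lambda>s. g s - v (Complex s (Y k))"
        have "v (Complex x (t + Y k)) = poisson_ext (\<lambda>s. v (Complex s (Y k))) (Complex x t)"
          using semigroup[OF Y(1)[of k] t, of x] by (simp add: add.commute)
        then have eq: "poisson_ext g (Complex x t) - v (Complex x (t + Y k)) = poisson_ext ?d (Complex x t)"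
          using poisson_integrableD[OF gpi t, of x] poisson_integrableD[OF vpi[OF Y(1)[of k]] t, of x]
          by (simp add: poisson_ext_def scaleR_diff_right)
        have fin: "(\<integral>\<^sup>+ s. ennreal (cmod (?d s) powr 2) \<partial>lborel) < \<infinity>"
          unfolding nn_integral_powr_2 by (rule le_less_trans[OF dist]) simp
        have "ennreal (cmod (poisson_ext ?d (Complex x t)) powr 2) \<le> (\<integral>\<^sup>+ s. ennreal (poisson t (x - s) * cmod (?d s) powr 2) \<partial>lborel)"
          by (rule poisson_jensen(2)[OF _ _ t Lp_poisson_integrable(2)[OF _ _ fin t]]) auto
        also have "\<dots> \<le> ennreal (1 / (pi * t)) * (\<integral>\<^sup>+ s. ennreal (cmod (?d s) powr 2) \<partial>lborel)"
          by (rule nn_integral_poisson_mult_le[OF _ _ t]) auto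
        also have "\<dots> \<le> ennreal (1 / (pi * t)) * ennreal (2 * (1/8) ^ k)"
          unfolding nn_integral_powr_2 by (intro mult_left_mono dist) auto
        also have "\<dots> = ennreal (1 / (pi * t) * (2 * (1/8) ^ k))"
          by (rule ennreal_mult[symmetric]) (use t in auto)
        finally have "(cmod (poisson_ext ?d (Complex x t)))\<^sup>2 \<le> 1 / (pi * t) * (2 * (1/8) ^ k)"
          using t by (simp add: ennreal_le_iff)
        then show "norm (cmod (poisson_ext g (Complex x t) - v (Complex x (t + Y k)))) \<le> sqrt (1 / (pi * t) * (2 * (1/8) ^ k))"
          unfolding eq by (simp only: norm_of_real real_norm_def abs_norm_cancel) (rule real_le_rsqrt)
      qed
    qed
    then have 1: "(\<lambda>k. v (Complex x (t + Y k))) \<longlonglongrightarrow> poisson_ext g (Complex x t)"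
      using tendsto_diff[OF tendsto_const[of "poisson_ext g (Complex x t)"] tendsto_norm_zero_cancel]
      by fastforce
    \<comment> \<open>Nothing is assumed about the continuity of \<open>v\<close> in the height. It
      comes from representing all these values as extensions from the fixed line at height
      t/2.\<close>
    have eq: "v (Complex x (t + Y k)) = poisson_ext (\<lambda>s. v (Complex s (t/2))) (Complex x (t/2 + Y k))" for k
      using semigroup[of "t/2" "t/2 + Y k" x] t Y(1)[of k] by (simp add: add.assoc[symmetric])
    have "(\<lambda>k. t/2 + Y k) \<longlonglongrightarrow> t/2 + 0" by (intro tendsto_intros Y)
    then have "(\<lambda>k. v (Complex x (t + Y k))) \<longlonglongrightarrow> poisson_ext (\<lambda>s. v (Complex s (t/2))) (Complex x (t/2))"
      unfolding eq using t by (intro poisson_ext_tendsto_height vpi) auto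
    also have "poisson_ext (\<lambda>s. v (Complex s (t/2))) (Complex x (t/2)) = v (Complex x t)"
      using semigroup[of "t/2" "t/2" x] t by simp
    finally show ?thesis using LIMSEQ_unique 1 by blast
  qed
  then have "v z = poisson_ext g z" if "Im z > 0" for z
    using that by (metis complex.collapse)
  then show ?thesis using g gM by blast
qed

end

section \<open>Nontangential limits of bounded holomorphic functions\<close>

lemma has_nt_limit_mult:
  assumes "has_nt_limit f x a" "has_nt_limit h x b"
  shows "has_nt_limit (\<lambda>z. f z * h z) x (a * b)"
  using assms unfolding has_nt_limit_def by (auto intro: tendsto_mult)

lemma has_nt_limit_cong:
  assumes "has_nt_limit f x a" "\<And>z. Im z > 0 \<Longrightarrow> f z = h z"
  shows "has_nt_limit h x a"
  using assms(1) unfolding has_nt_limit_def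
proof (intro allI impI)
  fix c :: real assume "c > 0" and *: "\<forall>a'>0. (f \<longlongrightarrow> a) (at (complex_of_real x) within {z. 0 < Im z \<and> \<bar>Re z - x\<bar> < a' * Im z})"
  have "(f \<longlongrightarrow> a) (at (complex_of_real x) within {z. 0 < Im z \<and> \<bar>Re z - x\<bar> < c * Im z})"
    using * \<open>c > 0\<close> by blast
  then show "(h \<longlongrightarrow> a) (at (complex_of_real x) within {z. 0 < Im z \<and> \<bar>Re z - x\<bar> < c * Im z})"
    by (rule Lim_transform_eventually) (auto simp: eventually_at_filter assms(2))
qed

lemma has_nt_limit_isCont: "isCont f (of_real x) \<Longrightarrow> has_nt_limit f x (f (of_real x))"
  unfolding has_nt_limit_def isCont_def by (meson subset_UNIV tendsto_within_subset)

lemma has_nt_limit_vertical: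
  assumes "has_nt_limit f x a" "\<And>n. e n > 0" "e \<longlonglongrightarrow> 0"
  shows "(\<lambda>n. f (Complex x (e n))) \<longlonglongrightarrow> a"
proof -
  let ?S = "{z. 0 < Im z \<and> \<bar>Re z - x\<bar> < 1 * Im z}"
  have "(f \<longlongrightarrow> a) (at (complex_of_real x) within ?S)"
    using assms(1) unfolding has_nt_limit_def by (meson zero_less_one)
  moreover have "filterlim (\<lambda>n. Complex x (e n)) (at (complex_of_real x) within ?S) sequentially"
    unfolding filterlim_at
  proof
    show "\<forall>\<^sub>F n in sequentially. Complex x (e n) \<in> ?S \<and> Complex x (e n) \<noteq> complex_of_real x"
      using assms(2) by (intro always_eventually) (auto simp: complex_eq_iff less_imp_neq[symmetric])
    have "(\<lambda>n. Complex x (e n)) \<longlonglongrightarrow> Complex x 0" by (intro tendsto_Complex tendsto_const assms)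
    then show "(\<lambda>n. Complex x (e n)) \<longlonglongrightarrow> complex_of_real x" by (simp add: complex_of_real_def)
  qed
  ultimately show ?thesis by (rule filterlim_compose)
qed

text \<open>A bounded function need not be in L^2 on lines, but its quotient by z + \<i> is: the
  squared modulus is at most 1/(1 + x^2), with integral pi, the constant of the interpretation. The
  Poisson formula for shifts gives the semigroup law, and multiplying by z + \<i> restores
  \<open>B\<close>.\<close>

theorem bounded_holomorphic_boundary:
  assumes hol: "B holomorphic_on {z. Im z > 0}" and bd: "\<And>z. Im z > 0 \<Longrightarrow> cmod (B z) \<le> 1"
  shows "\<exists>b. b \<in> borel_measurable borel \<and> (AE x in lborel. has_nt_limit B x (b x))"
proof -
  define v where "v = (\<lambda>z. B z / (z + \<i>))"
  have nz: "z + \<i> \<noteq> 0" if "Im z > -1" for z using that by (auto simp: complex_eq_iff)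
  have contB: "continuous_on {z. Im z > 0} B" by (rule holomorphic_on_imp_continuous_on[OF hol])
  interpret L2_semigroup v pi
  proof
    fix y :: real assume y: "y > 0"
    have C: "Complex x y = of_real x + \<i> * of_real y" for x by (simp add: complex_eq_iff)
    have "continuous_on UNIV (\<lambda>x. v (Complex x y))"
      unfolding v_def C
      by (intro continuous_intros continuous_on_compose2[OF contB]) (use y nz in \<open>auto simp: complex_eq_iff\<close>)
    then show "(\<lambda>x. v (Complex x y)) \<in> borel_measurable borel" by (rule borel_measurable_continuous_onI)
    have vb: "cmod (v (Complex x y)) \<le> 1 / cmod (Complex x (y + 1))" for x
    proof -
      have "Complex x y + \<i> = Complex x (y + 1)" by (simp add: complex_eq_iff)
      then show ?thesis using bd[of "Complex x y"] y by (simp add: v_def norm_divide divide_right_mono)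
    qed
    have "(\<integral>\<^sup>+ x. ennreal ((cmod (v (Complex x y)))\<^sup>2) \<partial>lborel) \<le> (\<integral>\<^sup>+ x. ennreal pi * ennreal (poisson 1 (0 - x)) \<partial>lborel)"
    proof (intro nn_integral_mono)
      fix x
      have "(cmod (v (Complex x y)))\<^sup>2 \<le> (1 / cmod (Complex x (y + 1)))\<^sup>2" by (intro power_mono vb) auto
      also have "\<dots> = 1 / (x\<^sup>2 + (y + 1)\<^sup>2)" by (simp add: power_divide cmod_power2)
      also have "\<dots> \<le> 1 / (x\<^sup>2 + 1\<^sup>2)"
        using y by (intro divide_left_mono add_left_mono power_mono mult_pos_pos add_nonneg_pos) auto
      also have "\<dots> = pi * poisson 1 (0 - x)" by (simp add: poisson_def)
      finally show "ennreal ((cmod (v (Complex x y)))\<^sup>2) \<le> ennreal pi * ennreal (poisson 1 (0 - x))"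
        by (subst ennreal_mult[symmetric]) (auto intro: ennreal_leI)
    qed
    also have "\<dots> = ennreal pi"
      by (subst nn_integral_cmult) (simp_all add: nn_integral_poisson del: diff_0)
    finally show "(\<integral>\<^sup>+ x. ennreal ((cmod (v (Complex x y)))\<^sup>2) \<partial>lborel) \<le> ennreal pi" .
    fix t x :: real assume t: "t > 0"
    define k where "k = (\<lambda>w. v (w + \<i> * of_real y))"
    have hk: "k holomorphic_on {w. Im w > - y}"
      unfolding k_def v_def
      by (intro holomorphic_intros holomorphic_on_compose_gen[OF _ hol, unfolded comp_def])
         (use y in \<open>auto simp: complex_eq_iff\<close>)
    have bk: "cmod (k w) \<le> 1" if "Im w \<ge> 0" for w
    proof -
      have "1 \<le> cmod (w + \<i> * of_real y + \<i>)"
        using abs_Im_le_cmod[of "w + \<i> * of_real y + \<i>"] that y by simp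
      then show ?thesis
        using bd[of "w + \<i> * of_real y"] that y
        by (simp add: k_def v_def norm_divide divide_le_eq_1)
    qed
    have "Complex x t + \<i> * of_real y = Complex x (y + t)" by (simp add: complex_eq_iff)
    then show "v (Complex x (y + t)) = poisson_ext (\<lambda>s. v (Complex s y)) (Complex x t)"
      using bounded_holomorphic_Poisson(2)[OF hk y t bk, of x]
      by (simp add: poisson_ext_def k_def C scaleR_conv_of_real)
  qed
  obtain g where g: "g \<in> borel_measurable borel" "(\<integral>\<^sup>+ s. ennreal ((cmod (g s))\<^sup>2) \<partial>lborel) \<le> ennreal pi"
     "\<And>z. Im z > 0 \<Longrightarrow> v z = poisson_ext g z"
    using boundary_function by blast
  have gpi: "poisson_integrable g"
    using g by (intro Lp_poisson_integrable(1)[where p = 2]) (auto simp: nn_integral_powr_2 intro: le_less_trans)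
  have "AE x in lborel. has_nt_limit B x (g x * (of_real x + \<i>))"
    using Fatou_poisson[OF gpi]
  proof eventually_elim
    case (elim x)
    have "has_nt_limit v x (g x)" by (rule has_nt_limit_cong[OF elim]) (simp add: g)
    moreover have "has_nt_limit (\<lambda>z. z + \<i>) x (of_real x + \<i>)" by (rule has_nt_limit_isCont) (intro continuous_intros)
    ultimately have "has_nt_limit (\<lambda>z. v z * (z + \<i>)) x (g x * (of_real x + \<i>))" by (rule has_nt_limit_mult)
    then show ?case by (rule has_nt_limit_cong) (use nz in \<open>auto simp: v_def\<close>)
  qed
  moreover have "(\<lambda>x. g x * (of_real x + \<i>)) \<in> borel_measurable borel" using g(1) by measurable
  ultimately show ?thesis by blast
qed

section \<open>Cauchy integrals on the real line\<close>

definition cauchy_int :: "(real \<Rightarrow> complex) \<Rightarrow> complex \<Rightarrow> complex"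
  where "cauchy_int g z = (LINT s|lborel. g s / (of_real s - z))"

text \<open>The weight is the decay of the Cauchy kernel at a nonreal point. The condition admits
  L^p for every finite p >= 1 and is preserved when a boundary function is divided by a damping
  factor.\<close>

definition cauchy_integrable :: "(real \<Rightarrow> complex) \<Rightarrow> bool"
  where "cauchy_integrable g \<longleftrightarrow> g \<in> borel_measurable borel \<and>
    integrable lborel (\<lambda>s. g s / of_real (1 + \<bar>s\<bar>))"

lemma cauchy_integrable_measurable: "cauchy_integrable g \<Longrightarrow> g \<in> borel_measurable borel"
  by (simp add: cauchy_integrable_def)

lemma real_minus_nonreal_nonzero: "Im z \<noteq> 0 \<Longrightarrow> of_real s - z \<noteq> 0"
  by (auto simp: complex_eq_iff)

lemma cauchy_kernel_le:
  assumes "Im z \<noteq> 0"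
  shows "1 / cmod (of_real s - z) \<le> ((1 + cmod z + \<bar>Im z\<bar>) / \<bar>Im z\<bar>) / (1 + \<bar>s\<bar>)"
  using inverse_dist_le[of "\<bar>Im z\<bar>" "of_real s" z] abs_Im_le_cmod[of "of_real s - z"] assms
  by simp

lemma cauchy_integrableD:
  assumes g: "cauchy_integrable g" and z: "Im z \<noteq> 0"
  shows "integrable lborel (\<lambda>s. g s / (of_real s - z))"
proof -
  define K where "K = (1 + cmod z + \<bar>Im z\<bar>) / \<bar>Im z\<bar>"
  have K: "K \<ge> 0" by (simp add: K_def)
  have [measurable]: "g \<in> borel_measurable borel" by (rule cauchy_integrable_measurable[OF g])
  have "integrable lborel (\<lambda>s. of_real K * (g s / of_real (1 + \<bar>s\<bar>)))"
    using g by (intro integrable_mult_right) (simp add: cauchy_integrable_def)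
  then show ?thesis
  proof (rule Bochner_Integration.integrable_bound)
    show "AE s in lborel. norm (g s / (of_real s - z)) \<le> norm (of_real K * (g s / of_real (1 + \<bar>s\<bar>)))"
    proof (rule AE_I2)
      fix s
      have "cmod (g s) * (1 / cmod (of_real s - z)) \<le> cmod (g s) * (K / (1 + \<bar>s\<bar>))"
        unfolding K_def by (intro mult_left_mono cauchy_kernel_le z) auto
      moreover have "norm (of_real K * (g s / of_real (1 + \<bar>s\<bar>))) = K * (cmod (g s) / (1 + \<bar>s\<bar>))"
        unfolding norm_mult norm_divide norm_of_real using K by simp
      ultimately show "norm (g s / (of_real s - z)) \<le> norm (of_real K * (g s / of_real (1 + \<bar>s\<bar>)))"
        by (simp add: norm_divide mult.commute)
    qed
  qed measurable
qed

text \<open>Differentiation under the integral sign by hand: \<open>D\<close> is the expected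
  derivative, and the error of the difference quotient is again a Cauchy-type integral with an
  additional factor w - z against a bounded kernel.\<close>

lemma cauchy_int_holomorphic:
  assumes g: "cauchy_integrable g"
  shows "cauchy_int g holomorphic_on {z. Im z > 0}"
proof (rule holomorphic_onI, rule field_differentiable_at_within)
  fix z :: complex assume "z \<in> {z. Im z > 0}"
  then have z: "Im z > 0" by simp
  have [measurable]: "g \<in> borel_measurable borel" by (rule cauchy_integrable_measurable[OF g])
  define y where "y = Im z"
  have y: "y > 0" using z by (simp add: y_def)
  define N where "N = (LINT s|lborel. cmod (g s / (of_real s - z)))"
  have N: "N \<ge> 0" unfolding N_def by (rule integral_nonneg_AE) auto
  have dz: "y \<le> cmod (of_real s - z)" for s
    using abs_Im_le_cmod[of "of_real s - z"] y by (simp add: y_def)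
  note intz = cauchy_integrableD[OF g, of z]
  define D where "D = (LINT s|lborel. g s / (of_real s - z) / (of_real s - z))"
  have int_bd: "integrable lborel (\<lambda>s. g s / (of_real s - z) * h s)"
    if [measurable]: "h \<in> borel_measurable borel" and h: "\<And>s. cmod (h s) \<le> c" for h c
  proof (rule Bochner_Integration.integrable_bound[OF integrable_mult_right[OF integrable_norm[OF intz], of c]])
    show "AE s in lborel. norm (g s / (of_real s - z) * h s) \<le> norm (c * norm (g s / (of_real s - z)))"
    proof (rule AE_I2)
      fix s
      have "c \<ge> 0" using h[of s] norm_ge_zero order.trans by blast
      then show "norm (g s / (of_real s - z) * h s) \<le> norm (c * norm (g s / (of_real s - z)))"
        using mult_left_mono[OF h[of s] norm_ge_zero[of "g s / (of_real s - z)"]]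
        by (simp only: norm_mult[of "g s / (of_real s - z)" "h s"] real_norm_def abs_mult
            abs_norm_cancel abs_of_nonneg mult.commute[of c])
    qed
  qed (use z in auto)
  have est: "cmod ((cauchy_int g w - cauchy_int g z) / (w - z) - D) \<le> cmod (w - z) * (2 / y * (1 / y) * N)"
    if w: "w \<noteq> z" "cmod (w - z) < y / 2" for w
  proof -
    \<comment> \<open>Staying within y/2 of \<open>z\<close> keeps \<open>w\<close> above height
      y/2, so its kernel is at most 2/y uniformly.\<close>
    have Imw: "Im w > y / 2"
      using w(2) abs_Im_le_cmod[of "w - z"] by (simp add: y_def)
    have dw: "y / 2 \<le> cmod (of_real s - w)" for s
      using abs_Im_le_cmod[of "of_real s - w"] Imw y by simp
    note intw = cauchy_integrableD[OF g, of w]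
    let ?h = "\<lambda>s. (w - z) / (of_real s - w) / (of_real s - z)"
    have i1: "integrable lborel (\<lambda>s. g s / (of_real s - z) * (1 / (of_real s - z)))"
      by (rule int_bd[where c = "1 / y"]) (use dz y in \<open>auto simp: norm_divide intro!: divide_left_mono mult_pos_pos intro: less_le_trans\<close>)
    have nz: "of_real s - z \<noteq> 0" "of_real s - w \<noteq> 0" for s
      using z Imw y by (auto intro!: real_minus_nonreal_nonzero)
    have alg: "(g s / (of_real s - w) - g s / (of_real s - z)) / (w - z) - g s / (of_real s - z) / (of_real s - z)
       = g s / (of_real s - z) * ?h s" for s
    proof -
      have "(a / p - a / q) / (q - p) - a / q / q = a / q * ((q - p) / p / q)"
        if "p \<noteq> 0" "q \<noteq> 0" "q - p \<noteq> 0" for a p q :: complex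
      proof -
        have 1: "1 / p - 1 / q = (q - p) / p / q"
          using that by (simp add: diff_frac_eq)
        have "a / p - a / q = a * (1 / p - 1 / q)" by (simp add: right_diff_distrib)
        then have "(a / p - a / q) / (q - p) = a / q * (1 / p)"
          unfolding 1 using that by simp
        moreover have "a / q / q = a / q * (1 / q)" by simp
        ultimately show ?thesis
          unfolding 1[symmetric] by (simp only: right_diff_distrib)
      qed
      from this[OF nz(2)[of s] nz(1)[of s], of "g s"] w(1) show ?thesis by simp
    qed
    have "(cauchy_int g w - cauchy_int g z) / (w - z) - D
       = (LINT s|lborel. (g s / (of_real s - w) - g s / (of_real s - z)) / (w - z) - g s / (of_real s - z) / (of_real s - z))"
    proof -
      have "integrable lborel (\<lambda>s. g s / (of_real s - w))" "integrable lborel (\<lambda>s. g s / (of_real s - z))"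
        using intw intz z Imw y by auto
      moreover have "integrable lborel (\<lambda>s. g s / (of_real s - z) / (of_real s - z))"
        using i1 by (simp only: times_divide_eq_right mult_1_right)
      ultimately show ?thesis
        unfolding cauchy_int_def D_def
        by (simp only: Bochner_Integration.integral_diff integral_divide_zero
            Bochner_Integration.integrable_diff integrable_divide_zero)
    qed
    also have "\<dots> = (LINT s|lborel. g s / (of_real s - z) * ?h s)"
      by (simp only: alg)
    also have "cmod \<dots> \<le> (LINT s|lborel. cmod (g s / (of_real s - z) * ?h s))"
      by (rule integral_norm_bound)
    also have "\<dots> \<le> (LINT s|lborel. (cmod (w - z) * (2 / y * (1 / y))) * cmod (g s / (of_real s - z)))"
    proof (rule integral_mono)
      have hb: "cmod (?h s) \<le> cmod (w - z) * (2 / y * (1 / y))" for s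
      proof -
        have p: "0 < cmod (of_real s - w)" "0 < cmod (of_real s - z)"
          using nz[of s] by simp_all
        have "1 / cmod (of_real s - w) \<le> 1 / (y / 2)"
          by (rule divide_left_mono[OF dw]) (use p y in \<open>auto intro!: mult_pos_pos\<close>)
        moreover have "1 / cmod (of_real s - z) \<le> 1 / y"
          by (rule divide_left_mono[OF dz]) (use p y in \<open>auto intro!: mult_pos_pos\<close>)
        ultimately have "1 / cmod (of_real s - w) * (1 / cmod (of_real s - z)) \<le> 1 / (y / 2) * (1 / y)"
          using y by (intro mult_mono) auto
        then have "cmod (w - z) * (1 / cmod (of_real s - w) * (1 / cmod (of_real s - z))) \<le> cmod (w - z) * (1 / (y / 2) * (1 / y))"
          by (rule mult_left_mono) auto
        then show ?thesis by (simp add: norm_divide norm_mult)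
      qed
      show "integrable lborel (\<lambda>s. cmod (g s / (of_real s - z) * ?h s))"
        by (intro integrable_norm int_bd[OF _ hb] borel_measurable_continuous_onI continuous_intros)
          (use nz in auto)
      show "integrable lborel (\<lambda>s. (cmod (w - z) * (2 / y * (1 / y))) * cmod (g s / (of_real s - z)))"
        using intz z by (intro integrable_mult_right integrable_norm) auto
      show "cmod (g s / (of_real s - z) * ?h s) \<le> (cmod (w - z) * (2 / y * (1 / y))) * cmod (g s / (of_real s - z))" for s
        using mult_left_mono[OF hb[of s] norm_ge_zero[of "g s / (of_real s - z)"]] by (simp only: norm_mult mult.commute)
    qed
    also have "\<dots> = cmod (w - z) * (2 / y * (1 / y) * N)"
      by (simp add: N_def)
    finally show ?thesis .
  qed
  have "((\<lambda>w. (cauchy_int g w - cauchy_int g z) / (w - z) - D) \<longlongrightarrow> 0) (at z)"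
  proof (rule Lim_null_comparison)
    show "\<forall>\<^sub>F w in at z. norm ((cauchy_int g w - cauchy_int g z) / (w - z) - D) \<le> cmod (w - z) * (2 / y * (1 / y) * N)"
      unfolding eventually_at by (rule exI[of _ "y / 2"]) (use y est in \<open>auto simp: dist_norm\<close>)
    have "((\<lambda>w. cmod (w - z) * (2 / y * (1 / y) * N)) \<longlongrightarrow> cmod (z - z) * (2 / y * (1 / y) * N)) (at z)"
      by (intro tendsto_intros)
    then show "((\<lambda>w. cmod (w - z) * (2 / y * (1 / y) * N)) \<longlongrightarrow> 0) (at z)" by simp
  qed
  then have "((\<lambda>w. (cauchy_int g w - cauchy_int g z) / (w - z)) \<longlongrightarrow> D) (at z)"
    by (simp add: LIM_zero_iff)
  then show "cauchy_int g field_differentiable at z"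
    unfolding field_differentiable_def has_field_derivative_iff by blast
qed

lemma cauchy_int_diff_eq_poisson_ext:
  assumes g: "cauchy_integrable g" and z: "Im z > 0"
  shows "cauchy_int g z - cauchy_int g (cnj z) = 2 * of_real pi * \<i> * poisson_ext g z"
proof -
  have ker: "g s / (of_real s - z) - g s / (of_real s - cnj z)
      = 2 * of_real pi * \<i> * (poisson (Im z) (Re z - s) *\<^sub>R g s)" for s
  proof -
    have nz: "of_real s - z \<noteq> 0" "of_real s - cnj z \<noteq> 0"
      using z real_minus_nonreal_nonzero[of z s] real_minus_nonreal_nonzero[of "cnj z" s] by auto
    have "g s / (of_real s - z) - g s / (of_real s - cnj z)
        = g s * ((z - cnj z) / (of_real s - cnj z) / (of_real s - z))"
      using nz by (simp add: diff_frac_eq divide_simps) (simp add: algebra_simps)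
    also have "\<dots> = g s * (2 * of_real pi * \<i> * of_real (poisson (Im z) (Re z - s)))"
      using poisson_as_Cauchy[OF z, of "Re z" s] by simp
    finally show ?thesis by (simp add: scaleR_conv_of_real mult_ac)
  qed
  have "cauchy_int g z - cauchy_int g (cnj z) = (LINT s|lborel. g s / (of_real s - z) - g s / (of_real s - cnj z))"
    unfolding cauchy_int_def using cauchy_integrableD[OF g, of z] cauchy_integrableD[OF g, of "cnj z"] z by simp
  then show ?thesis unfolding ker poisson_ext_def by (simp only: integral_mult_right_zero)
qed

lemma cauchy_integrable_imp_poisson_integrable:
  assumes g: "cauchy_integrable g"
  shows "poisson_integrable g"
  unfolding poisson_integrable_def
proof
  show [measurable]: "g \<in> borel_measurable borel" by (rule cauchy_integrable_measurable[OF g])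
  have "integrable lborel (\<lambda>s. g s / of_real (1 + \<bar>s\<bar>))"
    using g by (simp add: cauchy_integrable_def)
  then show "integrable lborel (\<lambda>s. poisson 1 s *\<^sub>R g s)"
  proof (rule Bochner_Integration.integrable_bound)
    show "AE s in lborel. norm (poisson 1 s *\<^sub>R g s) \<le> norm (g s / of_real (1 + \<bar>s\<bar>))"
    proof (rule AE_I2)
      fix s :: real
      have "2 * \<bar>s\<bar> \<le> s\<^sup>2 + 1"
        using sum_squares_bound[of "\<bar>s\<bar>" 1] by simp
      \<comment> \<open>The generous factor 3 is below pi and is absorbed by the normalisation of
        the Poisson kernel.\<close>
      then have "1 + \<bar>s\<bar> \<le> 3 * (s\<^sup>2 + 1)"
        using zero_le_power2[of s] by argo
      also have "\<dots> \<le> pi * (s\<^sup>2 + 1)" using pi_gt3 by (intro mult_right_mono) auto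
      finally have "poisson 1 s \<le> 1 / (1 + \<bar>s\<bar>)"
        unfolding poisson_def by (intro frac_le) auto
      from mult_right_mono[OF this, of "cmod (g s)"]
      show "norm (poisson 1 s *\<^sub>R g s) \<le> norm (g s / of_real (1 + \<bar>s\<bar>))"
        unfolding norm_divide norm_of_real by simp
    qed
  qed measurable
qed

text \<open>Young's inequality bounds |g|/(1 + |s|) by |g|^p plus (1 + |s|)^(-q), which is
  integrable because the conjugate exponent q exceeds 1. For p = 1 there is no such q, but the
  weight is at most 1.\<close>

lemma Lp_cauchy_integrable:
  assumes [measurable]: "g \<in> borel_measurable borel" and p: "p \<ge> 1"
    and fin: "(\<integral>\<^sup>+ s. ennreal (cmod (g s) powr p) \<partial>lborel) < \<infinity>"
  shows "cauchy_integrable g"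
proof -
  have intp: "integrable lborel (\<lambda>s. cmod (g s) powr p)"
    using fin by (intro integrableI_nonneg) auto
  have "integrable lborel (\<lambda>s. g s / of_real (1 + \<bar>s\<bar>))"
  proof (cases "p = 1")
    case True
    show ?thesis
    proof (rule Bochner_Integration.integrable_bound[OF intp])
      show "AE s in lborel. norm (g s / of_real (1 + \<bar>s\<bar>)) \<le> norm (cmod (g s) powr p)"
        unfolding norm_divide norm_of_real
        by (auto simp: True divide_le_eq mult_left_mono intro!: AE_I2)
           (metis abs_ge_zero add_increasing2 mult.commute mult_cancel_right1 mult_le_cancel_left1 norm_ge_zero not_le order_refl)
    qed measurable
  next
    case False
    define q where "q = p / (p - 1)"
    have p1: "p > 1" using p False by simp
    have q: "q > 1" "1 / p + 1 / q = 1" using p1 by (auto simp: q_def field_simps)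
    have half: "(\<integral>\<^sup>+ s. ennreal ((1 + s) powr (- q)) * indicator {0..} s \<partial>lborel) < \<infinity>"
    proof -
      have "((\<lambda>s. (1 + s) powr (1 - q)) \<longlongrightarrow> 0) at_top"
        by (rule tendsto_neg_powr)
          (use q in \<open>auto intro!: filterlim_tendsto_add_at_top[OF tendsto_const] filterlim_ident\<close>)
      then have "((\<lambda>s. (1 + s) powr (1 - q) / (1 - q)) \<longlongrightarrow> 0 / (1 - q)) at_top"
        using q by (intro tendsto_divide) auto
      moreover have "((\<lambda>s. (1 + s) powr (1 - q) / (1 - q)) has_real_derivative (1 + s) powr (- q)) (at s)"
        if "0 \<le> s" for s
        using that q by (auto intro!: derivative_eq_intros)
      ultimately have "(\<integral>\<^sup>+ s. ennreal ((1 + s) powr (- q)) * indicator {0..} s \<partial>lborel)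
          = ennreal (0 / (1 - q) - (1 + 0) powr (1 - q) / (1 - q))"
        by (intro nn_integral_FTC_atLeast) auto
      then show ?thesis by simp
    qed
    have "(\<integral>\<^sup>+ s. ennreal ((1 + \<bar>s\<bar>) powr (- q)) \<partial>lborel)
       \<le> (\<integral>\<^sup>+ s. ennreal ((1 + s) powr (- q)) * indicator {0..} s
             + ennreal ((1 + (- s)) powr (- q)) * indicator {0..} (- s) \<partial>lborel)"
      by (intro nn_integral_mono) (auto simp: indicator_def abs_if)
    also have "\<dots> = (\<integral>\<^sup>+ s. ennreal ((1 + s) powr (- q)) * indicator {0..} s \<partial>lborel)
             + (\<integral>\<^sup>+ s. ennreal ((1 + (- s)) powr (- q)) * indicator {0..} (- s) \<partial>lborel)"
      by (rule nn_integral_add) measurable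
    also have "(\<integral>\<^sup>+ s. ennreal ((1 + (- s)) powr (- q)) * indicator {0..} (- s) \<partial>lborel)
        = (\<integral>\<^sup>+ s. ennreal ((1 + s) powr (- q)) * indicator {0..} s \<partial>lborel)"
      using nn_integral_real_affine[of "\<lambda>s. ennreal ((1 + s) powr (- q)) * indicator {0..} s" "-1" 0] by simp
    also have "\<dots> + \<dots> < \<infinity>" using half by simp
    finally have intq: "integrable lborel (\<lambda>s. (1 + \<bar>s\<bar>) powr (- q))"
      by (intro integrableI_nonneg) auto
    show ?thesis
    proof (rule Bochner_Integration.integrable_bound[OF Bochner_Integration.integrable_add[OF intp intq]])
      show "AE s in lborel. norm (g s / of_real (1 + \<bar>s\<bar>)) \<le> norm (cmod (g s) powr p + (1 + \<bar>s\<bar>) powr (- q))"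
      proof (rule AE_I2)
        fix s :: real
        have "cmod (g s) * (1 / (1 + \<bar>s\<bar>)) \<le> cmod (g s) powr p / p + (1 / (1 + \<bar>s\<bar>)) powr q / q"
          by (rule Youngs_inequality) (use p1 q in auto)
        also have "\<dots> \<le> cmod (g s) powr p + (1 / (1 + \<bar>s\<bar>)) powr q"
          using p1 q by (intro add_mono) (auto simp: divide_le_eq mult_le_cancel_left1)
        also have "(1 / (1 + \<bar>s\<bar>)) powr q = (1 + \<bar>s\<bar>) powr (- q)"
          by (simp add: powr_minus powr_divide inverse_eq_divide)
        finally show "norm (g s / of_real (1 + \<bar>s\<bar>)) \<le> norm (cmod (g s) powr p + (1 + \<bar>s\<bar>) powr (- q))"
          unfolding norm_divide norm_of_real by simp
      qed
    qed measurable
  qed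
  then show ?thesis by (simp add: cauchy_integrable_def)
qed

text \<open>The Schwarz integral of the half-plane: the normalisation by pi \<i> makes its real part
  the Poisson integral of the real function \<open>q\<close>.\<close>

definition schwarz_int :: "(real \<Rightarrow> real) \<Rightarrow> complex \<Rightarrow> complex"
  where "schwarz_int q z = cauchy_int (\<lambda>s. of_real (q s)) z / (of_real pi * \<i>)"

lemma schwarz_int_holomorphic:
  "cauchy_integrable (\<lambda>s. of_real (q s)) \<Longrightarrow> schwarz_int q holomorphic_on {z. Im z > 0}"
  unfolding schwarz_int_def
  by (intro holomorphic_intros cauchy_int_holomorphic) auto

text \<open>For real \<open>q\<close> the Cauchy integral at \<open>cnj z\<close> is the conjugate
  of that at \<open>z\<close>, so their difference, a multiple of the Poisson integral, is also 2
  \<i> times an imaginary part.\<close>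

lemma Re_schwarz_int:
  assumes q: "cauchy_integrable (\<lambda>s. of_real (q s))" and z: "Im z > 0"
  shows "Re (schwarz_int q z) = (LINT s|lborel. poisson (Im z) (Re z - s) * q s)"
proof -
  have "cauchy_int (\<lambda>s. of_real (q s)) (cnj z) = cnj (cauchy_int (\<lambda>s. of_real (q s)) z)"
    by (simp add: cauchy_int_def flip: Bochner_Integration.integral_cnj)
  then have "cauchy_int (\<lambda>s. of_real (q s)) z - cnj (cauchy_int (\<lambda>s. of_real (q s)) z)
      = 2 * of_real pi * \<i> * poisson_ext (\<lambda>s. of_real (q s)) z"
    using cauchy_int_diff_eq_poisson_ext[OF q z] by simp
  moreover have "c - cnj c = 2 * \<i> * of_real (Im c)" for c
    by (simp add: complex_eq_iff)
  ultimately have "2 * \<i> * of_real (Im (cauchy_int (\<lambda>s. of_real (q s)) z))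
      = 2 * \<i> * of_real (pi * (LINT s|lborel. poisson (Im z) (Re z - s) * q s))"
    by (simp add: mult_ac poisson_ext_of_real)
  then have "complex_of_real (Im (cauchy_int (\<lambda>s. of_real (q s)) z))
      = of_real (pi * (LINT s|lborel. poisson (Im z) (Re z - s) * q s))"
    by (subst (asm) mult_cancel_left) auto
  then have "Im (cauchy_int (\<lambda>s. of_real (q s)) z) = pi * (LINT s|lborel. poisson (Im z) (Re z - s) * q s)"
    by (rule of_real_eq_iff[THEN iffD1])
  moreover have "c / (of_real pi * \<i>) = (- \<i> * c) / of_real pi" for c
    by (simp add: field_simps)
  ultimately show ?thesis
    unfolding schwarz_int_def by (simp only: Re_divide_of_real) simp
qed

section \<open>Harmonic majorants and boundary values in \<open>H\<^sup>1\<close>\<close>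

text \<open>A maximum principle for \<open>w\<close>, the difference of sqrt |g| and its Poisson
  extension Re G. It cannot reach a positive level \<open>h\<close> far out, where sqrt |g| is
  small, nor near the real line, where the extension is close to sqrt |g|. A positive value would
  thus give an interior maximum, which is refuted by the maximum modulus principle for a local
  branch of the square root of \<open>g\<close>.\<close>

lemma sqrt_norm_le_poisson:
  assumes hol: "g holomorphic_on {w. Im w > -\<eta>}" and \<eta>: "\<eta> > 0"
    and bound: "\<And>w. Im w \<ge> 0 \<Longrightarrow> cmod (g w) \<le> C / (1 + cmod w)\<^sup>2"
    and y: "y > 0"
  shows "sqrt (cmod (g (Complex x y))) \<le> (LINT s|lborel. poisson y (x - s) * sqrt (cmod (g (of_real s))))"
proof (rule ccontr)
  assume contra: "\<not> ?thesis"
  define u where "u = (\<lambda>w. sqrt (cmod (g w)))"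
  define q where "q = (\<lambda>s::real. u (of_real s))"
  have C: "C \<ge> 0" using order.trans[OF norm_ge_zero bound[of 0]] by simp
  have contg: "continuous_on {w. Im w > -\<eta>} g" by (rule holomorphic_on_imp_continuous_on[OF hol])
  have contu: "continuous_on {w. Im w > -\<eta>} u" unfolding u_def by (intro continuous_intros contg)
  have u0: "u w \<ge> 0" for w by (simp add: u_def)
  have ub: "u w \<le> sqrt C / (1 + cmod w)" if "Im w \<ge> 0" for w
    using real_sqrt_le_mono[OF bound[OF that]] by (simp add: u_def real_sqrt_divide)
  have ub1: "u w \<le> sqrt C" if "Im w \<ge> 0" for w
    using ub[OF that] C mult_left_mono[of 1 "1 + cmod w" "sqrt C"]
    by (smt (verit) divide_le_eq mult_cancel_left1 norm_ge_zero real_sqrt_ge_zero)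
  have "continuous_on UNIV q"
    unfolding q_def by (intro continuous_on_compose2[OF contu]) (use \<eta> in \<open>auto intro!: continuous_intros\<close>)
  then have qm[measurable]: "q \<in> borel_measurable borel" by (rule borel_measurable_continuous_onI)
  have ci: "cauchy_integrable (\<lambda>s. of_real (q s))"
    unfolding cauchy_integrable_def
  proof
    show "integrable lborel (\<lambda>s. complex_of_real (q s) / of_real (1 + \<bar>s\<bar>))"
    proof (rule Bochner_Integration.integrable_bound[OF integrable_mult_right[OF integrable_inverse_square, of "sqrt C"]])
      show "AE s in lborel. norm (complex_of_real (q s) / of_real (1 + \<bar>s\<bar>)) \<le> norm (sqrt C * (1 / (1 + \<bar>s\<bar>)\<^sup>2))"
      proof (rule AE_I2)
        fix s :: real
        have "q s / (1 + \<bar>s\<bar>) \<le> sqrt C / (1 + \<bar>s\<bar>) / (1 + \<bar>s\<bar>)"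
          using ub[of "of_real s"] by (intro divide_right_mono) (auto simp: q_def)
        then show "norm (complex_of_real (q s) / of_real (1 + \<bar>s\<bar>)) \<le> norm (sqrt C * (1 / (1 + \<bar>s\<bar>)\<^sup>2))"
          unfolding norm_divide norm_of_real using u0 C by (simp add: q_def power2_eq_square abs_mult)
      qed
    qed measurable
  qed measurable
  define G where "G = schwarz_int q"
  have holG: "G holomorphic_on {z. Im z > 0}" unfolding G_def by (rule schwarz_int_holomorphic[OF ci])
  have contG: "continuous_on {z. Im z > 0} G" by (rule holomorphic_on_imp_continuous_on[OF holG])
  have ReG: "Re (G z) = (LINT s|lborel. poisson (Im z) (Re z - s) * q s)" if "Im z > 0" for z
    unfolding G_def by (rule Re_schwarz_int[OF ci that])
  have ReG0: "Re (G z) \<ge> 0" if "Im z > 0" for z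
    unfolding ReG[OF that] using that u0 by (intro integral_nonneg_AE) (auto simp: q_def)
  have intPq: "integrable lborel (\<lambda>s. poisson t (a - s) * q s)" if "t > 0" for t a
    using integrable_Re[OF poisson_integrableD[OF cauchy_integrable_imp_poisson_integrable[OF ci] that, of a]]
    by simp
  define w where "w = (\<lambda>z. u z - Re (G z))"
  define h where "h = w (Complex x y)"
  have h: "h > 0" using contra y by (simp add: h_def w_def ReG u_def q_def)
  \<comment> \<open>Beyond this radius the decay bound already gives sqrt |g| < h, and Re G is
    nonnegative.\<close>
  define R where "R = sqrt C / h"
  have R: "R \<ge> 0" using C h by (simp add: R_def)
  have far: "w z < h" if "Im z > 0" "cmod z > R" for z
  proof -
    have "u z \<le> sqrt C / (1 + cmod z)" by (rule ub) (use that in simp)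
    also have "\<dots> < h"
      using that h unfolding R_def by (simp add: divide_less_eq add_pos_nonneg) (simp add: field_simps)
    finally show ?thesis using ReG0[OF that(1)] by (simp add: w_def)
  qed
  \<comment> \<open>The extra radius 1 makes room for the real points \<open>s\<close> close to a
    point \<open>z\<close> of modulus at most \<open>R\<close>.\<close>
  define Q where "Q = {z. Im z \<ge> 0} \<inter> cball 0 (R + 1)"
  have "compact Q" unfolding Q_def by (intro closed_Int_compact closed_halfspace_Im_ge compact_cball)
  then have "uniformly_continuous_on Q u"
    by (rule compact_uniformly_continuous[rotated]) (use \<eta> in \<open>auto simp: Q_def intro: continuous_on_subset[OF contu]\<close>)
  then obtain d0 where d0: "d0 > 0" "\<And>z z'. z \<in> Q \<Longrightarrow> z' \<in> Q \<Longrightarrow> dist z' z < d0 \<Longrightarrow> dist (u z') (u z) < h / 2"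
    unfolding uniformly_continuous_on_def using h by (metis half_gt_zero)
  \<comment> \<open>A real \<open>s\<close> with |Re z - s| < d lies within 2 d of a
    \<open>z\<close> below height \<open>d\<close>. This must be less than both \<open>d0\<close>,
    for uniform continuity, and 1, to remain in \<open>Q\<close>.\<close>
  define d where "d = min d0 1 / 3"
  have d: "d > 0" "2 * d < d0" "2 * d < 1" using d0(1) by (auto simp: d_def min_def)
  \<comment> \<open>Below height \<open>t\<close> the far part of the Poisson integral is less than
    h/4; with the h/2 of the near part, \<open>w\<close> stays below \<open>h\<close>. The + 1 keeps
    the inner denominator positive.\<close>
  define t where "t = min d (h / (4 * (sqrt C * (1 + 1 / d\<^sup>2) + 1)))"
  have A: "sqrt C * (1 + 1 / d\<^sup>2) \<ge> 0" using C by auto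
  have t: "t > 0" using d h A by (auto simp: t_def intro!: divide_pos_pos)
  have near: "w z < h" if z: "Im z > 0" "Im z < t" for z
  proof (cases "cmod z > R")
    case True then show ?thesis using far z by blast
  next
    case False
    have zd: "Im z < d" using z by (simp add: t_def)
    have pt: "poisson (Im z) (Re z - s) * (u z - q s)
       \<le> poisson (Im z) (Re z - s) * (h / 2) + sqrt C * (Im z * (1 + 1 / d\<^sup>2)) * poisson 1 (Re z - s)" for s
    proof (cases "\<bar>Re z - s\<bar> < d")
      case True
      have "cmod (of_real s - z) \<le> \<bar>Re z - s\<bar> + \<bar>Im z\<bar>"
        using cmod_le[of "of_real s - z"] by (simp add: abs_minus_commute)
      then have ds: "cmod (of_real s - z) < 2 * d" using True zd z by simp
      have "cmod (of_real s) \<le> cmod z + cmod (of_real s - z)"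
        using norm_triangle_ineq[of z "of_real s - z"] by simp
      then have "of_real s \<in> Q" "z \<in> Q" using False ds d z by (auto simp: Q_def)
      then have "dist (u (of_real s)) (u z) < h / 2" using ds d by (intro d0) (auto simp: dist_norm)
      then have "u z - q s \<le> h / 2" unfolding q_def dist_real_def by linarith
      then have "poisson (Im z) (Re z - s) * (u z - q s) \<le> poisson (Im z) (Re z - s) * (h / 2)"
        using z by (intro mult_left_mono) auto
      moreover have "sqrt C * (Im z * (1 + 1 / d\<^sup>2)) * poisson 1 (Re z - s) \<ge> 0"
        using C z by (intro mult_nonneg_nonneg) auto
      ultimately show ?thesis by linarith
    next
      case False
      have "u z - q s \<le> sqrt C" using ub1[of z] u0[of "of_real s"] z by (simp add: q_def)
      then have "poisson (Im z) (Re z - s) * (u z - q s) \<le> poisson (Im z) (Re z - s) * sqrt C"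
        using z by (intro mult_left_mono) auto
      also have "\<dots> \<le> (Im z * (1 + 1 / d\<^sup>2) * poisson 1 (Re z - s)) * sqrt C"
        using z d False C by (intro mult_right_mono poisson_tail_le) auto
      finally have "poisson (Im z) (Re z - s) * (u z - q s) \<le> sqrt C * (Im z * (1 + 1 / d\<^sup>2)) * poisson 1 (Re z - s)"
        by (simp add: mult_ac)
      moreover have "poisson (Im z) (Re z - s) * (h / 2) \<ge> 0" using z h by simp
      ultimately show ?thesis by linarith
    qed
    note P = poisson_has_integral[OF z(1), of "Re z"] poisson_has_integral[of 1 "Re z"]
    have "w z = (LINT s|lborel. poisson (Im z) (Re z - s) * (u z - q s))"
      using P intPq[OF z(1), of "Re z"] by (simp add: w_def ReG[OF z(1)] right_diff_distrib)
    also have "\<dots> \<le> (LINT s|lborel. poisson (Im z) (Re z - s) * (h / 2) + sqrt C * (Im z * (1 + 1 / d\<^sup>2)) * poisson 1 (Re z - s))"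
      using P intPq[OF z(1), of "Re z"] by (intro integral_mono pt) (auto simp: right_diff_distrib)
    also have "\<dots> = h / 2 + sqrt C * (Im z * (1 + 1 / d\<^sup>2))"
      using P by simp
    also have "\<dots> < h"
    proof -
      define K where "K = sqrt C * (1 + 1 / d\<^sup>2) + 1"
      have K: "K \<ge> 1" using A by (simp add: K_def)
      have "Im z < h / (4 * K)" using z by (simp add: t_def K_def)
      then have "Im z * K < h / 4" using K by (simp add: field_simps)
      moreover have "sqrt C * (Im z * (1 + 1 / d\<^sup>2)) = Im z * K - Im z" by (simp add: K_def algebra_simps)
      ultimately show ?thesis using z h by linarith
    qed
    finally show ?thesis .
  qed
  define S where "S = {z. Im z \<ge> t} \<inter> cball 0 R"
  have S: "compact S" unfolding S_def by (intro closed_Int_compact closed_halfspace_Im_ge compact_cball)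
  have outside: "z \<in> S" if "Im z > 0" "w z \<ge> h" for z
    using far[OF that(1)] near[OF that(1)] that by (fastforce simp: S_def)
  have contw: "continuous_on {z. Im z > 0} w"
    unfolding w_def by (intro continuous_intros contG continuous_on_subset[OF contu]) (use \<eta> in auto)
  have contwS: "continuous_on S w"
    by (rule continuous_on_subset[OF contw]) (use t in \<open>auto simp: S_def\<close>)
  have "Complex x y \<in> S" by (rule outside) (use y in \<open>auto simp: h_def\<close>)
  then obtain z0 where z0: "z0 \<in> S" "\<And>z. z \<in> S \<Longrightarrow> w z \<le> w z0"
    using continuous_attains_sup[OF S _ contwS] by blast
  define m where "m = w z0"
  have mh: "m \<ge> h" using z0(2)[OF \<open>Complex x y \<in> S\<close>] by (simp add: m_def h_def)
  have wm: "w z \<le> m" if "Im z > 0" for z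
    using outside[OF that] z0(2)[of z] mh by (cases "w z \<ge> h") (auto simp: m_def)
  \<comment> \<open>Among all maximum points a highest one is chosen; constancy of \<open>w\<close>
    on a disc around it then produces a higher one.\<close>
  define T where "T = {z \<in> S. w z = m}"
  have "compact T"
    unfolding T_def
    by (rule closedin_compact[OF S continuous_closedin_preimage_constant[OF contwS]])
  moreover have "T \<noteq> {}" using z0 by (auto simp: T_def m_def)
  moreover have "continuous_on T Im" by (intro continuous_intros)
  ultimately obtain z2 where z2: "z2 \<in> T" "\<And>z. z \<in> T \<Longrightarrow> Im z \<le> Im z2"
    using continuous_attains_sup[of T Im] by blast
  have Im2: "Im z2 > 0" and w2: "w z2 = m" using z2(1) t by (auto simp: T_def S_def)
  \<comment> \<open>At the maximum \<open>g\<close> does not vanish, so near it \<open>g\<close> has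
    a holomorphic logarithm and hence a square root.\<close>
  have "u z2 > 0" using w2 mh h ReG0[OF Im2] by (simp add: w_def)
  then have g2: "g z2 \<noteq> 0" by (auto simp: u_def)
  have contg': "continuous_on {z. Im z > 0} g"
    by (rule continuous_on_subset[OF contg]) (use \<eta> in auto)
  have "open {z. Im z > 0 \<and> g z \<noteq> 0}"
  proof -
    have "{z. Im z > 0 \<and> g z \<noteq> 0} = {z. Im z > 0} \<inter> g -` (- {0})" by auto
    then show ?thesis
      using continuous_open_preimage[OF contg' open_halfspace_Im_gt, of "- {0}"]
      by (simp add: open_Compl)
  qed
  then obtain r where r: "r > 0" "ball z2 r \<subseteq> {z. Im z > 0 \<and> g z \<noteq> 0}"
    using Im2 g2 unfolding open_contains_ball by blast
  have ballI: "Im z > 0" "g z \<noteq> 0" if "z \<in> ball z2 r" for z using r(2) that by auto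
  have "g holomorphic_on ball z2 r"
    by (rule holomorphic_on_subset[OF hol]) (use ballI(1) \<eta> in \<open>force\<close>)
  then obtain l where l: "l holomorphic_on ball z2 r" "\<And>z. z \<in> ball z2 r \<Longrightarrow> g z = exp (l z)"
    using contractible_imp_holomorphic_log[of g "ball z2 r"] ballI(2) convex_imp_contractible[OF convex_ball]
    by metis
  define \<sigma> where "\<sigma> = (\<lambda>z. exp (l z / 2))"
  have \<sigma>u: "cmod (\<sigma> z) = u z" if "z \<in> ball z2 r" for z
  proof -
    have "sqrt (exp a) = exp (a / 2)" for a :: real
      by (rule real_sqrt_unique) (simp_all flip: exp_double)
    then show ?thesis unfolding u_def l(2)[OF that] \<sigma>_def by simp
  qed
  \<comment> \<open>The unimodular constant that rotates the branch of the square root to a positive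
    value at \<open>z2\<close>.\<close>
  define c where "c = cnj (\<sigma> z2) / of_real (cmod (\<sigma> z2))"
  have z2b: "z2 \<in> ball z2 r" using r by simp
  have s2: "cmod (\<sigma> z2) > 0" using \<sigma>u[OF z2b] \<open>u z2 > 0\<close> by simp
  have c1: "cmod c = 1" using s2 by (simp add: c_def norm_divide)
  have c2: "c * \<sigma> z2 = of_real (cmod (\<sigma> z2))"
  proof -
    have "cnj (\<sigma> z2) * \<sigma> z2 = of_real ((cmod (\<sigma> z2))\<^sup>2)"
      using complex_norm_square[of "\<sigma> z2"] by (simp add: mult.commute)
    then show ?thesis using s2 by (simp add: c_def power2_eq_square)
  qed
  \<comment> \<open>Since Re (c \<sigma>) <= |\<sigma>| = u, the modulus of \<open>f\<close> is at
    most exp(w), with equality at \<open>z2\<close>. So |f| attains its maximum over the disc at the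
    centre.\<close>
  define f where "f = (\<lambda>z. exp (c * \<sigma> z - G z))"
  have holf: "f holomorphic_on ball z2 r"
    unfolding f_def \<sigma>_def
    by (intro holomorphic_intros l(1) holomorphic_on_subset[OF holG]) (use ballI in auto)
  have Recs: "Re (c * \<sigma> z) \<le> u z" if "z \<in> ball z2 r" for z
    using complex_Re_le_cmod[of "c * \<sigma> z"] c1 \<sigma>u[OF that] by (simp only: norm_mult mult_1)
  have f2: "cmod (f z2) = exp m"
    using \<sigma>u[OF z2b] w2 c2
    by (simp only: f_def norm_exp_eq_Re w_def minus_complex.sel Re_complex_of_real)
  have fle: "cmod (f z) \<le> cmod (f z2)" if "z \<in> ball z2 r" for z
  proof -
    have "cmod (f z) = exp (Re (c * \<sigma> z) - Re (G z))"
      by (simp only: f_def norm_exp_eq_Re minus_complex.sel)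
    also have "\<dots> \<le> exp m"
      using wm[OF ballI(1)[OF that]] Recs[OF that] by (simp add: w_def del: times_complex.sel)
    finally show ?thesis by (simp only: f2)
  qed
  have "f constant_on ball z2 r"
    by (rule maximum_modulus_principle[OF holf open_ball connected_ball open_ball order.refl z2b]) (rule fle)
  then have fconst: "f z = f z2" if "z \<in> ball z2 r" for z
    using that z2b unfolding constant_on_def by metis
  have wconst: "w z = m" if zb: "z \<in> ball z2 r" for z
  proof -
    have "exp (Re (c * \<sigma> z) - Re (G z)) = exp m"
      using arg_cong[OF fconst[OF zb], of cmod] f2 by (simp only: f_def norm_exp_eq_Re minus_complex.sel)
    then have "Re (c * \<sigma> z) - Re (G z) = m" by simp
    then show ?thesis using Recs[OF zb] wm[OF ballI(1)[OF zb]] by (simp add: w_def del: times_complex.sel)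
  qed
  define z3 where "z3 = z2 + \<i> * of_real (r / 2)"
  have "z3 \<in> ball z2 r" using r by (simp add: z3_def dist_norm norm_mult)
  then have "w z3 = m" "Im z3 > 0" using wconst ballI by auto
  then have "z3 \<in> T" using outside[of z3] mh by (auto simp: T_def)
  then show False using z2(2)[of z3] r by (simp add: z3_def)
qed

section \<open>Extended-valued Poisson integrals and the least harmonic majorant\<close>

definition nn_poisson :: "real \<Rightarrow> (real \<Rightarrow> ennreal) \<Rightarrow> real \<Rightarrow> ennreal"
  where "nn_poisson y \<phi> x = (\<integral>\<^sup>+ s. ennreal (poisson y (x - s)) * \<phi> s \<partial>lborel)"

lemma nn_poisson_measurable [measurable]:
  assumes [measurable]: "\<phi> \<in> borel_measurable borel"
  shows "nn_poisson y \<phi> \<in> borel_measurable borel"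
  unfolding nn_poisson_def[abs_def] by measurable

lemma nn_poisson_mono: "(\<And>s. \<phi> s \<le> \<psi> s) \<Longrightarrow> nn_poisson y \<phi> x \<le> nn_poisson y \<psi> x"
  unfolding nn_poisson_def by (intro nn_integral_mono mult_left_mono) auto

text \<open>In \<open>ennreal\<close> the interchange of integrals is Tonelli's theorem, available
  before the monotone limit below is known to be finite.\<close>

lemma nn_poisson_semigroup:
  assumes [measurable]: "\<phi> \<in> borel_measurable borel" and ab: "a > 0" "b > 0"
  shows "nn_poisson a (nn_poisson b \<phi>) x = nn_poisson (a + b) \<phi> x"
proof -
  have "nn_poisson a (nn_poisson b \<phi>) x
      = (\<integral>\<^sup>+ s. (\<integral>\<^sup>+ r. ennreal (poisson a (x - s)) * (ennreal (poisson b (s - r)) * \<phi> r) \<partial>lborel) \<partial>lborel)"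
    unfolding nn_poisson_def by (simp add: nn_integral_cmult)
  also have "\<dots> = (\<integral>\<^sup>+ r. (\<integral>\<^sup>+ s. ennreal (poisson a (x - s)) * (ennreal (poisson b (s - r)) * \<phi> r) \<partial>lborel) \<partial>lborel)"
    by (rule lborel_pair.Fubini'[symmetric]) (simp add: split_beta')
  also have "\<dots> = (\<integral>\<^sup>+ r. ennreal (poisson (a + b) (x - r)) * \<phi> r \<partial>lborel)"
  proof (intro nn_integral_cong)
    fix r
    have "(\<integral>\<^sup>+ s. ennreal (poisson a (x - s)) * (ennreal (poisson b (s - r)) * \<phi> r) \<partial>lborel)
       = (\<integral>\<^sup>+ s. ennreal (poisson a (x - s) * poisson b (s - r)) \<partial>lborel) * \<phi> r"
      using ab by (subst nn_integral_multc[symmetric]) (auto simp: ennreal_mult mult.assoc)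
    also have "(\<integral>\<^sup>+ s. ennreal (poisson a (x - s) * poisson b (s - r)) \<partial>lborel) = ennreal (poisson (a + b) (x - r))"
      using ab poisson_semigroup[OF ab, of x r] by (subst nn_integral_eq_integral) auto
    finally show "(\<integral>\<^sup>+ s. ennreal (poisson a (x - s)) * (ennreal (poisson b (s - r)) * \<phi> r) \<partial>lborel)
        = ennreal (poisson (a + b) (x - r)) * \<phi> r" .
  qed
  finally show ?thesis by (simp add: nn_poisson_def)
qed

lemma holomorphic_imp_continuous_line:
  assumes hol: "f holomorphic_on {z. Im z > 0}" and y: "y > 0"
  shows "continuous_on UNIV (\<lambda>x. f (Complex x y))"
proof -
  have "Complex x y = of_real x + \<i> * of_real y" for x by (simp add: complex_eq_iff)
  then show ?thesis
    using y by (simp, intro continuous_intros continuous_on_compose2[OF holomorphic_on_imp_continuous_on[OF hol]])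
      (auto simp: complex_eq_iff)
qed

text \<open>The class to which damping reduces an H^p function. The constant in the decay condition
  may grow without bound as the height tends to 0; only the L^1 bound is uniform.\<close>

locale hardy_decay =
  fixes g :: "complex \<Rightarrow> complex" and M :: real
  assumes hol: "g holomorphic_on {z. Im z > 0}"
    and decay: "\<epsilon> > 0 \<Longrightarrow> \<exists>C. \<forall>z. Im z \<ge> \<epsilon> \<longrightarrow> cmod (g z) \<le> C / (1 + cmod z)\<^sup>2"
    and bound: "y > 0 \<Longrightarrow> (\<integral>\<^sup>+ x. ennreal (cmod (g (Complex x y))) \<partial>lborel) \<le> ennreal M"
begin

definition u :: "real \<Rightarrow> real \<Rightarrow> real"
  where "u a s = sqrt (cmod (g (Complex s a)))"

lemma continuous_line: "a > 0 \<Longrightarrow> continuous_on UNIV (\<lambda>s. g (Complex s a))"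
  by (rule holomorphic_imp_continuous_line[OF hol])

lemma line_measurable [measurable]: "a > 0 \<Longrightarrow> (\<lambda>s. g (Complex s a)) \<in> borel_measurable borel"
  by (intro borel_measurable_continuous_onI continuous_line)

lemma u_measurable [measurable]: "a > 0 \<Longrightarrow> u a \<in> borel_measurable borel"
  unfolding u_def[abs_def]
  by (intro borel_measurable_continuous_onI continuous_intros continuous_line)

lemma u_nonneg [simp]: "u a s \<ge> 0"
  by (simp add: u_def)

lemma u_square: "a > 0 \<Longrightarrow> (\<integral>\<^sup>+ s. ennreal (cmod (of_real (u a s)) powr 2) \<partial>lborel) \<le> ennreal M"
  using bound[of a] by (simp add: u_def)

lemma shift_decay:
  assumes a: "a > 0"
  obtains C where "C \<ge> 0" "\<And>w. Im w \<ge> 0 \<Longrightarrow> cmod (g (w + \<i> * of_real a)) \<le> C / (1 + cmod w)\<^sup>2"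
proof -
  obtain C where C: "\<And>z. Im z \<ge> a \<Longrightarrow> cmod (g z) \<le> C / (1 + cmod z)\<^sup>2"
    using decay[OF a] by blast
  have "0 \<le> C / (1 + cmod (\<i> * of_real a))\<^sup>2"
    using order.trans[OF norm_ge_zero C[of "\<i> * of_real a"]] by simp
  moreover have "0 < (1 + cmod (\<i> * of_real a))\<^sup>2"
    by (intro zero_less_power add_pos_nonneg) auto
  ultimately have C0: "C \<ge> 0" by (metis divide_neg_pos not_le)
  show thesis
  proof
    show "C \<ge> 0" by (rule C0)
    fix w assume w: "Im w \<ge> 0"
    have "cmod w \<le> cmod (w + \<i> * of_real a)"
      unfolding cmod_def using w a by (intro real_sqrt_le_mono) (simp add: power_mono)
    then have "C / (1 + cmod (w + \<i> * of_real a))\<^sup>2 \<le> C / (1 + cmod w)\<^sup>2"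
      using C0 by (intro divide_left_mono power_mono mult_pos_pos zero_less_power add_pos_nonneg) auto
    then show "cmod (g (w + \<i> * of_real a)) \<le> C / (1 + cmod w)\<^sup>2"
      using C[of "w + \<i> * of_real a"] w by simp
  qed
qed

lemma shift_holomorphic: "a > 0 \<Longrightarrow> (\<lambda>w. g (w + \<i> * of_real a)) holomorphic_on {w. Im w > - a}"
  by (intro holomorphic_on_compose_gen[OF _ hol, unfolded comp_def] holomorphic_intros) auto

lemma u_poisson_integrable:
  assumes "a > 0" "t > 0"
  shows "integrable lborel (\<lambda>s. poisson t (x - s) * u a s)"
proof -
  have "poisson_integrable (\<lambda>s. of_real (u a s))"
    using u_square[OF assms(1)] assms
    by (intro Lp_poisson_integrable(1)[where p = 2]) (auto intro: le_less_trans)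
  from integrable_Re[OF poisson_integrableD[OF this assms(2), of x]]
  show ?thesis by simp
qed

lemma u_le_poisson:
  assumes a: "a > 0" and t: "t > 0"
  shows "ennreal (u (a + t) x) \<le> nn_poisson t (\<lambda>s. ennreal (u a s)) x"
proof -
  obtain C where C: "C \<ge> 0" "\<And>w. Im w \<ge> 0 \<Longrightarrow> cmod (g (w + \<i> * of_real a)) \<le> C / (1 + cmod w)\<^sup>2"
    by (rule shift_decay[OF a]) blast
  have eq: "Complex x t + \<i> * of_real a = Complex x (a + t)" "complex_of_real s + \<i> * of_real a = Complex s a" for s
    by (simp_all add: complex_eq_iff)
  have "u (a + t) x \<le> (LINT s|lborel. poisson t (x - s) * u a s)"
    using sqrt_norm_le_poisson[OF shift_holomorphic[OF a] a C(2) t, of x] by (simp add: eq u_def)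
  then have "ennreal (u (a + t) x) \<le> ennreal (LINT s|lborel. poisson t (x - s) * u a s)"
    by (rule ennreal_leI)
  also have "\<dots> = (\<integral>\<^sup>+ s. ennreal (poisson t (x - s) * u a s) \<partial>lborel)"
    using u_poisson_integrable[OF a t, of x] t by (subst nn_integral_eq_integral) auto
  finally show ?thesis using t by (simp add: nn_poisson_def ennreal_mult)
qed

definition e :: "nat \<Rightarrow> real"
  where "e n = 1 / real (Suc n)"

lemma e_pos [simp]: "e n > 0"
  by (simp add: e_def)

lemma e_mono: "n \<le> m \<Longrightarrow> e m \<le> e n"
  unfolding e_def by (intro divide_left_mono) auto

lemma e_lim: "e \<longlonglongrightarrow> 0"
  unfolding e_def[abs_def] using LIMSEQ_inverse_real_of_nat by (simp add: inverse_eq_divide)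

lemma e_less: "y > 0 \<Longrightarrow> \<exists>n. e n < y"
  unfolding e_def using reals_Archimedean[of y] by (simp add: inverse_eq_divide)

text \<open>The Poisson extension of \<open>sqrt |g|\<close> from the line at height
  \<open>e n\<close>. The value 0 at points not above that line keeps the family increasing in
  \<open>n\<close> at every height.\<close>

definition V :: "nat \<Rightarrow> real \<Rightarrow> real \<Rightarrow> ennreal"
  where "V n y x = (if e n < y then nn_poisson (y - e n) (\<lambda>s. ennreal (u (e n) s)) x else 0)"

lemma V_measurable [measurable]: "V n y \<in> borel_measurable borel"
  unfolding V_def[abs_def] by measurable

text \<open>Subharmonicity bounds the data at height \<open>e n\<close> by the extension of the data
  at the lower height \<open>e m\<close>; extending both and using the semigroup law gives the
  inequality.\<close>

lemma V_mono:
  assumes "n \<le> m"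
  shows "V n y x \<le> V m y x"
proof (cases "e n < y \<and> e m < e n")
  case True
  then have t: "e n - e m > 0" "y - e n > 0" "e m < y" by auto
  have "nn_poisson (y - e n) (\<lambda>s. ennreal (u (e n) s)) x
      \<le> nn_poisson (y - e n) (nn_poisson (e n - e m) (\<lambda>s. ennreal (u (e m) s))) x"
    using u_le_poisson[OF e_pos[of m] t(1)] by (intro nn_poisson_mono) simp
  also have "\<dots> = nn_poisson (y - e m) (\<lambda>s. ennreal (u (e m) s)) x"
    using t by (subst nn_poisson_semigroup) auto
  finally show ?thesis using True t by (simp add: V_def)
next
  case False
  then show ?thesis using e_mono[OF assms] by (cases "e m = e n") (auto simp: V_def)
qed

lemma V_semigroup:
  assumes "e n < y" "t > 0"
  shows "V n (y + t) x = nn_poisson t (V n y) x"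
proof -
  have "V n y = nn_poisson (y - e n) (\<lambda>s. ennreal (u (e n) s))"
    using assms by (auto simp: V_def[abs_def])
  then show ?thesis
    using assms nn_poisson_semigroup[of "\<lambda>s. ennreal (u (e n) s)" t "y - e n" x]
    by (simp add: V_def algebra_simps)
qed

lemma V_square: "(\<integral>\<^sup>+ x. V n y x * V n y x \<partial>lborel) \<le> ennreal M"
proof (cases "e n < y")
  case True
  have V: "V n y x = ennreal (cmod (poisson_ext (\<lambda>s. of_real (u (e n) s)) (Complex x (y - e n))))" for x
  proof -
    have "V n y x = (\<integral>\<^sup>+ s. ennreal (poisson (y - e n) (x - s) * u (e n) s) \<partial>lborel)"
      using True by (simp add: V_def nn_poisson_def ennreal_mult)
    also have "\<dots> = ennreal (LINT s|lborel. poisson (y - e n) (x - s) * u (e n) s)"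
      using True by (intro nn_integral_eq_integral u_poisson_integrable) auto
    also have "(LINT s|lborel. poisson (y - e n) (x - s) * u (e n) s)
       = cmod (poisson_ext (\<lambda>s. of_real (u (e n) s)) (Complex x (y - e n)))"
    proof -
      have "(LINT s|lborel. poisson (y - e n) (x - s) * u (e n) s) \<ge> 0"
        using True by (intro integral_nonneg_AE) auto
      then show ?thesis by (simp add: poisson_ext_of_real)
    qed
    finally show ?thesis .
  qed
  have "(\<integral>\<^sup>+ x. V n y x * V n y x \<partial>lborel)
     = (\<integral>\<^sup>+ x. ennreal (cmod (poisson_ext (\<lambda>s. of_real (u (e n) s)) (Complex x (y - e n))) powr 2) \<partial>lborel)"
    unfolding V by (simp add: power2_eq_square flip: ennreal_mult)
  also have "\<dots> \<le> (\<integral>\<^sup>+ s. ennreal (cmod (of_real (u (e n) s)) powr 2) \<partial>lborel)"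
    using True u_square[OF e_pos[of n]] by (intro poisson_Lp_contraction) (auto intro: le_less_trans)
  also have "\<dots> \<le> ennreal M" by (rule u_square) simp
  finally show ?thesis .
qed (simp add: V_def)

text \<open>The least harmonic majorant of \<open>sqrt \<bar>g\<bar>\<close>, as an increasing limit of Poisson extensions.\<close>

definition W :: "real \<Rightarrow> real \<Rightarrow> ennreal"
  where "W y x = (SUP n. V n y x)"

lemma W_measurable [measurable]: "W y \<in> borel_measurable borel"
  unfolding W_def[abs_def] by measurable

lemma V_incseq: "incseq (\<lambda>n. V n y x)"
  by (rule incseq_SucI) (rule V_mono, simp)

lemma W_semigroup:
  assumes y: "y > 0" and t: "t > 0"
  shows "W (y + t) x = nn_poisson t (W y) x"
proof -
  have eq: "nn_poisson t (W y) x = (SUP n. nn_poisson t (V n y) x)"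
  proof -
    have "nn_poisson t (W y) x = (\<integral>\<^sup>+ s. (SUP n. ennreal (poisson t (x - s)) * V n y s) \<partial>lborel)"
      unfolding nn_poisson_def W_def by (simp add: SUP_mult_left_ennreal)
    also have "\<dots> = (SUP n. \<integral>\<^sup>+ s. ennreal (poisson t (x - s)) * V n y s \<partial>lborel)"
      by (rule nn_integral_monotone_convergence_SUP)
         (auto simp: incseq_def le_fun_def intro!: mult_left_mono V_mono)
    finally show ?thesis by (simp add: nn_poisson_def)
  qed
  show ?thesis
  proof (rule antisym)
    show "W (y + t) x \<le> nn_poisson t (W y) x"
      unfolding eq W_def
    proof (rule SUP_least)
      fix n
      obtain k where "e k < y" using e_less[OF y] by blast
      \<comment> \<open>The law for \<open>V\<close> holds only above the starting line, so the
        index is raised until that line lies below \<open>y\<close>.\<close>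
      then have m: "e (max k n) < y" using e_mono[of k "max k n"] by simp
      have "V n (y + t) x \<le> V (max k n) (y + t) x" by (rule V_mono) simp
      also have "\<dots> = nn_poisson t (V (max k n) y) x" by (rule V_semigroup[OF m t])
      also have "\<dots> \<le> (SUP n. nn_poisson t (V n y) x)" by (rule SUP_upper) simp
      finally show "V n (y + t) x \<le> (SUP n. nn_poisson t (V n y) x)" .
    qed
    show "nn_poisson t (W y) x \<le> W (y + t) x"
      unfolding eq
    proof (rule SUP_least)
      fix n
      show "nn_poisson t (V n y) x \<le> W (y + t) x"
      proof (cases "e n < y")
        case True
        then show ?thesis
          unfolding W_def V_semigroup[OF True t, symmetric] by (intro SUP_upper) simp
      next
        case False
        then have "V n y = (\<lambda>_. 0)" by (auto simp: V_def)
        then show ?thesis by (simp add: nn_poisson_def)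
      qed
    qed
  qed
qed

lemma W_square: "(\<integral>\<^sup>+ x. W y x * W y x \<partial>lborel) \<le> ennreal M"
proof -
  have "(\<integral>\<^sup>+ x. W y x * W y x \<partial>lborel) = (\<integral>\<^sup>+ x. liminf (\<lambda>n. V n y x * V n y x) \<partial>lborel)"
  proof (intro nn_integral_cong)
    fix x
    have "(\<lambda>n. V n y x) \<longlonglongrightarrow> W y x" unfolding W_def by (rule LIMSEQ_SUP[OF V_incseq])
    then have "(\<lambda>n. V n y x * V n y x) \<longlonglongrightarrow> W y x * W y x"
      by (intro tendsto_mult_ennreal) auto
    then show "W y x * W y x = liminf (\<lambda>n. V n y x * V n y x)"
      by (intro lim_imp_Liminf[symmetric]) simp_all
  qed
  also have "\<dots> \<le> liminf (\<lambda>n. \<integral>\<^sup>+ x. V n y x * V n y x \<partial>lborel)"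
    by (rule nn_integral_liminf) measurable
  also have "\<dots> \<le> ennreal M"
    by (rule Liminf_le) (auto intro!: always_eventually V_square)
  finally show ?thesis .
qed

text \<open>The inequality w <= 1 + w^2 and the boundedness of the kernel at height y/2 turn the L^2
  bound on the line at height y/2 into a pointwise bound at height \<open>y\<close>.\<close>

lemma W_finite:
  assumes y: "y > 0"
  shows "W y x < \<infinity>"
proof -
  have le: "w \<le> 1 + w * w" for w :: ennreal
  proof (cases "w \<le> 1")
    case True then show ?thesis by (simp add: add_increasing2)
  next
    case False
    then have "w * 1 \<le> w * w" by (intro mult_left_mono) auto
    then show ?thesis by (simp add: add_increasing)
  qed
  have "W y x = nn_poisson (y/2) (W (y/2)) x" using W_semigroup[of "y/2" "y/2" x] y by simp
  also have "\<dots> \<le> (\<integral>\<^sup>+ s. ennreal (poisson (y/2) (x - s)) + ennreal (1 / (pi * (y/2))) * (W (y/2) s * W (y/2) s) \<partial>lborel)"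
    unfolding nn_poisson_def
  proof (intro nn_integral_mono)
    fix s
    have "ennreal (poisson (y/2) (x - s)) * W (y/2) s \<le> ennreal (poisson (y/2) (x - s)) * (1 + W (y/2) s * W (y/2) s)"
      by (intro mult_left_mono le) auto
    also have "\<dots> = ennreal (poisson (y/2) (x - s)) + ennreal (poisson (y/2) (x - s)) * (W (y/2) s * W (y/2) s)"
      by (simp add: distrib_left)
    also have "\<dots> \<le> ennreal (poisson (y/2) (x - s)) + ennreal (1 / (pi * (y/2))) * (W (y/2) s * W (y/2) s)"
      using y by (intro add_left_mono mult_right_mono ennreal_leI poisson_le) auto
    finally show "ennreal (poisson (y/2) (x - s)) * W (y/2) s
      \<le> ennreal (poisson (y/2) (x - s)) + ennreal (1 / (pi * (y/2))) * (W (y/2) s * W (y/2) s)" .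
  qed
  also have "\<dots> = 1 + ennreal (1 / (pi * (y/2))) * (\<integral>\<^sup>+ s. W (y/2) s * W (y/2) s \<partial>lborel)"
    using y by (subst nn_integral_add) (auto simp: nn_integral_cmult nn_integral_poisson)
  also have "\<dots> < \<infinity>"
    using le_less_trans[OF W_square[of "y/2"] ennreal_less_top] by (simp add: ennreal_mult_less_top)
  finally show ?thesis .
qed

text \<open>Being finite, bounded in L^2 and a Poisson semigroup, \<open>W\<close> is the Poisson
  extension of its own boundary function, which is the required \<open>q\<close>.\<close>

lemma majorant:
  "\<exists>q :: real \<Rightarrow> real. q \<in> borel_measurable borel \<and> (\<integral>\<^sup>+ s. ennreal ((q s)\<^sup>2) \<partial>lborel) \<le> ennreal M \<and>
     (\<forall>y>0. \<forall>x. u y x \<le> (LINT s|lborel. poisson y (x - s) * q s))"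
proof -
  define v where "v = (\<lambda>z. complex_of_real (enn2real (W (Im z) (Re z))))"
  interpret L: L2_semigroup v M
  proof
    fix y :: real assume y: "y > 0"
    show "(\<lambda>x. v (Complex x y)) \<in> borel_measurable borel"
      unfolding v_def complex.sel by measurable
    have "(\<integral>\<^sup>+ x. ennreal ((cmod (v (Complex x y)))\<^sup>2) \<partial>lborel) = (\<integral>\<^sup>+ x. W y x * W y x \<partial>lborel)"
      using W_finite[OF y]
      by (intro nn_integral_cong) (simp add: v_def power2_eq_square ennreal_mult)
    then show "(\<integral>\<^sup>+ x. ennreal ((cmod (v (Complex x y)))\<^sup>2) \<partial>lborel) \<le> ennreal M"
      using W_square by simp
    fix t x :: real assume t: "t > 0"
    have "poisson_ext (\<lambda>s. v (Complex s y)) (Complex x t)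
        = of_real (LINT s|lborel. poisson t (x - s) * enn2real (W y s))"
      by (simp add: v_def poisson_ext_of_real)
    also have "(LINT s|lborel. poisson t (x - s) * enn2real (W y s))
        = enn2real (\<integral>\<^sup>+ s. ennreal (poisson t (x - s) * enn2real (W y s)) \<partial>lborel)"
      using t by (intro integral_eq_nn_integral) auto
    also have "(\<integral>\<^sup>+ s. ennreal (poisson t (x - s) * enn2real (W y s)) \<partial>lborel) = nn_poisson t (W y) x"
      unfolding nn_poisson_def using W_finite[OF y] t by (intro nn_integral_cong) (simp add: ennreal_mult)
    also have "\<dots> = W (y + t) x" by (rule W_semigroup[symmetric, OF y t])
    finally show "v (Complex x (y + t)) = poisson_ext (\<lambda>s. v (Complex s y)) (Complex x t)"
      by (simp add: v_def)
  qed
  obtain g0 where g0: "g0 \<in> borel_measurable borel" "(\<integral>\<^sup>+ s. ennreal ((cmod (g0 s))\<^sup>2) \<partial>lborel) \<le> ennreal M"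
    "\<And>z. Im z > 0 \<Longrightarrow> v z = poisson_ext g0 z"
    using L.boundary_function by blast
  have pi: "poisson_integrable g0"
    using g0 by (intro Lp_poisson_integrable(1)[where p = 2]) (auto simp: nn_integral_powr_2 intro: le_less_trans)
  show ?thesis
  \<comment> \<open>The L^2 theory delivers a complex-valued boundary function; the extension is
    real, so the real part has the same extension and no larger norm.\<close>
  proof (intro exI[of _ "\<lambda>s. Re (g0 s)"] conjI allI impI)
    show "(\<lambda>s. Re (g0 s)) \<in> borel_measurable borel" using g0(1) by measurable
    have "(\<integral>\<^sup>+ s. ennreal ((Re (g0 s))\<^sup>2) \<partial>lborel) \<le> (\<integral>\<^sup>+ s. ennreal ((cmod (g0 s))\<^sup>2) \<partial>lborel)"
      by (intro nn_integral_mono ennreal_leI) (simp add: cmod_power2)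
    then show "(\<integral>\<^sup>+ s. ennreal ((Re (g0 s))\<^sup>2) \<partial>lborel) \<le> ennreal M" using g0(2) by simp
    fix y x :: real assume y: "y > 0"
    obtain n where n: "e n < y" using e_less[OF y] by blast
    have "ennreal (u y x) \<le> nn_poisson (y - e n) (\<lambda>s. ennreal (u (e n) s)) x"
      using u_le_poisson[OF e_pos[of n], of "y - e n" x] n by simp
    also have "\<dots> = V n y x" using n by (simp add: V_def)
    also have "\<dots> \<le> W y x" unfolding W_def by (rule SUP_upper) simp
    finally have "u y x \<le> enn2real (W y x)"
      using W_finite[OF y, of x] by (metis enn2real_mono enn2real_ennreal infinity_ennreal_def u_nonneg)
    also have "\<dots> = Re (poisson_ext g0 (Complex x y))"
      using g0(3)[of "Complex x y"] y by (simp add: v_def) (metis Re_complex_of_real)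
    also have "\<dots> = (LINT s|lborel. poisson y (x - s) * Re (g0 s))"
      using integral_Re[OF poisson_integrableD[OF pi y, of x]] by (simp add: poisson_ext_def)
    finally show "u y x \<le> (LINT s|lborel. poisson y (x - s) * Re (g0 s))" .
  qed
qed

text \<open>The limit \<open>h\<close> is first found along vertical lines as b/d^2. Fatou's lemma
  upgrades this to L^1 convergence, under which the Cauchy and Poisson formulas of the shifted
  functions pass to the limit. The nontangential limit of \<open>g\<close> then follows from its
  Poisson representation.\<close>

theorem boundary:
  "\<exists>h. h \<in> borel_measurable borel \<and> integrable lborel h \<and>
     (AE x in lborel. has_nt_limit g x (h x)) \<and>
     (\<forall>z. Im z > 0 \<longrightarrow> g z = poisson_ext h z) \<and>
     (\<forall>z. Im z < 0 \<longrightarrow> cauchy_int h z = 0)"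
proof -
  obtain q :: "real \<Rightarrow> real" where q[measurable]: "q \<in> borel_measurable borel"
    and qM: "(\<integral>\<^sup>+ s. ennreal ((q s)\<^sup>2) \<partial>lborel) \<le> ennreal M"
    and uq: "\<And>y x. y > 0 \<Longrightarrow> u y x \<le> (LINT s|lborel. poisson y (x - s) * q s)"
    using majorant by blast
  have qL2: "(\<integral>\<^sup>+ s. ennreal (cmod (complex_of_real (q s)) powr 2) \<partial>lborel) < \<infinity>"
    using qM by (auto intro: le_less_trans)
  have intq: "integrable lborel (\<lambda>s. (q s)\<^sup>2)"
    using le_less_trans[OF qM ennreal_less_top] by (intro integrableI_nonneg) auto
  have ci: "cauchy_integrable (\<lambda>s. of_real (q s))"
    by (rule Lp_cauchy_integrable[where p = 2]) (use qL2 in auto)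
  have pi: "poisson_integrable (\<lambda>s. of_real (q s))"
    by (rule cauchy_integrable_imp_poisson_integrable[OF ci])
  define G where "G = schwarz_int q"
  have holG: "G holomorphic_on {z. Im z > 0}" unfolding G_def by (rule schwarz_int_holomorphic[OF ci])
  have ReG: "u (Im z) (Re z) \<le> Re (G z)" if "Im z > 0" for z
    unfolding G_def Re_schwarz_int[OF ci that] by (rule uq[OF that])
  have ReG0: "Re (G z) \<ge> 0" if "Im z > 0" for z
    using ReG[OF that] u_nonneg order.trans by blast
  have G1: "1 \<le> cmod (1 + G z)" "Re (G z) \<le> cmod (1 + G z)" "1 + G z \<noteq> 0" if "Im z > 0" for z
  proof -
    have "1 + Re (G z) \<le> cmod (1 + G z)" using complex_Re_le_cmod[of "1 + G z"] by simp
    then show "1 \<le> cmod (1 + G z)" "Re (G z) \<le> cmod (1 + G z)" using ReG0[OF that] by auto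
    then show "1 + G z \<noteq> 0" by auto
  qed
  have gG: "cmod (g z) \<le> (Re (G z))\<^sup>2" if "Im z > 0" for z
  proof -
    have "(u (Im z) (Re z))\<^sup>2 \<le> (Re (G z))\<^sup>2" by (intro power_mono ReG that) simp
    then show ?thesis by (simp add: u_def)
  qed
  define D where "D = (\<lambda>z. 1 / (1 + G z))"
  define B where "B = (\<lambda>z. g z / ((1 + G z) * (1 + G z)))"
  have "D holomorphic_on {z. Im z > 0}" unfolding D_def
    by (intro holomorphic_intros holG) (use G1 in auto)
  moreover have "cmod (D z) \<le> 1" if "Im z > 0" for z
    using G1[OF that] by (simp add: D_def norm_divide divide_le_eq_1)
  ultimately obtain d where d[measurable]: "d \<in> borel_measurable borel" and dlim: "AE x in lborel. has_nt_limit D x (d x)"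
    using bounded_holomorphic_boundary[of D] by blast
  have "B holomorphic_on {z. Im z > 0}" unfolding B_def
    by (intro holomorphic_intros holG hol) (use G1 in auto)
  moreover have "cmod (B z) \<le> 1" if z: "Im z > 0" for z
  proof -
    have "(Re (G z))\<^sup>2 \<le> (cmod (1 + G z))\<^sup>2" by (intro power_mono G1 ReG0 z)
    with gG[OF z] have "cmod (g z) \<le> cmod (1 + G z) * cmod (1 + G z)"
      by (simp add: power2_eq_square)
    then show ?thesis using G1[OF z] by (simp add: B_def norm_divide norm_mult divide_le_eq_1 zero_less_mult_iff)
  qed
  ultimately obtain b where b[measurable]: "b \<in> borel_measurable borel" and blim: "AE x in lborel. has_nt_limit B x (b x)"
    using bounded_holomorphic_boundary[of B] by blast
  \<comment> \<open>A crude bound from |q| |s - z|^(-1) <= q^2 + |s - z|^(-2). It makes the shifted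
    square roots below bounded, as the Poisson formula for them requires.\<close>
  have Gbound: "cmod (G z) \<le> (LINT s|lborel. (q s)\<^sup>2) + pi / Im z" if z: "Im z > 0" for z
  proof -
    have sq: "1 / (cmod (of_real s - z))\<^sup>2 = pi / Im z * poisson (Im z) (Re z - s)" for s
      using z by (simp add: poisson_def cmod_power2 power2_commute)
    have "cmod (cauchy_int (\<lambda>s. of_real (q s)) z) \<le> (LINT s|lborel. cmod (of_real (q s) / (of_real s - z)))"
      unfolding cauchy_int_def by (rule integral_norm_bound)
    also have "\<dots> \<le> (LINT s|lborel. (q s)\<^sup>2 + pi / Im z * poisson (Im z) (Re z - s))"
    proof (rule integral_mono)
      show "integrable lborel (\<lambda>s. cmod (of_real (q s) / (of_real s - z)))"
        using cauchy_integrableD[OF ci, of z] z by (intro integrable_norm) auto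
      show "integrable lborel (\<lambda>s. (q s)\<^sup>2 + pi / Im z * poisson (Im z) (Re z - s))"
        using intq poisson_has_integral(1)[OF z, of "Re z"] by (intro Bochner_Integration.integrable_add integrable_mult_right)
      fix s
      from mult_le_sum_squares[of "\<bar>q s\<bar>" "1 / cmod (of_real s - z)"]
      show "cmod (of_real (q s) / (of_real s - z)) \<le> (q s)\<^sup>2 + pi / Im z * poisson (Im z) (Re z - s)"
        unfolding sq[symmetric] by (simp add: norm_divide power_divide)
    qed
    also have "\<dots> = (LINT s|lborel. (q s)\<^sup>2) + pi / Im z"
      using intq poisson_has_integral[OF z, of "Re z"] by simp
    finally have le: "cmod (cauchy_int (\<lambda>s. of_real (q s)) z) \<le> (LINT s|lborel. (q s)\<^sup>2) + pi / Im z" .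
    have "cmod (G z) = cmod (cauchy_int (\<lambda>s. of_real (q s)) z) / pi"
      by (simp add: G_def schwarz_int_def norm_divide norm_mult)
    also have "\<dots> \<le> cmod (cauchy_int (\<lambda>s. of_real (q s)) z)"
      using pi_ge_two mult_left_mono[of 1 pi "cmod (cauchy_int (\<lambda>s. of_real (q s)) z)"] by (simp add: divide_le_eq)
    finally show ?thesis using le by linarith
  qed
  text \<open>Kolmogorov's trick: \<open>csqrt (1 + G)\<close> takes values in a sector, so its real part dominates its
    modulus, and the Poisson formula at \<open>\<i>\<close> bounds its integral. Hence \<open>1 / D\<close> stays finite.\<close>
  define k where "k = (\<lambda>n w. csqrt (1 + G (w + \<i> * of_real (e n))))"
  have holk: "k n holomorphic_on {w. Im w > - e n}" for n
    unfolding k_def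
  proof (rule holomorphic_on_csqrt')
    show "(\<lambda>w. 1 + G (w + \<i> * of_real (e n))) holomorphic_on {w. Im w > - e n}"
      by (intro holomorphic_intros holomorphic_on_compose_gen[OF _ holG, unfolded comp_def]) auto
    fix w assume "w \<in> {w. Im w > - e n}"
    then have "Re (1 + G (w + \<i> * of_real (e n))) > 0"
      using ReG0[of "w + \<i> * of_real (e n)"] by (simp add: add_pos_nonneg)
    then show "1 + G (w + \<i> * of_real (e n)) \<notin> \<real>\<^sub>\<le>\<^sub>0"
      unfolding complex_nonpos_Reals_iff by linarith
  qed
  have contk: "(\<lambda>s. k n (of_real s)) \<in> borel_measurable borel" for n
    by (intro borel_measurable_continuous_onI
        continuous_on_compose2[OF holomorphic_on_imp_continuous_on[OF holk[of n]]] continuous_intros) auto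
  have csqrt_sector: "cmod r \<le> 2 * Re r" if "Re r \<ge> 0" "Re (r\<^sup>2) \<ge> 0" for r
  proof -
    have "(Im r)\<^sup>2 \<le> (Re r)\<^sup>2" using that(2) by (simp add: power2_eq_square)
    then have "\<bar>Im r\<bar> \<le> Re r" using that(1) by (simp add: abs_le_square_iff[symmetric])
    then show ?thesis using cmod_le[of r] that(1) by linarith
  qed
  have kint: "(\<integral>\<^sup>+ s. ennreal (poisson 1 (0 - s) * cmod (k n (of_real s))) \<partial>lborel) \<le> ennreal (2 * cmod (k n \<i>))" for n
  proof -
    define K where "K = sqrt (1 + ((LINT s|lborel. (q s)\<^sup>2) + pi / e n))"
    have bk: "cmod (k n w) \<le> K" if "Im w \<ge> 0" for w
    proof -
      have "cmod (1 + G (w + \<i> * of_real (e n))) \<le> 1 + cmod (G (w + \<i> * of_real (e n)))"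
        using norm_triangle_ineq[of "1::complex" "G (w + \<i> * of_real (e n))"] by simp
      also have "\<dots> \<le> 1 + ((LINT s|lborel. (q s)\<^sup>2) + pi / Im (w + \<i> * of_real (e n)))"
        using that e_pos[of n] by (intro add_left_mono Gbound) (simp add: add_nonneg_pos)
      also have "\<dots> \<le> 1 + ((LINT s|lborel. (q s)\<^sup>2) + pi / e n)"
        using that e_pos[of n] by (intro add_left_mono divide_left_mono mult_pos_pos) (auto simp: add_nonneg_pos)
      finally show ?thesis unfolding k_def K_def by (simp add: norm_csqrt)
    qed
    note P = bounded_holomorphic_Poisson[OF holk e_pos zero_less_one bk, of 0]
    have Rek: "cmod (k n (of_real s)) \<le> 2 * Re (k n (of_real s))" for s
      unfolding k_def
    proof (rule csqrt_sector)
      show "0 \<le> Re (csqrt (1 + G (of_real s + \<i> * of_real (e n))))" by (rule Re_csqrt)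
      show "0 \<le> Re ((csqrt (1 + G (of_real s + \<i> * of_real (e n))))\<^sup>2)"
        using ReG0[of "of_real s + \<i> * of_real (e n)"] by simp
    qed
    have intR: "integrable lborel (\<lambda>s. poisson 1 (0 - s) * Re (k n (of_real s)))"
      using integrable_Re[OF P(1)] by (simp del: diff_0)
    have "(\<integral>\<^sup>+ s. ennreal (poisson 1 (0 - s) * cmod (k n (of_real s))) \<partial>lborel)
        \<le> (\<integral>\<^sup>+ s. ennreal (2 * (poisson 1 (0 - s) * Re (k n (of_real s)))) \<partial>lborel)"
    proof (intro nn_integral_mono ennreal_leI)
      fix s
      show "poisson 1 (0 - s) * cmod (k n (of_real s)) \<le> 2 * (poisson 1 (0 - s) * Re (k n (of_real s)))"
        using mult_left_mono[OF Rek[of s], of "poisson 1 (0 - s)"] by (simp add: mult.left_commute)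
    qed
    also have "\<dots> = ennreal (2 * (LINT s|lborel. poisson 1 (0 - s) * Re (k n (of_real s))))"
    proof (subst nn_integral_eq_integral)
      show "integrable lborel (\<lambda>s. 2 * (poisson 1 (0 - s) * Re (k n (of_real s))))"
        using intR by (rule integrable_mult_right)
      show "AE s in lborel. 0 \<le> 2 * (poisson 1 (0 - s) * Re (k n (of_real s)))"
        unfolding k_def by (intro AE_I2 mult_nonneg_nonneg Re_csqrt) auto
    qed simp
    also have "(LINT s|lborel. poisson 1 (0 - s) * Re (k n (of_real s))) = Re (k n \<i>)"
      using integral_Re[OF P(1)] P(2) by (simp add: imaginary_unit.code del: diff_0)
    also have "ennreal (2 * Re (k n \<i>)) \<le> ennreal (2 * cmod (k n \<i>))"
      by (intro ennreal_leI mult_left_mono complex_Re_le_cmod) auto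
    finally show ?thesis .
  qed
  have contG: "continuous_on {z. Im z > 0} G" by (rule holomorphic_on_imp_continuous_on[OF holG])
  \<comment> \<open>Uniform in \<open>n\<close> because the points \<i> + \<i> e n converge to \<i>,
    where \<open>G\<close> is continuous.\<close>
  obtain K where K: "\<And>n. 2 * cmod (k n \<i>) \<le> K"
  proof -
    have "isCont G \<i>"
      using contG open_halfspace_Im_gt[of 0] by (simp add: continuous_on_eq_continuous_at)
    moreover have "(\<lambda>n. \<i> + \<i> * of_real (e n)) \<longlonglongrightarrow> \<i> + \<i> * of_real 0"
      by (intro tendsto_intros e_lim)
    ultimately have "(\<lambda>n. G (\<i> + \<i> * of_real (e n))) \<longlonglongrightarrow> G \<i>"
      by (intro isCont_tendsto_compose[of _ G]) auto
    then have "(\<lambda>n. 2 * sqrt (cmod (1 + G (\<i> + \<i> * of_real (e n))))) \<longlonglongrightarrow> 2 * sqrt (cmod (1 + G \<i>))"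
      by (intro tendsto_intros)
    then have "Bseq (\<lambda>n. 2 * sqrt (cmod (1 + G (\<i> + \<i> * of_real (e n)))))"
      using convergent_imp_Bseq convergentI by blast
    then obtain K where "\<And>n. \<bar>2 * sqrt (cmod (1 + G (\<i> + \<i> * of_real (e n))))\<bar> \<le> K"
      unfolding Bseq_def by auto
    then have "2 * cmod (k n \<i>) \<le> K" for n
      unfolding k_def norm_csqrt using abs_le_D1 by blast
    then show thesis by (rule that)
  qed
  \<comment> \<open>By Fatou's lemma the bounded integrals force a finite lower limit of |k n| at
    almost every real point.\<close>
  have "(\<integral>\<^sup>+ s. liminf (\<lambda>n. ennreal (poisson 1 (0 - s) * cmod (k n (of_real s)))) \<partial>lborel)
      \<le> liminf (\<lambda>n. \<integral>\<^sup>+ s. ennreal (poisson 1 (0 - s) * cmod (k n (of_real s))) \<partial>lborel)"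
    by (rule nn_integral_liminf) (use contk in measurable)
  also have "\<dots> \<le> ennreal K"
    by (rule Liminf_le) (use order.trans[OF kint ennreal_leI[OF K]] in \<open>auto intro!: always_eventually\<close>)
  also have "\<dots> < \<infinity>" by simp
  finally have "AE s in lborel. liminf (\<lambda>n. ennreal (poisson 1 (0 - s) * cmod (k n (of_real s)))) \<noteq> \<infinity>"
    by (intro nn_integral_PInf_AE) (use contk in measurable)
  then have d0: "AE x in lborel. d x \<noteq> 0"
    using dlim
  proof eventually_elim
    case (elim x)
    show ?case
    proof
      \<comment> \<open>If the boundary value of \<open>D\<close> were 0, then |1 + G|, and with it
        |k n|, would tend to infinity on the vertical line over \<open>x\<close>, against the finite
        lower limit.\<close>
      assume dx: "d x = 0"
      have "(\<lambda>n. D (Complex x (e n))) \<longlonglongrightarrow> 0"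
        using has_nt_limit_vertical[OF elim(2) e_pos e_lim] dx by simp
      then have "filterlim (\<lambda>n. inverse (D (Complex x (e n)))) at_infinity sequentially"
        by (intro filterlim_compose[OF filterlim_inverse_at_infinity] filterlim_atI)
           (use G1 in \<open>auto simp: D_def intro!: always_eventually\<close>)
      moreover have "inverse (D (Complex x (e n))) = 1 + G (of_real x + \<i> * of_real (e n))" for n
        by (simp add: D_def Complex_eq)
      ultimately have "filterlim (\<lambda>n. cmod (1 + G (of_real x + \<i> * of_real (e n)))) at_top sequentially"
        by (simp add: filterlim_at_infinity_conv_norm_at_top)
      then have "filterlim (\<lambda>n. sqrt (cmod (1 + G (of_real x + \<i> * of_real (e n))))) at_top sequentially"
        by (rule filterlim_compose[OF sqrt_at_top])
      then have "filterlim (\<lambda>n. poisson 1 (0 - x) * cmod (k n (of_real x))) at_top sequentially"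
        unfolding k_def norm_csqrt
        by (intro filterlim_tendsto_pos_mult_at_top[OF tendsto_const]) (auto intro: poisson_pos)
      then have "(\<lambda>n. ennreal (poisson 1 (0 - x) * cmod (k n (of_real x)))) \<longlonglongrightarrow> \<infinity>"
        by (simp add: ennreal_tendsto_top_eq_at_top)
      then have "liminf (\<lambda>n. ennreal (poisson 1 (0 - x) * cmod (k n (of_real x)))) = \<infinity>"
        by (intro lim_imp_Liminf) auto
      with elim(1) show False by simp
    qed
  qed
  \<comment> \<open>Modelled on the identity g = B/D^2 in the half-plane.\<close>
  define h where "h = (\<lambda>x. b x / (d x * d x))"
  have h[measurable]: "h \<in> borel_measurable borel" unfolding h_def by measurable
  define vn where "vn = (\<lambda>n x. Re (poisson_ext (\<lambda>s. of_real (q s)) (Complex x (e n))))"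
  have vn[measurable]: "vn n \<in> borel_measurable borel" for n
    unfolding vn_def using poisson_ext_measurable[of "\<lambda>s. of_real (q s)" "e n"] by measurable
  have gm[measurable]: "(\<lambda>x. g (Complex x (e n))) \<in> borel_measurable borel" for n
    by (rule line_measurable) simp
  have gvn: "cmod (g (Complex x (e n))) \<le> (vn n x)\<^sup>2" for n x
  proof -
    have "(u (e n) x)\<^sup>2 \<le> (vn n x)\<^sup>2"
      using uq[OF e_pos[of n], of x] unfolding vn_def poisson_ext_of_real by (intro power_mono) auto
    then show ?thesis by (simp add: u_def)
  qed
  have lims: "AE x in lborel. (\<lambda>n. g (Complex x (e n))) \<longlonglongrightarrow> h x \<and> (\<lambda>n. vn n x) \<longlonglongrightarrow> q x"
    using dlim blim d0 Fatou_poisson[OF pi]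
  proof eventually_elim
    case (elim x)
    have "(\<lambda>n. B (Complex x (e n)) / (D (Complex x (e n)) * D (Complex x (e n)))) \<longlonglongrightarrow> h x"
      unfolding h_def using elim(3)
      by (intro tendsto_divide tendsto_mult has_nt_limit_vertical[OF elim(1) e_pos e_lim]
          has_nt_limit_vertical[OF elim(2) e_pos e_lim]) auto
    moreover have "B (Complex x (e n)) / (D (Complex x (e n)) * D (Complex x (e n))) = g (Complex x (e n))" for n
      using G1(3)[of "Complex x (e n)"] by (simp add: B_def D_def)
    ultimately have "(\<lambda>n. g (Complex x (e n))) \<longlonglongrightarrow> h x" by simp
    moreover have "(\<lambda>n. vn n x) \<longlonglongrightarrow> q x"
      unfolding vn_def using tendsto_Re[OF has_nt_limit_vertical[OF elim(4) e_pos e_lim]] by simp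
    ultimately show ?case by blast
  qed
  define Q where "Q = (LINT s|lborel. (q s)\<^sup>2)"
  have nnQ: "(\<integral>\<^sup>+ s. ennreal ((q s)\<^sup>2) \<partial>lborel) = ennreal Q"
    unfolding Q_def by (rule nn_integral_eq_integral[OF intq]) auto
  have vnQ: "(\<integral>\<^sup>+ x. ennreal ((vn n x)\<^sup>2) \<partial>lborel) \<le> ennreal Q" for n
  proof -
    have "(\<integral>\<^sup>+ x. ennreal ((vn n x)\<^sup>2) \<partial>lborel)
       = (\<integral>\<^sup>+ x. ennreal (cmod (poisson_ext (\<lambda>s. of_real (q s)) (Complex x (e n))) powr 2) \<partial>lborel)"
      by (simp add: vn_def poisson_ext_of_real)
    also have "\<dots> \<le> (\<integral>\<^sup>+ s. ennreal (cmod (complex_of_real (q s)) powr 2) \<partial>lborel)"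
      by (rule poisson_Lp_contraction) (use qL2 in auto)
    finally show ?thesis by (simp add: nnQ)
  qed
  have intv: "integrable lborel (\<lambda>x. (vn n x)\<^sup>2)" for n
    using le_less_trans[OF vnQ ennreal_less_top] by (intro integrableI_nonneg) auto
  have intvQ: "(LINT x|lborel. (vn n x)\<^sup>2) \<le> Q" for n
  proof -
    have "Q \<ge> 0" unfolding Q_def by (intro integral_nonneg_AE) auto
    then show ?thesis
      using vnQ[of n] nn_integral_eq_integral[OF intv[of n]] by simp
  qed
  have hq: "AE x in lborel. cmod (h x) \<le> (q x)\<^sup>2"
    using lims
  proof eventually_elim
    case (elim x)
    then show ?case
      by (intro LIMSEQ_le[of "\<lambda>n. cmod (g (Complex x (e n)))" _ "\<lambda>n. (vn n x)\<^sup>2"])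
         (auto intro!: tendsto_intros gvn)
  qed
  have inth: "integrable lborel h"
    by (rule Bochner_Integration.integrable_bound[OF intq]) (use hq in auto)
  have intg: "integrable lborel (\<lambda>x. g (Complex x (e n)))" for n
    by (rule Bochner_Integration.integrable_bound[OF intv[of n]]) (use gvn in auto)
  define I where "I = (\<lambda>n. LINT x|lborel. cmod (g (Complex x (e n)) - h x))"
  have I0: "I n \<ge> 0" for n unfolding I_def by (intro integral_nonneg_AE) auto
  \<comment> \<open>Dominated convergence with a varying majorant:
    \<open>(vn n)^2 + q^2 - |g - h|\<close> is nonnegative with pointwise limit 2 q^2. Fatou bounds
    the lower limit of its integrals from below by 2 Q, while they are at most 2 Q - I n.\<close>
  have Ilim: "I \<longlonglongrightarrow> 0"
  proof -
    have fn0: "AE x in lborel. 0 \<le> (vn n x)\<^sup>2 + (q x)\<^sup>2 - cmod (g (Complex x (e n)) - h x)" for n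
      using hq
    proof eventually_elim
      case (elim x)
      then show ?case
        using norm_triangle_ineq4[of "g (Complex x (e n))" "h x"] gvn[of x n] by linarith
    qed
    have intf: "integrable lborel (\<lambda>x. (vn n x)\<^sup>2 + (q x)\<^sup>2 - cmod (g (Complex x (e n)) - h x))" for n
      using intv intq intg inth by (intro Bochner_Integration.integrable_diff Bochner_Integration.integrable_add integrable_norm)
    define J where "J = (\<lambda>n. LINT x|lborel. (vn n x)\<^sup>2 + (q x)\<^sup>2 - cmod (g (Complex x (e n)) - h x))"
    have J0: "J n \<ge> 0" for n unfolding J_def using fn0[of n] by (rule integral_nonneg_AE)
    have JI: "I n \<le> 2 * Q - J n" for n
    proof -
      have "J n = (LINT x|lborel. (vn n x)\<^sup>2) + Q - I n"
        unfolding J_def I_def Q_def using intv intq intg inth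
        by (simp add: Bochner_Integration.integral_diff Bochner_Integration.integral_add)
      then show ?thesis using intvQ[of n] by linarith
    qed
    have "ennreal (2 * Q) = (\<integral>\<^sup>+ x. ennreal (2 * (q x)\<^sup>2) \<partial>lborel)"
      using nn_integral_eq_integral[OF integrable_mult_right[OF intq, of 2]] by (simp add: Q_def)
    also have "\<dots> = (\<integral>\<^sup>+ x. liminf (\<lambda>n. ennreal ((vn n x)\<^sup>2 + (q x)\<^sup>2 - cmod (g (Complex x (e n)) - h x))) \<partial>lborel)"
    proof (intro nn_integral_cong_AE, use lims in eventually_elim)
      case (elim x)
      then have "(\<lambda>n. (vn n x)\<^sup>2 + (q x)\<^sup>2 - cmod (g (Complex x (e n)) - h x)) \<longlonglongrightarrow> (q x)\<^sup>2 + (q x)\<^sup>2 - cmod (h x - h x)"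
        by (intro tendsto_intros) auto
      then have "(\<lambda>n. ennreal ((vn n x)\<^sup>2 + (q x)\<^sup>2 - cmod (g (Complex x (e n)) - h x))) \<longlonglongrightarrow> ennreal (2 * (q x)\<^sup>2)"
        by (intro tendsto_ennrealI) simp
      then show ?case by (intro lim_imp_Liminf[symmetric]) simp_all
    qed
    also have "\<dots> \<le> liminf (\<lambda>n. \<integral>\<^sup>+ x. ennreal ((vn n x)\<^sup>2 + (q x)\<^sup>2 - cmod (g (Complex x (e n)) - h x)) \<partial>lborel)"
      by (rule nn_integral_liminf) measurable
    also have "(\<lambda>n. \<integral>\<^sup>+ x. ennreal ((vn n x)\<^sup>2 + (q x)\<^sup>2 - cmod (g (Complex x (e n)) - h x)) \<partial>lborel) = (\<lambda>n. ennreal (J n))"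
      unfolding J_def by (intro ext nn_integral_eq_integral intf fn0)
    finally have lim: "ennreal (2 * Q) \<le> liminf (\<lambda>n. ennreal (J n))" .
    show ?thesis
    proof (rule LIMSEQ_I)
      fix \<delta> :: real assume \<delta>: "\<delta> > 0"
      show "\<exists>N. \<forall>n\<ge>N. norm (I n - 0) < \<delta>"
      \<comment> \<open>In the second case 2 Q - \<delta> is nonnegative, so \<open>ennreal\<close>
        does not truncate it.\<close>
      proof (cases "2 * Q < \<delta>")
        case True
        have "norm (I n - 0) < \<delta>" for n using I0[of n] JI[of n] J0[of n] True by simp
        then show ?thesis by blast
      next
        case False
        then have "ennreal (2 * Q - \<delta>) < ennreal (2 * Q)" using \<delta> by (simp add: ennreal_less_iff)
        then have "eventually (\<lambda>n. ennreal (2 * Q - \<delta>) < ennreal (J n)) sequentially"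
          using lim unfolding le_Liminf_iff by blast
        then obtain N where N: "\<And>n. n \<ge> N \<Longrightarrow> ennreal (2 * Q - \<delta>) < ennreal (J n)"
          unfolding eventually_sequentially by blast
        have "norm (I n - 0) < \<delta>" if "n \<ge> N" for n
          using N[OF that] JI[of n] I0[of n] False by (simp add: ennreal_less_iff)
        then show ?thesis by blast
      qed
    qed
  qed
  \<comment> \<open>L^1 convergence allows the limit under the integral against any bounded kernel:
    the Poisson kernel for \<open>z\<close> above the line, the Cauchy kernel for \<open>z\<close>
    below.\<close>
  have kernel_lim: "(\<lambda>n. LINT x|lborel. c x * g (Complex x (e n))) \<longlonglongrightarrow> (LINT x|lborel. c x * h x)"
    if c[measurable]: "c \<in> borel_measurable borel" and cK: "\<And>x. cmod (c x) \<le> K" for c :: "real \<Rightarrow> complex" and K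
  proof -
    have ib: "integrable lborel (\<lambda>x. c x * f x)" if f: "integrable lborel f" for f :: "real \<Rightarrow> complex"
    proof (rule Bochner_Integration.integrable_bound[OF integrable_mult_right[OF integrable_norm[OF f], of K]])
      show "(\<lambda>x. c x * f x) \<in> borel_measurable lborel"
        using borel_measurable_integrable[OF f] by measurable
      have "0 \<le> K" using order.trans[OF norm_ge_zero cK] .
      then show "AE x in lborel. norm (c x * f x) \<le> norm (K * norm (f x))"
        using cK by (intro AE_I2) (simp add: norm_mult mult_right_mono)
    qed
    have "(\<lambda>n. (LINT x|lborel. c x * g (Complex x (e n))) - (LINT x|lborel. c x * h x)) \<longlonglongrightarrow> 0"
    proof (rule Lim_null_comparison[OF always_eventually])
      show "(\<lambda>n. K * I n) \<longlonglongrightarrow> 0" using tendsto_mult_right[OF Ilim, of K] by (simp add: mult.commute)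
      show "\<forall>n. norm ((LINT x|lborel. c x * g (Complex x (e n))) - (LINT x|lborel. c x * h x)) \<le> K * I n"
      proof
        fix n
        have d: "integrable lborel (\<lambda>x. g (Complex x (e n)) - h x)" using intg inth by simp
        have "(LINT x|lborel. c x * g (Complex x (e n))) - (LINT x|lborel. c x * h x)
            = (LINT x|lborel. c x * (g (Complex x (e n)) - h x))"
          using ib[OF intg[of n]] ib[OF inth] by (simp add: right_diff_distrib)
        also have "norm \<dots> \<le> (LINT x|lborel. norm (c x * (g (Complex x (e n)) - h x)))"
          by (rule integral_norm_bound)
        also have "\<dots> \<le> (LINT x|lborel. K * cmod (g (Complex x (e n)) - h x))"
          using ib[OF d] d cK by (intro integral_mono integrable_norm integrable_mult_right) (auto simp: norm_mult mult_right_mono)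
        finally show "norm ((LINT x|lborel. c x * g (Complex x (e n))) - (LINT x|lborel. c x * h x)) \<le> K * I n"
          by (simp add: I_def)
      qed
    qed
    then show ?thesis by (simp add: LIM_zero_iff)
  qed
  have contg: "continuous_on {z. Im z > 0} g" by (rule holomorphic_on_imp_continuous_on[OF hol])
  have line: "complex_of_real s + \<i> * of_real a = Complex s a" for s a by (simp add: complex_eq_iff)
  have poisson_rep: "g z = poisson_ext h z" if z: "Im z > 0" for z
  proof -
    have "(\<lambda>n. LINT s|lborel. of_real (poisson (Im z) (Re z - s)) * g (Complex s (e n)))
        \<longlonglongrightarrow> (LINT s|lborel. of_real (poisson (Im z) (Re z - s)) * h s)"
      by (rule kernel_lim[where K = "1 / (pi * Im z)"]) (use poisson_le[OF z] z in auto)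
    also have "(LINT s|lborel. of_real (poisson (Im z) (Re z - s)) * h s) = poisson_ext h z"
      by (simp add: poisson_ext_def scaleR_conv_of_real)
    also have "(\<lambda>n. LINT s|lborel. of_real (poisson (Im z) (Re z - s)) * g (Complex s (e n))) = (\<lambda>n. g (z + \<i> * of_real (e n)))"
    proof
      fix n
      obtain C where C: "C \<ge> 0" "\<And>w. Im w \<ge> 0 \<Longrightarrow> cmod (g (w + \<i> * of_real (e n))) \<le> C / (1 + cmod w)\<^sup>2"
        by (rule shift_decay[OF e_pos]) blast
      have bd: "cmod (g (w + \<i> * of_real (e n))) \<le> C" if "Im w \<ge> 0" for w
      proof -
        have "C / (1 + cmod w)\<^sup>2 \<le> C / 1"
          using C(1) by (intro divide_left_mono one_le_power mult_pos_pos zero_less_power add_pos_nonneg) auto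
        then show ?thesis using C(2)[OF that] by simp
      qed
      from bounded_holomorphic_Poisson(2)[OF shift_holomorphic[OF e_pos] e_pos z bd, of "Re z"]
      show "(LINT s|lborel. of_real (poisson (Im z) (Re z - s)) * g (Complex s (e n))) = g (z + \<i> * of_real (e n))"
        by (simp add: line)
    qed
    finally have 1: "(\<lambda>n. g (z + \<i> * of_real (e n))) \<longlonglongrightarrow> poisson_ext h z" .
    have "isCont g z" using contg open_halfspace_Im_gt[of 0] z by (simp add: continuous_on_eq_continuous_at)
    moreover have "(\<lambda>n. z + \<i> * of_real (e n)) \<longlonglongrightarrow> z + \<i> * of_real 0"
      by (intro tendsto_intros e_lim)
    ultimately have "(\<lambda>n. g (z + \<i> * of_real (e n))) \<longlonglongrightarrow> g z"
      by (intro isCont_tendsto_compose[of _ g]) auto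
    then show ?thesis using 1 LIMSEQ_unique by blast
  qed
  have lower: "cauchy_int h z = 0" if z: "Im z < 0" for z
  proof -
    have ker: "cmod (1 / (w - z)) \<le> 1 / - Im z" if "Im w \<ge> 0" for w
    proof -
      have "- Im z \<le> cmod (w - z)" using abs_Im_le_cmod[of "w - z"] that z by simp
      then have "1 / cmod (w - z) \<le> 1 / - Im z" using z by (intro frac_le) auto
      then show ?thesis by (simp add: norm_divide)
    qed
    have "(\<lambda>n. LINT s|lborel. 1 / (of_real s - z) * g (Complex s (e n)))
        \<longlonglongrightarrow> (LINT s|lborel. 1 / (of_real s - z) * h s)"
      by (rule kernel_lim[where K = "1 / - Im z"]) (use ker in auto)
    moreover have "(LINT s|lborel. 1 / (of_real s - z) * g (Complex s (e n))) = 0" for n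
    proof -
      obtain C where C: "C \<ge> 0" "\<And>w. Im w \<ge> 0 \<Longrightarrow> cmod (g (w + \<i> * of_real (e n))) \<le> C / (1 + cmod w)\<^sup>2"
        by (rule shift_decay[OF e_pos]) blast
      \<comment> \<open>The strip below the real line must stay inside the domain of the shifted
        function and above the pole at \<open>z\<close>.\<close>
      define \<eta> where "\<eta> = min (e n) (- Im z)"
      have \<eta>: "\<eta> > 0" using z by (simp add: \<eta>_def)
      have hl: "(\<lambda>w. 1 / (w - z) * g (w + \<i> * of_real (e n))) holomorphic_on {w. Im w > - \<eta>}"
        by (intro holomorphic_intros holomorphic_on_subset[OF shift_holomorphic[OF e_pos[of n]]])
           (auto simp: \<eta>_def)
      have bd: "cmod (1 / (w - z) * g (w + \<i> * of_real (e n))) \<le> (1 / - Im z * C) / (1 + cmod w)\<^sup>2" if "Im w \<ge> 0" for w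
      proof -
        have "cmod (1 / (w - z)) * cmod (g (w + \<i> * of_real (e n))) \<le> 1 / - Im z * (C / (1 + cmod w)\<^sup>2)"
          using z by (intro mult_mono ker C that) auto
        then show ?thesis by (simp only: norm_mult times_divide_eq_right)
      qed
      show ?thesis
        using halfplane_Cauchy_0(2)[OF hl \<eta> bd] by (simp only: line)
    qed
    ultimately have "(LINT s|lborel. 1 / (of_real s - z) * h s) = 0"
      by (simp add: LIMSEQ_const_iff)
    then show ?thesis by (simp add: cauchy_int_def)
  qed
  have "(\<integral>\<^sup>+ s. ennreal (cmod (h s) powr 1) \<partial>lborel) < \<infinity>"
    using inth by (simp add: integrable_iff_bounded)
  then have "poisson_integrable h" by (intro Lp_poisson_integrable(1)[where p = 1]) auto
  from Fatou_poisson[OF this] have "AE x in lborel. has_nt_limit g x (h x)"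
    by eventually_elim (erule has_nt_limit_cong, simp add: poisson_rep)
  then show ?thesis using h inth poisson_rep lower by blast
qed

end

section \<open>Hardy spaces of the half-plane\<close>

text \<open>
  Difference quotients \<open>\<Phi> (z + a) - \<Phi> z\<close> of a primitive are bounded by the integrals of \<open>f\<close> over
  horizontal segments; Cauchy's estimate for them bounds the oscillation of \<open>f\<close> along such segments.
\<close>

lemma hardy_bounded_above_height:
  fixes f :: "complex \<Rightarrow> complex"
  assumes hol: "f holomorphic_on {z. Im z > 0}" and p: "p \<ge> 1"
    and bound: "\<And>y. y > 0 \<Longrightarrow> (\<integral>\<^sup>+ x. ennreal (cmod (f (Complex x y)) powr p) \<partial>lborel) \<le> ennreal M"
    and \<epsilon>: "\<epsilon> > 0"
  shows "\<exists>C. \<forall>z. Im z \<ge> \<epsilon> \<longrightarrow> cmod (f z) \<le> C"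
proof -
  let ?U = "{z. Im z > 0}"
  have U: "open ?U" "convex ?U" by (simp_all add: open_halfspace_Im_gt convex_halfspace_Im_gt)
  have contf: "continuous_on ?U f" by (rule holomorphic_on_imp_continuous_on[OF hol])
  obtain \<Phi> where \<Phi>: "\<And>z. z \<in> ?U \<Longrightarrow> (\<Phi> has_field_derivative f z) (at z within ?U)"
    using holomorphic_convex_primitive'[OF U(2,1) hol] by blast
  have d\<Phi>: "(\<Phi> has_field_derivative f z) (at z)" if "Im z > 0" for z
    using \<Phi>[of z] that at_within_open[OF _ U(1), of z] by simp
  define N where "N = max M 0"
  \<comment> \<open>On a segment of length at most 1 the integral of |f| is at most that of 1 +
    |f|^p, uniformly in the height.\<close>
  have segment: "cmod (\<Phi> (z + of_real a) - \<Phi> z) \<le> 1 + N" if z: "Im z > 0" and a: "0 \<le> a" "a \<le> 1" for z a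
  proof -
    have C: "z + of_real t = Complex (Re z + t) (Im z)" for t by (simp add: complex_eq_iff)
    have cont: "continuous_on A (\<lambda>t. f (z + of_real t))" for A
      by (intro continuous_on_compose2[OF contf] continuous_intros) (use z in auto)
    have [measurable]: "(\<lambda>t. f (z + of_real t)) \<in> borel_measurable borel"
      by (rule borel_measurable_continuous_onI[OF cont])
    have "((\<lambda>t. \<Phi> (z + of_real t)) has_vector_derivative f (z + of_real t)) (at t within {0..a})" for t
    proof -
      have "((\<lambda>t. z + of_real t) has_vector_derivative 1) (at t within {0..a})"
        by (auto intro!: derivative_eq_intros)
      from field_vector_diff_chain_within[OF this has_field_derivative_at_within[OF d\<Phi>]]
      show ?thesis using z by (simp add: comp_def)
    qed
    then have hb: "has_bochner_integral lborel (\<lambda>t. indicator {0..a} t *\<^sub>R f (z + of_real t)) (\<Phi> (z + of_real a) - \<Phi> (z + of_real 0))"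
      by (intro has_bochner_integral_FTC_Icc a cont)
    have "ennreal (cmod (\<Phi> (z + of_real a) - \<Phi> z))
       = ennreal (norm (LINT t|lborel. indicator {0..a} t *\<^sub>R f (z + of_real t)))"
      using has_bochner_integral_integral_eq[OF hb] by simp
    also have "\<dots> \<le> (\<integral>\<^sup>+ t. ennreal (norm (indicator {0..a} t *\<^sub>R f (z + of_real t))) \<partial>lborel)"
      using hb by (intro integral_norm_bound_ennreal) (auto simp: has_bochner_integral_iff)
    also have "\<dots> \<le> (\<integral>\<^sup>+ t. indicator {0..1} t + ennreal (cmod (f (z + of_real t)) powr p) \<partial>lborel)"
    proof (rule nn_integral_mono)
      fix t
      have "ennreal (cmod (f (z + of_real t))) \<le> ennreal (1 + cmod (f (z + of_real t)) powr p)"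
        by (intro ennreal_leI le_one_plus_powr p) auto
      then show "ennreal (norm (indicator {0..a} t *\<^sub>R f (z + of_real t))) \<le> indicator {0..1} t + ennreal (cmod (f (z + of_real t)) powr p)"
        using a by (auto simp: indicator_def)
    qed
    also have "\<dots> = 1 + (\<integral>\<^sup>+ t. ennreal (cmod (f (z + of_real t)) powr p) \<partial>lborel)"
      by (subst nn_integral_add) auto
    also have "(\<integral>\<^sup>+ t. ennreal (cmod (f (z + of_real t)) powr p) \<partial>lborel)
        = (\<integral>\<^sup>+ x. ennreal (cmod (f (Complex x (Im z))) powr p) \<partial>lborel)"
    proof -
      have [measurable]: "(\<lambda>x. f (Complex x (Im z))) \<in> borel_measurable borel"
        by (intro borel_measurable_continuous_onI holomorphic_imp_continuous_line hol z)
      show ?thesis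
        using nn_integral_real_affine[of "\<lambda>x. ennreal (cmod (f (Complex x (Im z))) powr p)" 1 "Re z"] by (simp add: C)
    qed
    also have "\<dots> \<le> ennreal N"
      using bound[OF z] by (rule order.trans) (simp add: N_def ennreal_leI)
    finally have "ennreal (cmod (\<Phi> (z + of_real a) - \<Phi> z)) \<le> 1 + ennreal N" by (simp add: add_left_mono)
    also have "\<dots> = ennreal (1 + N)" by (simp add: N_def ennreal_plus[symmetric] del: ennreal_plus flip: ennreal_1)
    finally show ?thesis by (subst (asm) ennreal_le_iff) (simp_all add: N_def)
  qed
  \<comment> \<open>Cauchy's estimate on a disc of radius \<epsilon>/2, which stays in the open
    half-plane when its centre has height at least \<epsilon>.\<close>
  define K where "K = (1 + N) / (\<epsilon> / 2)"
  have osc: "cmod (f (z + of_real a) - f z) \<le> K" if z: "Im z \<ge> \<epsilon>" and a: "0 \<le> a" "a \<le> 1" for z a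
  proof -
    define \<Psi> where "\<Psi> = (\<lambda>w. \<Phi> (w + of_real a) - \<Phi> w)"
    have ball: "Im w > 0" if "w \<in> cball z (\<epsilon> / 2)" for w
      using that z \<epsilon> abs_Im_le_cmod[of "z - w"] by (auto simp: dist_norm)
    have d\<Psi>: "(\<Psi> has_field_derivative f (w + of_real a) - f w) (at w)" if "Im w > 0" for w
    proof -
      have "((\<lambda>w. \<Phi> (w + of_real a)) has_field_derivative f (w + of_real a) * 1) (at w)"
        by (rule DERIV_chain2[OF d\<Phi>]) (use that in \<open>auto intro!: derivative_eq_intros\<close>)
      then show ?thesis unfolding \<Psi>_def using d\<Phi>[OF that] by (auto intro!: derivative_eq_intros)
    qed
    have "cmod ((deriv ^^ 1) \<Psi> z) \<le> fact 1 * (1 + N) / (\<epsilon> / 2) ^ 1"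
    proof (rule Cauchy_inequality)
      show "\<Psi> holomorphic_on ball z (\<epsilon> / 2)"
        using d\<Psi> ball by (intro holomorphic_onI) (meson ball_subset_cball field_differentiable_at_within field_differentiable_def subsetD)
      show "continuous_on (cball z (\<epsilon> / 2)) \<Psi>"
        using d\<Psi> ball by (intro continuous_at_imp_continuous_on ballI) (meson DERIV_isCont)
      show "cmod (\<Psi> w) \<le> 1 + N" if "cmod (z - w) = \<epsilon> / 2" for w
        unfolding \<Psi>_def by (rule segment) (use that a ball[of w] in \<open>auto simp: dist_norm\<close>)
    qed (use \<epsilon> in auto)
    moreover have "deriv \<Psi> z = f (z + of_real a) - f z" by (rule DERIV_imp_deriv[OF d\<Psi>]) (use z \<epsilon> in simp)
    ultimately show ?thesis by (simp add: K_def)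
  qed
  have "cmod (f z) \<le> 1 + N + K" if z: "Im z \<ge> \<epsilon>" for z
  proof -
    have seg: "\<exists>a. 0 \<le> a \<and> a \<le> 1 \<and> w = z + of_real a" if "w \<in> closed_segment z (z + 1)" for w
      using that by (auto simp: closed_segment_def algebra_simps scaleR_conv_of_real)
    \<comment> \<open>The difference of \<open>\<Phi>\<close> over the unit segment is the mean of
      \<open>f\<close> there. Subtracting w f(z) leaves a function with derivative f(w) - f(z), so
      the oscillation bound compares this mean with f(z).\<close>
    have "cmod ((\<Phi> (z + 1) - (z + 1) * f z) - (\<Phi> z - z * f z)) \<le> K * cmod ((z + 1) - z)"
    proof (rule field_differentiable_bound[OF convex_closed_segment[of z "z + 1"]])
      fix w assume w: "w \<in> closed_segment z (z + 1)"
      obtain a where a: "0 \<le> a" "a \<le> 1" "w = z + of_real a" using seg[OF w] by blast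
      show "((\<lambda>w. \<Phi> w - w * f z) has_field_derivative f w - f z) (at w within closed_segment z (z + 1))"
      proof (rule has_field_derivative_at_within)
        have "(\<Phi> has_field_derivative f w) (at w)" by (rule d\<Phi>) (use a z \<epsilon> in simp)
        then show "((\<lambda>w. \<Phi> w - w * f z) has_field_derivative f w - f z) (at w)"
          by (auto intro!: derivative_eq_intros)
      qed
      show "cmod (f w - f z) \<le> K" unfolding a(3) by (rule osc[OF z a(1,2)])
    qed auto
    then have "cmod ((\<Phi> (z + 1) - \<Phi> z) - f z) \<le> K" by (simp add: algebra_simps)
    moreover have "cmod (\<Phi> (z + 1) - \<Phi> z) \<le> 1 + N" using segment[of z 1] z \<epsilon> by simp
    ultimately show ?thesis
      using norm_triangle_sub[of "f z" "\<Phi> (z + 1) - \<Phi> z"] norm_minus_commute[of "f z" "\<Phi> (z + 1) - \<Phi> z"] by linarith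
  qed
  then show ?thesis by blast
qed

text \<open>The factor vanishes only at -\<i>/\<delta>, below the real line. In the upper half-plane
  its modulus is at least 1 and grows linearly, and the inverse square is dominated by the Poisson
  kernel of height 1/\<delta>.\<close>

lemma damping_factor:
  assumes "\<delta> > 0" "Im z \<ge> 0"
  shows "1 \<le> cmod (1 - \<i> * of_real \<delta> * z)"
    and "1 / (cmod (1 - \<i> * of_real \<delta> * z))\<^sup>2 \<le> pi / \<delta> * poisson (1 / \<delta>) (0 - Re z)"
    and "1 + cmod z \<le> (2 + \<delta>) / \<delta> * cmod (1 - \<i> * of_real \<delta> * z)"
proof -
  have sq: "(cmod (1 - \<i> * of_real \<delta> * z))\<^sup>2 = (1 + \<delta> * Im z)\<^sup>2 + (\<delta> * Re z)\<^sup>2"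
    by (simp add: cmod_power2)
  have ge: "1 + (\<delta> * Re z)\<^sup>2 \<le> (cmod (1 - \<i> * of_real \<delta> * z))\<^sup>2"
    unfolding sq using assms by (simp add: one_le_power)
  have "1 \<le> (cmod (1 - \<i> * of_real \<delta> * z))\<^sup>2" by (rule order.trans[OF _ ge]) simp
  then show 1: "1 \<le> cmod (1 - \<i> * of_real \<delta> * z)"
    using power2_le_imp_le[of 1 "cmod (1 - \<i> * of_real \<delta> * z)"] by simp
  have "1 / (cmod (1 - \<i> * of_real \<delta> * z))\<^sup>2 \<le> 1 / (1 + (\<delta> * Re z)\<^sup>2)"
    by (intro divide_left_mono ge mult_pos_pos) (use 1 in \<open>auto intro: add_pos_nonneg\<close>)
  also have "\<dots> = pi / \<delta> * poisson (1 / \<delta>) (0 - Re z)"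
  proof -
    have "1 + (\<delta> * x)\<^sup>2 = \<delta>\<^sup>2 * (x\<^sup>2 + (1 / \<delta>)\<^sup>2)" for x
      using assms by (simp add: power2_eq_square field_simps)
    then show ?thesis using assms by (simp add: poisson_def power2_eq_square)
  qed
  finally show "1 / (cmod (1 - \<i> * of_real \<delta> * z))\<^sup>2 \<le> pi / \<delta> * poisson (1 / \<delta>) (0 - Re z)" .
  have eq: "1 - \<i> * of_real \<delta> * z = - \<i> * of_real \<delta> * (z - (- \<i> / of_real \<delta>))"
    using assms by (simp add: algebra_simps)
  have n: "cmod (1 - \<i> * of_real \<delta> * z) = \<delta> * cmod (z - (- \<i> / of_real \<delta>))"
    unfolding eq norm_mult using assms by simp
  have d: "1 / \<delta> \<le> cmod (z - (- \<i> / of_real \<delta>))"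
    using 1 assms unfolding n by (simp add: divide_le_eq mult.commute)
  have "1 + cmod z \<le> ((1 + cmod (- \<i> / of_real \<delta>) + 1 / \<delta>) / (1 / \<delta>)) * cmod (z - (- \<i> / of_real \<delta>))"
    by (rule one_plus_norm_le_dist[OF _ d]) (use assms in simp)
  also have "(1 + cmod (- \<i> / of_real \<delta>) + 1 / \<delta>) / (1 / \<delta>) = (2 + \<delta>) / \<delta> * \<delta>"
    using assms by (simp add: norm_divide field_simps)
  finally show "1 + cmod z \<le> (2 + \<delta>) / \<delta> * cmod (1 - \<i> * of_real \<delta> * z)"
    unfolding n by (simp only: mult.assoc)
qed

text \<open>Boundedness above each height times the inverse square of the factor gives the decay.
  For the L^1 bound, |f| k <= (1 + |f|^p) k with the weight k = |1 - \<i> \<delta> z|^(-2) <= 1,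
  whose integral over any line is at most pi/\<delta>.\<close>

lemma hardy_decay_damped:
  fixes f :: "complex \<Rightarrow> complex"
  assumes hol: "f holomorphic_on {z. Im z > 0}" and p: "p \<ge> 1"
    and bound: "\<And>y. y > 0 \<Longrightarrow> (\<integral>\<^sup>+ x. ennreal (cmod (f (Complex x y)) powr p) \<partial>lborel) \<le> ennreal M"
    and \<delta>: "\<delta> > 0"
  shows "hardy_decay (\<lambda>z. f z / (1 - \<i> * of_real \<delta> * z)\<^sup>2) (max M 0 + pi / \<delta>)"
proof
  have nz: "1 - \<i> * of_real \<delta> * z \<noteq> 0" if "Im z \<ge> 0" for z
    using damping_factor(1)[OF \<delta> that] by auto
  show "(\<lambda>z. f z / (1 - \<i> * of_real \<delta> * z)\<^sup>2) holomorphic_on {z. Im z > 0}"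
    by (intro holomorphic_intros hol) (use nz in auto)
  fix \<epsilon> :: real assume \<epsilon>: "\<epsilon> > 0"
  obtain C where C: "\<And>z. Im z \<ge> \<epsilon> \<Longrightarrow> cmod (f z) \<le> C"
    using hardy_bounded_above_height[OF hol p bound \<epsilon>] by blast
  have C0: "C \<ge> 0" using order.trans[OF norm_ge_zero C[of "\<i> * of_real \<epsilon>"]] by simp
  have "cmod (f z / (1 - \<i> * of_real \<delta> * z)\<^sup>2) \<le> (C * ((2 + \<delta>) / \<delta>)\<^sup>2) / (1 + cmod z)\<^sup>2" if z: "Im z \<ge> \<epsilon>" for z
  proof -
    define a where "a = cmod (1 - \<i> * of_real \<delta> * z)"
    define k where "k = (2 + \<delta>) / \<delta>"
    have a: "a \<ge> 1" "1 + cmod z \<le> k * a"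
      using damping_factor(1,3)[OF \<delta>, of z] z \<epsilon> by (auto simp: a_def k_def)
    have sq: "(1 + cmod z)\<^sup>2 \<le> (k * a)\<^sup>2" by (intro power_mono a) simp
    have "cmod (f z) / a\<^sup>2 \<le> C / a\<^sup>2" by (intro divide_right_mono C z) simp
    also have "\<dots> \<le> (C * k\<^sup>2) / (1 + cmod z)\<^sup>2"
    proof -
      have "C * (1 + cmod z)\<^sup>2 \<le> C * (k * a)\<^sup>2" by (intro mult_left_mono sq C0)
      moreover have "1 + cmod z > 0" by (simp add: add_pos_nonneg)
      ultimately show ?thesis using a(1) by (simp add: frac_le_eq divide_simps power_mult_distrib mult_ac)
    qed
    finally show ?thesis by (simp add: norm_divide norm_power a_def k_def)
  qed
  then show "\<exists>C. \<forall>z. Im z \<ge> \<epsilon> \<longrightarrow> cmod (f z / (1 - \<i> * of_real \<delta> * z)\<^sup>2) \<le> C / (1 + cmod z)\<^sup>2" by blast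
next
  fix y :: real assume y: "y > 0"
  have [measurable]: "(\<lambda>x. f (Complex x y)) \<in> borel_measurable borel"
    by (intro borel_measurable_continuous_onI holomorphic_imp_continuous_line hol y)
  have "(\<integral>\<^sup>+ x. ennreal (cmod (f (Complex x y) / (1 - \<i> * of_real \<delta> * Complex x y)\<^sup>2)) \<partial>lborel)
     \<le> (\<integral>\<^sup>+ x. ennreal (cmod (f (Complex x y)) powr p) + ennreal (pi / \<delta>) * ennreal (poisson (1 / \<delta>) (0 - x)) \<partial>lborel)"
  proof (rule nn_integral_mono)
    fix x
    define \<kappa> where "\<kappa> = 1 / (cmod (1 - \<i> * of_real \<delta> * Complex x y))\<^sup>2"
    have \<kappa>: "\<kappa> \<ge> 0" "\<kappa> \<le> 1" "\<kappa> \<le> pi / \<delta> * poisson (1 / \<delta>) (0 - x)"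
      using damping_factor(2)[OF \<delta>, of "Complex x y"] y
        one_le_power[OF damping_factor(1)[OF \<delta>, of "Complex x y"], of 2]
      by (auto simp: \<kappa>_def divide_le_eq_1)
    have "cmod (f (Complex x y)) * \<kappa> \<le> (1 + cmod (f (Complex x y)) powr p) * \<kappa>"
      by (intro mult_right_mono le_one_plus_powr p \<kappa>) auto
    also have "\<dots> \<le> cmod (f (Complex x y)) powr p + pi / \<delta> * poisson (1 / \<delta>) (0 - x)"
      using \<kappa> mult_left_mono[OF \<kappa>(2), of "cmod (f (Complex x y)) powr p"] by (simp add: algebra_simps)
    finally have "cmod (f (Complex x y) / (1 - \<i> * of_real \<delta> * Complex x y)\<^sup>2)
       \<le> cmod (f (Complex x y)) powr p + pi / \<delta> * poisson (1 / \<delta>) (0 - x)"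
      by (simp add: \<kappa>_def norm_divide norm_power)
    then have "ennreal (cmod (f (Complex x y) / (1 - \<i> * of_real \<delta> * Complex x y)\<^sup>2))
      \<le> ennreal (cmod (f (Complex x y)) powr p + pi / \<delta> * poisson (1 / \<delta>) (0 - x))" by (rule ennreal_leI)
    also have "\<dots> = ennreal (cmod (f (Complex x y)) powr p) + ennreal (pi / \<delta>) * ennreal (poisson (1 / \<delta>) (0 - x))"
    proof -
      have "ennreal (pi / \<delta> * poisson (1 / \<delta>) (0 - x)) = ennreal (pi / \<delta>) * ennreal (poisson (1 / \<delta>) (0 - x))"
        by (rule ennreal_mult) (use \<delta> in auto)
      then show ?thesis using \<delta> by (subst ennreal_plus) (simp_all only: powr_ge_zero poisson_nonneg
          mult_nonneg_nonneg divide_nonneg_pos pi_ge_zero zero_less_divide_1_iff)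
    qed
    finally show "ennreal (cmod (f (Complex x y) / (1 - \<i> * of_real \<delta> * Complex x y)\<^sup>2))
      \<le> ennreal (cmod (f (Complex x y)) powr p) + ennreal (pi / \<delta>) * ennreal (poisson (1 / \<delta>) (0 - x))" .
  qed
  also have "\<dots> = (\<integral>\<^sup>+ x. ennreal (cmod (f (Complex x y)) powr p) \<partial>lborel) + ennreal (pi / \<delta>) * 1"
    using \<delta> by (subst nn_integral_add) (simp_all add: nn_integral_cmult nn_integral_poisson del: diff_0)
  also have "\<dots> \<le> ennreal (max M 0) + ennreal (pi / \<delta>)"
    using order.trans[OF bound[OF y] ennreal_leI[of M "max M 0"]] by (simp add: add_right_mono)
  also have "\<dots> = ennreal (max M 0 + pi / \<delta>)" using \<delta> by (intro ennreal_plus[symmetric]) auto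
  finally show "(\<integral>\<^sup>+ x. ennreal (cmod (f (Complex x y) / (1 - \<i> * of_real \<delta> * Complex x y)\<^sup>2)) \<partial>lborel)
     \<le> ennreal (max M 0 + pi / \<delta>)" .
qed

text \<open>Damping reduces to the case p = 1 for each \<delta>. All the damped boundary functions
  come from a single \<open>h\<close>, which is in L^p by Fatou's lemma and hence Cauchy integrable.
  As the factor has modulus at least 1, \<open>h\<close> itself provides the domination for letting
  \<delta> tend to 0.\<close>

theorem hardy_Cauchy_formula:
  fixes f :: "complex \<Rightarrow> complex"
  assumes hol: "f holomorphic_on {z. Im z > 0}" and p: "p \<ge> 1"
    and bound: "\<And>y. y > 0 \<Longrightarrow> (\<integral>\<^sup>+ x. ennreal (cmod (f (Complex x y)) powr p) \<partial>lborel) \<le> ennreal M"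
  shows "\<exists>h. cauchy_integrable h \<and> (AE x in lborel. has_nt_limit f x (h x)) \<and>
    (\<forall>z. Im z > 0 \<longrightarrow> cauchy_int h z = 2 * of_real pi * \<i> * f z) \<and>
    (\<forall>z. Im z < 0 \<longrightarrow> cauchy_int h z = 0)"
proof -
  define \<kappa> where "\<kappa> = (\<lambda>\<delta> z. (1 - \<i> * complex_of_real \<delta> * z)\<^sup>2)"
  have \<kappa>0: "\<kappa> \<delta> z \<noteq> 0" if "\<delta> > 0" "Im z \<ge> 0" for \<delta> z
    using damping_factor(1)[OF that] by (auto simp: \<kappa>_def)
  have cont\<kappa>: "continuous (at z) (\<kappa> \<delta>)" for \<delta> z unfolding \<kappa>_def by (intro continuous_intros)
  define Q where "Q = (\<lambda>\<delta> h. h \<in> borel_measurable borel \<and> integrable lborel h \<and>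
      (AE x in lborel. has_nt_limit (\<lambda>z. f z / \<kappa> \<delta> z) x (h x)) \<and>
      (\<forall>z. Im z > 0 \<longrightarrow> f z / \<kappa> \<delta> z = poisson_ext h z) \<and> (\<forall>z. Im z < 0 \<longrightarrow> cauchy_int h z = 0))"
  have "\<exists>h. Q \<delta> h" if "\<delta> > 0" for \<delta>
    unfolding Q_def \<kappa>_def by (rule hardy_decay.boundary[OF hardy_decay_damped[OF hol p bound that]])
  then obtain hd where Q: "\<And>\<delta>. \<delta> > 0 \<Longrightarrow> Q \<delta> (hd \<delta>)" by metis
  have hd: "\<And>\<delta>. \<delta> > 0 \<Longrightarrow> hd \<delta> \<in> borel_measurable borel"
    "\<And>\<delta>. \<delta> > 0 \<Longrightarrow> integrable lborel (hd \<delta>)"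
    "\<And>\<delta>. \<delta> > 0 \<Longrightarrow> AE x in lborel. has_nt_limit (\<lambda>z. f z / \<kappa> \<delta> z) x (hd \<delta> x)"
    "\<And>\<delta> z. \<delta> > 0 \<Longrightarrow> Im z > 0 \<Longrightarrow> f z / \<kappa> \<delta> z = poisson_ext (hd \<delta>) z"
    "\<And>\<delta> z. \<delta> > 0 \<Longrightarrow> Im z < 0 \<Longrightarrow> cauchy_int (hd \<delta>) z = 0"
    using Q unfolding Q_def by blast+
  \<comment> \<open>Any fixed \<delta> would serve to undo the damping; \<delta> = 1 is
    taken.\<close>
  define h where "h = (\<lambda>x. hd 1 x * \<kappa> 1 (of_real x))"
  have m\<kappa>[measurable]: "(\<lambda>x. \<kappa> \<delta> (complex_of_real x)) \<in> borel_measurable borel" for \<delta>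
    unfolding \<kappa>_def by measurable
  have h[measurable]: "h \<in> borel_measurable borel"
    unfolding h_def using hd(1)[of 1] by measurable
  have nt: "AE x in lborel. has_nt_limit f x (h x)"
    using hd(3)[OF zero_less_one]
  proof eventually_elim
    case (elim x)
    have "has_nt_limit (\<lambda>z. f z / \<kappa> 1 z * \<kappa> 1 z) x (hd 1 x * \<kappa> 1 (of_real x))"
      by (intro has_nt_limit_mult elim has_nt_limit_isCont cont\<kappa>)
    then show ?case unfolding h_def
      by (rule has_nt_limit_cong) (use \<kappa>0[of 1] in auto)
  qed
  have e: "\<And>n. 1 / real (Suc n) > 0" "(\<lambda>n. 1 / real (Suc n)) \<longlonglongrightarrow> 0"
    using LIMSEQ_inverse_real_of_nat by (auto simp: inverse_eq_divide)
  have fm[measurable]: "(\<lambda>x. f (Complex x (1 / real (Suc n)))) \<in> borel_measurable borel" for n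
    by (intro borel_measurable_continuous_onI holomorphic_imp_continuous_line hol) simp
  have "(\<integral>\<^sup>+ s. ennreal (cmod (h s) powr p) \<partial>lborel)
     = (\<integral>\<^sup>+ s. liminf (\<lambda>n. ennreal (cmod (f (Complex s (1 / real (Suc n)))) powr p)) \<partial>lborel)"
  proof (intro nn_integral_cong_AE, use nt in eventually_elim)
    case (elim s)
    have "(\<lambda>n. ennreal (cmod (f (Complex s (1 / real (Suc n)))) powr p)) \<longlonglongrightarrow> ennreal (cmod (h s) powr p)"
      using has_nt_limit_vertical[OF elim e] p
      by (intro tendsto_ennrealI tendsto_powr' tendsto_norm tendsto_const) auto
    then show ?case by (intro lim_imp_Liminf[symmetric]) simp_all
  qed
  also have "\<dots> \<le> liminf (\<lambda>n. \<integral>\<^sup>+ s. ennreal (cmod (f (Complex s (1 / real (Suc n)))) powr p) \<partial>lborel)"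
    by (rule nn_integral_liminf) measurable
  also have "\<dots> \<le> ennreal M"
    by (rule Liminf_le) (auto intro!: always_eventually bound)
  also have "\<dots> < \<infinity>" by simp
  finally have hp: "(\<integral>\<^sup>+ s. ennreal (cmod (h s) powr p) \<partial>lborel) < \<infinity>" .
  have ci: "cauchy_integrable h" by (rule Lp_cauchy_integrable[OF h p hp])
  \<comment> \<open>The boundary functions for different \<delta> were chosen independently;
    uniqueness of nontangential limits ties them together.\<close>
  have hd_eq: "AE x in lborel. hd \<delta> x = h x / \<kappa> \<delta> (of_real x)" if \<delta>: "\<delta> > 0" for \<delta>
    using hd(3)[OF \<delta>] nt
  proof eventually_elim
    case (elim x)
    have "isCont (\<lambda>z. 1 / \<kappa> \<delta> z) (of_real x)"
      by (intro continuous_intros cont\<kappa>) (use \<kappa>0[OF \<delta>, of "of_real x"] in simp)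
    then have "has_nt_limit (\<lambda>z. f z * (1 / \<kappa> \<delta> z)) x (h x * (1 / \<kappa> \<delta> (of_real x)))"
      by (intro has_nt_limit_mult elim has_nt_limit_isCont)
    then show ?case using has_nt_limit_unique[OF elim(1)] by simp
  qed
  have cd: "cauchy_int (hd \<delta>) z = (LINT s|lborel. h s / \<kappa> \<delta> (of_real s) / (of_real s - z))" if \<delta>: "\<delta> > 0" for \<delta> z
    unfolding cauchy_int_def
    by (rule integral_cong_AE) (use hd(1)[OF \<delta>] hd_eq[OF \<delta>] in \<open>auto elim: eventually_mono\<close>)
  have lim: "(\<lambda>n. cauchy_int (hd (1 / real (Suc n))) z) \<longlonglongrightarrow> cauchy_int h z" if z: "Im z \<noteq> 0" for z
    unfolding cd[OF e(1)] unfolding cauchy_int_def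
  proof (rule integral_dominated_convergence[where w = "\<lambda>s. cmod (h s / (of_real s - z))"])
    show "integrable lborel (\<lambda>s. cmod (h s / (of_real s - z)))"
      by (intro integrable_norm cauchy_integrableD ci z)
    show "AE s in lborel. (\<lambda>n. h s / \<kappa> (1 / real (Suc n)) (of_real s) / (of_real s - z)) \<longlonglongrightarrow> h s / (of_real s - z)"
    proof (rule AE_I2)
      fix s
      have "(\<lambda>n. \<kappa> (1 / real (Suc n)) (of_real s)) \<longlonglongrightarrow> \<kappa> 0 (of_real s)"
        unfolding \<kappa>_def by (intro tendsto_intros e(2))
      then have "(\<lambda>n. h s / \<kappa> (1 / real (Suc n)) (of_real s) / (of_real s - z)) \<longlonglongrightarrow> h s / \<kappa> 0 (of_real s) / (of_real s - z)"
        using real_minus_nonreal_nonzero[OF z, of s] by (intro tendsto_intros) (auto simp: \<kappa>_def)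
      then show "(\<lambda>n. h s / \<kappa> (1 / real (Suc n)) (of_real s) / (of_real s - z)) \<longlonglongrightarrow> h s / (of_real s - z)"
        by (simp add: \<kappa>_def)
    qed
    show "AE s in lborel. norm (h s / \<kappa> (1 / real (Suc n)) (of_real s) / (of_real s - z)) \<le> cmod (h s / (of_real s - z))" for n
    proof (rule AE_I2)
      fix s
      define a where "a = cmod (1 - \<i> * complex_of_real (1 / real (Suc n)) * complex_of_real s)"
      have "1 \<le> a" unfolding a_def by (rule damping_factor(1)[OF e(1)]) simp
      then have "cmod (h s / (of_real s - z)) / a\<^sup>2 \<le> cmod (h s / (of_real s - z)) / 1"
        by (intro divide_left_mono one_le_power) auto
      then show "norm (h s / \<kappa> (1 / real (Suc n)) (of_real s) / (of_real s - z)) \<le> cmod (h s / (of_real s - z))"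
        unfolding \<kappa>_def norm_divide norm_power a_def by (simp add: mult.commute)
    qed
  qed measurable
  have upper: "cauchy_int h z = 2 * of_real pi * \<i> * f z" if z: "Im z > 0" for z
  proof -
    have "cauchy_int (hd \<delta>) z = 2 * of_real pi * \<i> * (f z / \<kappa> \<delta> z)" if \<delta>: "\<delta> > 0" for \<delta>
    proof -
      have "(\<integral>\<^sup>+ s. ennreal (cmod (hd \<delta> s) powr 1) \<partial>lborel) < \<infinity>"
        using hd(2)[OF \<delta>] by (simp add: integrable_iff_bounded)
      then have "cauchy_integrable (hd \<delta>)" by (intro Lp_cauchy_integrable[where p = 1] hd(1) \<delta>) auto
      from cauchy_int_diff_eq_poisson_ext[OF this z] show ?thesis
        using hd(4)[OF \<delta> z] hd(5)[OF \<delta>, of "cnj z"] z by simp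
    qed
    then have "(\<lambda>n. cauchy_int (hd (1 / real (Suc n))) z) = (\<lambda>n. 2 * of_real pi * \<i> * (f z / \<kappa> (1 / real (Suc n)) z))"
      using e(1) by blast
    moreover have "(\<lambda>n. 2 * of_real pi * \<i> * (f z / \<kappa> (1 / real (Suc n)) z)) \<longlonglongrightarrow> 2 * of_real pi * \<i> * (f z / \<kappa> 0 z)"
      unfolding \<kappa>_def by (intro tendsto_intros e(2)) auto
    ultimately show ?thesis using LIMSEQ_unique[OF lim, of z] z by (simp add: \<kappa>_def)
  qed
  have "cauchy_int h z = 0" if z: "Im z < 0" for z
    using LIMSEQ_unique[OF lim, of z 0] hd(5)[OF e(1) z] z by simp
  with ci nt upper show ?thesis by blast
qed

theorem Cauchy_integral_hardy:
  fixes h :: "real \<Rightarrow> complex"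
  assumes h[measurable]: "h \<in> borel_measurable borel" and p: "p \<ge> 1"
    and hp: "(\<integral>\<^sup>+ s. ennreal (cmod (h s) powr p) \<partial>lborel) < \<infinity>"
    and zero: "\<And>z. Im z < 0 \<Longrightarrow> cauchy_int h z = 0"
  shows "(\<lambda>z. 1 / (2 * of_real pi * \<i>) * cauchy_int h z) \<in> hardy p"
    and "AE x in lborel. has_nt_limit (\<lambda>z. 1 / (2 * of_real pi * \<i>) * cauchy_int h z) x (h x)"
proof -
  have ci: "cauchy_integrable h" by (rule Lp_cauchy_integrable[OF h p hp])
  have eq: "1 / (2 * of_real pi * \<i>) * cauchy_int h z = poisson_ext h z" if "Im z > 0" for z
    using cauchy_int_diff_eq_poisson_ext[OF ci that] zero[of "cnj z"] that by simp
  have "(SUP y\<in>{0<..}. \<integral>\<^sup>+ x. ennreal (cmod (1 / (2 * of_real pi * \<i>) * cauchy_int h (Complex x y)) powr p) \<partial>lebesgue)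
      \<le> (\<integral>\<^sup>+ s. ennreal (cmod (h s) powr p) \<partial>lborel)"
  proof (rule SUP_least)
    fix y :: real assume y: "y \<in> {0<..}"
    then have "(\<integral>\<^sup>+ x. ennreal (cmod (1 / (2 * of_real pi * \<i>) * cauchy_int h (Complex x y)) powr p) \<partial>lebesgue)
        = (\<integral>\<^sup>+ x. ennreal (cmod (poisson_ext h (Complex x y)) powr p) \<partial>lborel)"
      unfolding nn_integral_completion by (subst eq) auto
    also have "\<dots> \<le> (\<integral>\<^sup>+ s. ennreal (cmod (h s) powr p) \<partial>lborel)"
      using y by (intro poisson_Lp_contraction h p hp) auto
    finally show "(\<integral>\<^sup>+ x. ennreal (cmod (1 / (2 * of_real pi * \<i>) * cauchy_int h (Complex x y)) powr p) \<partial>lebesgue)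
        \<le> (\<integral>\<^sup>+ s. ennreal (cmod (h s) powr p) \<partial>lborel)" .
  qed
  moreover have "(\<lambda>z. 1 / (2 * of_real pi * \<i>) * cauchy_int h z) holomorphic_on {z. Im z > 0}"
    by (intro holomorphic_intros cauchy_int_holomorphic ci) auto
  ultimately show "(\<lambda>z. 1 / (2 * of_real pi * \<i>) * cauchy_int h z) \<in> hardy p"
    unfolding hardy_def using hp by (auto intro: le_less_trans)
  show "AE x in lborel. has_nt_limit (\<lambda>z. 1 / (2 * of_real pi * \<i>) * cauchy_int h z) x (h x)"
    using Fatou_poisson[OF cauchy_integrable_imp_poisson_integrable[OF ci]]
    by eventually_elim (erule has_nt_limit_cong, simp only: eq)
qed

section \<open>From Borel functions to Lebesgue measure and to the hyperbolic plane\<close>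

lemma integral_lebesgue_AE_eq:
  fixes G G' :: "real \<Rightarrow> complex"
  assumes G': "G' \<in> borel_measurable borel" and eq: "AE s in lborel. G s = G' s"
  shows "integrable lebesgue G \<longleftrightarrow> integrable lborel G'" "(LINT s|lebesgue. G s) = (LINT s|lborel. G' s)"
proof -
  have G'l: "G' \<in> borel_measurable lebesgue" using G' by (intro measurable_completion) simp
  have eql: "AE s in lebesgue. G s = G' s" using eq by (rule AE_completion)
  \<comment> \<open>By completeness every part of the null set where \<open>G\<close> differs from
    \<open>G'\<close> is measurable. This covers \<open>nt_boundary\<close>, which is unspecified on
    an exceptional null set.\<close>
  have Gl: "G \<in> borel_measurable lebesgue"
  proof (rule measurableI)
    fix B :: "complex set" assume B: "B \<in> sets borel"
    have "Measurable.pred lebesgue (\<lambda>s. G s \<noteq> G' s \<and> G s \<in> B)"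
      by (rule sets_completion_AE) (use eq in eventually_elim, simp)
    moreover have "Measurable.pred lebesgue (\<lambda>s. G s \<noteq> G' s)"
      by (rule sets_completion_AE) (use eq in eventually_elim, simp)
    moreover have "G' -` B \<inter> space lebesgue \<in> sets lebesgue"
      by (rule measurable_sets[OF G'l B])
    ultimately have "{s. G s \<noteq> G' s \<and> G s \<in> B} \<union> (G' -` B - {s. G s \<noteq> G' s}) \<in> sets lebesgue"
      by (intro sets.Un sets.Diff) (simp_all add: pred_def)
    also have "{s. G s \<noteq> G' s \<and> G s \<in> B} \<union> (G' -` B - {s. G s \<noteq> G' s}) = G -` B \<inter> space lebesgue" by auto
    finally show "G -` B \<inter> space lebesgue \<in> sets lebesgue" .
  qed simp
  show "integrable lebesgue G \<longleftrightarrow> integrable lborel G'"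
    using integrable_cong_AE[OF Gl G'l eql] integrable_completion[of G' lborel] G' by simp
  show "(LINT s|lebesgue. G s) = (LINT s|lborel. G' s)"
    using integral_cong_AE[OF Gl G'l eql] integral_completion[of G' lborel] G' by simp
qed

lemma lebesgue_measurable_AE_borel:
  fixes H :: "real \<Rightarrow> complex"
  assumes "H \<in> borel_measurable lebesgue"
  obtains h where "h \<in> borel_measurable borel" "AE s in lborel. H s = h s"
proof -
  have "(\<lambda>s. Re (H s)) \<in> borel_measurable lebesgue" "(\<lambda>s. Im (H s)) \<in> borel_measurable lebesgue"
    using assms by measurable
  then obtain a b where ab: "a \<in> borel_measurable lborel" "AE s in lborel. Re (H s) = a s"
      "b \<in> borel_measurable lborel" "AE s in lborel. Im (H s) = b s"
    using completion_ex_borel_measurable_real by metis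
  show thesis
  proof
    have "(\<lambda>s. of_real (a s) + \<i> * of_real (b s)) \<in> borel_measurable lborel" using ab(1,3) by measurable
    then show "(\<lambda>s. of_real (a s) + \<i> * of_real (b s)) \<in> borel_measurable borel" by simp
    show "AE s in lborel. H s = of_real (a s) + \<i> * of_real (b s)"
      using ab(2,4) by eventually_elim (simp add: complex_eq_iff)
  qed
qed

text \<open>The exceptional set is enlarged to a Borel null set \<open>N\<close>. For c nonzero each
  slice of the preimage of \<open>N\<close> under (x, y) |-> x + c y is an affine image of
  \<open>N\<close>, so the preimage is null by Fubini; c = 1 and c = -1 give the two idempotent
  components.\<close>

lemma AE_hyperbolic:
  assumes P: "AE s in lborel. P s" and Q: "AE s in lborel. Q (s :: real)"
  shows "AE (x, y) in lebesgue. P (x + y) \<and> Q (x - y)"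
proof -
  have *: "AE z in lborel. R (fst z + c * snd z)" if R: "AE s in lborel. R s" and c: "c \<noteq> 0" for R and c :: real
  proof -
    obtain N where N: "N \<in> null_sets lborel" "{s. \<not> R s} \<subseteq> N"
      using R by (auto elim!: AE_E simp: null_sets_def)
    have [measurable]: "N \<in> sets borel" using N(1) by auto
    have "AE s in lborel. s \<notin> N" by (rule AE_not_in[OF N(1)])
    then have "AE y in lborel. x + c * y \<notin> N" for x
      using c by (intro AE_borel_affine[where P = "\<lambda>s. s \<notin> N"]) auto
    then have "AE z in lborel \<Otimes>\<^sub>M lborel. fst z + c * snd z \<notin> N"
    proof (intro lborel_pair.AE_pair_measure)
      have "(\<lambda>z. fst z + c * snd z) -` (- N) \<inter> space (lborel \<Otimes>\<^sub>M lborel) \<in> sets (lborel \<Otimes>\<^sub>M lborel)"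
        by (rule measurable_sets[where A = borel]) auto
      moreover have "(\<lambda>z. fst z + c * snd z) -` (- N) \<inter> space (lborel \<Otimes>\<^sub>M lborel)
          = {z \<in> space (lborel \<Otimes>\<^sub>M lborel). fst z + c * snd z \<notin> N}" by auto
      ultimately show "{z \<in> space (lborel \<Otimes>\<^sub>M lborel). fst z + c * snd z \<notin> N} \<in> sets (lborel \<Otimes>\<^sub>M lborel)"
        by simp
    qed simp
    then have "AE z in (lborel :: (real \<times> real) measure). fst z + c * snd z \<notin> N"
      by (simp only: lborel_prod)
    then show ?thesis by eventually_elim (use N(2) in auto)
  qed
  have "AE z in lborel. P (fst z + 1 * snd z)" by (rule *[OF P]) simp
  moreover have "AE z in lborel. Q (fst z + (- 1) * snd z)" by (rule *[OF Q]) simp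
  ultimately have "AE z in (lborel :: (real \<times> real) measure). P (fst z + snd z) \<and> Q (fst z - snd z)"
    by eventually_elim simp
  then have "AE z in (lebesgue :: (real \<times> real) measure). P (fst z + snd z) \<and> Q (fst z - snd z)"
    by (rule AE_completion)
  then show ?thesis by (simp add: split_beta')
qed

text \<open>\<phi> stands for a component of a bicomplex \<open>F\<close>, which agrees with a Hardy
  function only in the upper half-plane and is arbitrary elsewhere. Nontangential limits see only
  the upper half-plane.\<close>

lemma hardy_boundary_integrals:
  assumes f: "f \<in> hardy p" and p: "p \<ge> 1" and \<phi>: "\<forall>z. Im z > 0 \<longrightarrow> \<phi> z = f z"
  shows "AE s in lborel. \<exists>L. has_nt_limit \<phi> s L"
    and "Im z \<noteq> 0 \<Longrightarrow> integrable lebesgue (\<lambda>s. nt_boundary \<phi> s / (of_real s - z))"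
    and "Im z > 0 \<Longrightarrow> (LINT s|lebesgue. nt_boundary \<phi> s / (of_real s - z)) = 2 * of_real pi * \<i> * \<phi> z"
    and "Im z < 0 \<Longrightarrow> (LINT s|lebesgue. nt_boundary \<phi> s / (of_real s - z)) = 0"
proof -
  define S where "S = (SUP y\<in>{0<..}. \<integral>\<^sup>+ x. ennreal (cmod (f (Complex x y)) powr p) \<partial>lebesgue)"
  have S: "S < \<infinity>" and hol: "f holomorphic_on {z. Im z > 0}" using f by (auto simp: hardy_def S_def)
  have "(\<integral>\<^sup>+ x. ennreal (cmod (f (Complex x y)) powr p) \<partial>lborel) \<le> ennreal (enn2real S)" if "y > 0" for y
  proof -
    have "(\<integral>\<^sup>+ x. ennreal (cmod (f (Complex x y)) powr p) \<partial>lborel) \<le> S"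
      unfolding S_def nn_integral_completion using that by (intro SUP_upper) auto
    then show ?thesis using S by simp
  qed
  from hardy_Cauchy_formula[OF hol p this]
  obtain h where h: "cauchy_integrable h" "AE x in lborel. has_nt_limit f x (h x)"
    "\<And>z. Im z > 0 \<Longrightarrow> cauchy_int h z = 2 * of_real pi * \<i> * f z" "\<And>z. Im z < 0 \<Longrightarrow> cauchy_int h z = 0"
    by blast
  have nt: "AE x in lborel. has_nt_limit \<phi> x (h x)"
    using h(2) by eventually_elim (erule has_nt_limit_cong, simp add: \<phi>)
  then show "AE s in lborel. \<exists>L. has_nt_limit \<phi> s L" by eventually_elim blast
  have [measurable]: "h \<in> borel_measurable borel" by (rule cauchy_integrable_measurable[OF h(1)])
  have eq: "AE s in lborel. nt_boundary \<phi> s / (of_real s - z) = h s / (of_real s - z)" for z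
    using nt by eventually_elim (simp add: nt_boundary_eq)
  have m: "(\<lambda>s. h s / (of_real s - z)) \<in> borel_measurable borel" for z by measurable
  show "Im z \<noteq> 0 \<Longrightarrow> integrable lebesgue (\<lambda>s. nt_boundary \<phi> s / (of_real s - z))"
    using integral_lebesgue_AE_eq(1)[OF m eq] cauchy_integrableD[OF h(1)] by blast
  show "Im z > 0 \<Longrightarrow> (LINT s|lebesgue. nt_boundary \<phi> s / (of_real s - z)) = 2 * of_real pi * \<i> * \<phi> z"
    using integral_lebesgue_AE_eq(2)[OF m eq, of z] h(3)[of z] \<phi> by (simp add: cauchy_int_def)
  show "Im z < 0 \<Longrightarrow> (LINT s|lebesgue. nt_boundary \<phi> s / (of_real s - z)) = 0"
    using integral_lebesgue_AE_eq(2)[OF m eq, of z] h(4)[of z] by (simp add: cauchy_int_def)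
qed

text \<open>\<open>H\<close> is only Lebesgue measurable, so it is replaced by a Borel function
  equal to it almost everywhere; the Cauchy integrals do not change.\<close>

lemma Lp_line_boundary:
  assumes H: "H \<in> Lp_line p" and p: "p \<ge> 1"
    and zero: "\<forall>z. Im z < 0 \<longrightarrow> (LINT s|lebesgue. H s / (of_real s - z)) = 0"
  defines "f \<equiv> \<lambda>z. 1 / (2 * of_real pi * \<i>) * (LINT s|lebesgue. H s / (of_real s - z))"
  shows "f \<in> hardy p" "AE s in lborel. has_nt_limit f s (H s)"
    and "Im z \<noteq> 0 \<Longrightarrow> integrable lebesgue (\<lambda>s. H s / (of_real s - z))"
proof -
  have Hm: "H \<in> borel_measurable lebesgue" and Hi: "integrable lebesgue (\<lambda>s. cmod (H s) powr p)"
    using H by (auto simp: Lp_line_def)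
  obtain h where h[measurable]: "h \<in> borel_measurable borel" and Hh: "AE s in lborel. H s = h s"
    using lebesgue_measurable_AE_borel[OF Hm] by blast
  have "(\<integral>\<^sup>+ s. ennreal (cmod (h s) powr p) \<partial>lborel) = (\<integral>\<^sup>+ s. ennreal (cmod (H s) powr p) \<partial>lebesgue)"
    unfolding nn_integral_completion by (intro nn_integral_cong_AE, use Hh in eventually_elim) simp
  also have "\<dots> < \<infinity>" using Hi by (simp add: integrable_iff_bounded)
  finally have hp: "(\<integral>\<^sup>+ s. ennreal (cmod (h s) powr p) \<partial>lborel) < \<infinity>" .
  have eq: "AE s in lborel. H s / (of_real s - z) = h s / (of_real s - z)" for z
    using Hh by eventually_elim simp
  have m: "(\<lambda>s. h s / (of_real s - z)) \<in> borel_measurable borel" for z by measurable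
  have ints: "(LINT s|lebesgue. H s / (of_real s - z)) = cauchy_int h z" for z
    unfolding cauchy_int_def by (rule integral_lebesgue_AE_eq(2)[OF m eq])
  have f: "f = (\<lambda>z. 1 / (2 * of_real pi * \<i>) * cauchy_int h z)"
    unfolding f_def ints ..
  have z0: "cauchy_int h z = 0" if "Im z < 0" for z using zero that by (simp add: ints)
  show "f \<in> hardy p" unfolding f by (rule Cauchy_integral_hardy(1)[OF h p hp z0])
  have "AE s in lborel. has_nt_limit f s (h s)"
    unfolding f by (rule Cauchy_integral_hardy(2)[OF h p hp z0])
  with Hh show "AE s in lborel. has_nt_limit f s (H s)" by eventually_elim simp
  show "Im z \<noteq> 0 \<Longrightarrow> integrable lebesgue (\<lambda>s. H s / (of_real s - z))"
    using integral_lebesgue_AE_eq(1)[OF m eq] cauchy_integrableD[OF Lp_cauchy_integrable[OF h p hp]] by blast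
qed

theorem theorem3p3:
  fixes p :: real
  assumes "1 \<le> p"
  shows "(\<forall>F \<in> bc_hardy p.
      (AE (x0, x3) in lebesgue. bc_boundary_exists F (bc_hyp x0 x3)) \<and>
      (\<forall>Z \<in> bc_upper. bc_integrable (\<lambda>W. bc_boundary F W / (W - Z)) \<and>
        F Z = bc_of_complex (1 / (2 * of_real pi * \<i>)) *
              bc_integral (\<lambda>W. bc_boundary F W / (W - Z))) \<and>
      (\<forall>Z \<in> bc_lower. bc_integrable (\<lambda>W. bc_boundary F W / (W - Z)) \<and>
        bc_integral (\<lambda>W. bc_boundary F W / (W - Z)) = 0)) \<and>
    (\<forall>H \<in> bc_Lp p.
      (\<forall>Z \<in> bc_lower. bc_of_complex (1 / (2 * of_real pi * \<i>)) *
                       bc_integral (\<lambda>W. H W / (W - Z)) = 0) \<longrightarrow>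
      (\<exists>F \<in> bc_hardy p.
        (\<forall>Z \<in> bc_upper. bc_integrable (\<lambda>W. H W / (W - Z)) \<and>
          F Z = bc_of_complex (1 / (2 * of_real pi * \<i>)) *
                bc_integral (\<lambda>W. H W / (W - Z))) \<and>
        (AE (x0, x3) in lebesgue. bc_boundary_exists F (bc_hyp x0 x3) \<and>
          bc_boundary F (bc_hyp x0 x3) = H (bc_hyp x0 x3))))"
proof (intro conjI ballI impI)
  let ?c = "1 / (2 * of_real pi * \<i>)"
  fix F assume "F \<in> bc_hardy p"
  then obtain F1 F2 where F12: "F1 \<in> hardy p" "F2 \<in> hardy p"
    and F: "\<And>b1 b2. Im b1 > 0 \<Longrightarrow> Im b2 > 0 \<Longrightarrow> F (bc_idem b1 b2) = bc_idem (F1 b1) (F2 b2)"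
    by (auto simp: bc_hardy_def)
  have eq: "\<forall>z. Im z > 0 \<longrightarrow> bc_fun1 F z = F1 z" "\<forall>z. Im z > 0 \<longrightarrow> bc_fun2 F z = F2 z"
    using bc_fun_product[of "{z. Im z > 0}" F F1 F2] F by auto
  note b1 = hardy_boundary_integrals[OF F12(1) assms eq(1)]
  note b2 = hardy_boundary_integrals[OF F12(2) assms eq(2)]
  show "AE (x0, x3) in lebesgue. bc_boundary_exists F (bc_hyp x0 x3)"
    using AE_hyperbolic[OF b1(1) b2(1)]
    by (simp add: bc_boundary_exists_def bc_hyp_eq_idem)
  have comp: "bc_fun1 (\<lambda>W. bc_boundary F W / (W - bc_idem c1 c2)) (of_real s) = nt_boundary (bc_fun1 F) s / (of_real s - c1)"
    "bc_fun2 (\<lambda>W. bc_boundary F W / (W - bc_idem c1 c2)) (of_real s) = nt_boundary (bc_fun2 F) s / (of_real s - c2)"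
    for s c1 c2
  proof -
    have "bc_fun1 (\<lambda>W. bc_boundary F W / (W - bc_idem c1 c2)) (of_real s)
        = bc_comp1 (bc_boundary F (bc_of_complex (of_real s)) / (bc_of_complex (of_real s) - bc_idem c1 c2))"
      "bc_fun2 (\<lambda>W. bc_boundary F W / (W - bc_idem c1 c2)) (of_real s)
        = bc_comp2 (bc_boundary F (bc_of_complex (of_real s)) / (bc_of_complex (of_real s) - bc_idem c1 c2))"
      by (rule bc_fun1_def bc_fun2_def)+
    then show "bc_fun1 (\<lambda>W. bc_boundary F W / (W - bc_idem c1 c2)) (of_real s) = nt_boundary (bc_fun1 F) s / (of_real s - c1)"
      "bc_fun2 (\<lambda>W. bc_boundary F W / (W - bc_idem c1 c2)) (of_real s) = nt_boundary (bc_fun2 F) s / (of_real s - c2)"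
      by (simp_all add: bc_boundary_def)
  qed
  {
    fix Z assume "Z \<in> bc_upper"
    then obtain c1 c2 where Z: "Z = bc_idem c1 c2" "Im c1 > 0" "Im c2 > 0" by (auto simp: bc_upper_def)
    show "bc_integrable (\<lambda>W. bc_boundary F W / (W - Z))"
      unfolding Z(1) bc_integrable_def comp using b1(2)[of c1] b2(2)[of c2] Z by simp
    show "F Z = bc_of_complex ?c * bc_integral (\<lambda>W. bc_boundary F W / (W - Z))"
      unfolding Z(1) bc_integral_def comp
      using b1(3)[OF Z(2)] b2(3)[OF Z(3)] F[OF Z(2,3)] eq Z
      by (simp add: bicomplex_eq_iff)
  }
  {
    fix Z assume "Z \<in> bc_lower"
    then obtain c1 c2 where Z: "Z = bc_idem c1 c2" "Im c1 < 0" "Im c2 < 0" by (auto simp: bc_lower_def)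
    show "bc_integrable (\<lambda>W. bc_boundary F W / (W - Z))"
      unfolding Z(1) bc_integrable_def comp using b1(2)[of c1] b2(2)[of c2] Z by simp
    show "bc_integral (\<lambda>W. bc_boundary F W / (W - Z)) = 0"
      unfolding Z(1) bc_integral_def comp b1(4)[OF Z(2)] b2(4)[OF Z(3)]
      by (simp add: bc_idem_explicit zero_bicomplex_def)
  }
next
  let ?c = "1 / (2 * of_real pi * \<i>)"
  fix H assume "H \<in> bc_Lp p"
    and zero: "\<forall>Z\<in>bc_lower. bc_of_complex ?c * bc_integral (\<lambda>W. H W / (W - Z)) = 0"
  then obtain H1 H2 where H12: "H1 \<in> Lp_line p" "H2 \<in> Lp_line p"
    and H: "\<And>s1 s2 :: real. H (bc_idem (of_real s1) (of_real s2)) = bc_idem (H1 s1) (H2 s2)"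
    by (auto simp: bc_Lp_def)
  note int = bc_integral_cauchy[of H H1 H2, OF H]
  have zero12': "(LINT s|lebesgue. H1 s / (of_real s - z)) = 0 \<and> (LINT s|lebesgue. H2 s / (of_real s - z)) = 0"
    if "Im z < 0" for z
  proof -
    \<comment> \<open>The diagonal points are enough: the vanishing of one bicomplex number
      separates into the vanishing of both components at \<open>z\<close>.\<close>
    have "bc_idem z z \<in> bc_lower" using that by (auto simp: bc_lower_def)
    with zero have "bc_of_complex ?c * bc_integral (\<lambda>W. H W / (W - bc_idem z z)) = 0" by blast
    moreover have "bc_comp1 0 = 0" "bc_comp2 0 = 0" by (simp_all add: bc_comp1_def bc_comp2_def zero_bicomplex_def)
    ultimately show ?thesis by (simp add: int bicomplex_eq_iff)
  qed
  then have zero12: "\<forall>z. Im z < 0 \<longrightarrow> (LINT s|lebesgue. H1 s / (of_real s - z)) = 0"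
    "\<forall>z. Im z < 0 \<longrightarrow> (LINT s|lebesgue. H2 s / (of_real s - z)) = 0"
    by blast+
  define f1 f2 where "f1 = (\<lambda>z. ?c * (LINT s|lebesgue. H1 s / (of_real s - z)))"
    and "f2 = (\<lambda>z. ?c * (LINT s|lebesgue. H2 s / (of_real s - z)))"
  note l1 = Lp_line_boundary[OF H12(1) assms zero12(1), folded f1_def]
  note l2 = Lp_line_boundary[OF H12(2) assms zero12(2), folded f2_def]
  \<comment> \<open>Defined by the integral for every \<open>Z\<close>, so the representation holds
    by definition and the components are \<open>f1\<close> and \<open>f2\<close> without restriction
    on the arguments.\<close>
  define F where "F = (\<lambda>Z. bc_of_complex ?c * bc_integral (\<lambda>W. H W / (W - Z)))"
  have F: "F (bc_idem b1 b2) = bc_idem (f1 b1) (f2 b2)" for b1 b2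
    by (simp add: F_def int f1_def f2_def bicomplex_eq_iff)
  have fF: "bc_fun1 F = f1" "bc_fun2 F = f2"
    by (auto simp: bc_fun1_def bc_fun2_def bc_of_complex_eq_idem F)
  show "\<exists>F\<in>bc_hardy p.
      (\<forall>Z\<in>bc_upper. bc_integrable (\<lambda>W. H W / (W - Z)) \<and> F Z = bc_of_complex ?c * bc_integral (\<lambda>W. H W / (W - Z))) \<and>
      (AE (x0, x3) in lebesgue. bc_boundary_exists F (bc_hyp x0 x3) \<and> bc_boundary F (bc_hyp x0 x3) = H (bc_hyp x0 x3))"
  proof (intro bexI[of _ F] conjI ballI)
    show "F \<in> bc_hardy p" unfolding bc_hardy_def using l1(1) l2(1) F by blast
    show "F Z = bc_of_complex ?c * bc_integral (\<lambda>W. H W / (W - Z))" for Z by (simp add: F_def)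
    show "bc_integrable (\<lambda>W. H W / (W - Z))" if Zu: "Z \<in> bc_upper" for Z
    proof -
      obtain c1 c2 where Z: "Z = bc_idem c1 c2" "Im c1 > 0" "Im c2 > 0" using Zu by (auto simp: bc_upper_def)
      have "bc_fun1 (\<lambda>W. H W / (W - Z)) (of_real s) = H1 s / (of_real s - c1)"
        "bc_fun2 (\<lambda>W. H W / (W - Z)) (of_real s) = H2 s / (of_real s - c2)" for s
        using H[of s s] by (simp_all add: bc_fun1_def bc_fun2_def Z(1) bc_of_complex_eq_idem)
      then show ?thesis using l1(3)[of c1] l2(3)[of c2] Z by (simp add: bc_integrable_def)
    qed
    show "AE (x0, x3) in lebesgue. bc_boundary_exists F (bc_hyp x0 x3) \<and> bc_boundary F (bc_hyp x0 x3) = H (bc_hyp x0 x3)"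
      using AE_hyperbolic[OF l1(2) l2(2)]
    proof (rule eventually_mono, clarify)
      fix x0 x3 assume nt: "has_nt_limit f1 (x0 + x3) (H1 (x0 + x3))" "has_nt_limit f2 (x0 - x3) (H2 (x0 - x3))"
      have W: "Re (bc_comp1 (bc_hyp x0 x3)) = x0 + x3" "Re (bc_comp2 (bc_hyp x0 x3)) = x0 - x3"
        by (simp_all add: bc_hyp_eq_idem)
      show "bc_boundary_exists F (bc_hyp x0 x3) \<and> bc_boundary F (bc_hyp x0 x3) = H (bc_hyp x0 x3)"
        unfolding bc_boundary_exists_def bc_boundary_def W fF nt_boundary_eq[OF nt(1)] nt_boundary_eq[OF nt(2)]
        using nt H[of "x0 + x3" "x0 - x3"] by (auto simp only: bc_hyp_eq_idem)
    qed
  qed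
qed

end
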